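(* Let $\kappa\ge0$ and $\lambda>0$. For $f:[0,\infty)\to\mathbb{R}$ and $x\ge0$ let $$v(x)=\inf_{u\in\mathscr{U}}\mathbb{E}_x\int_0^\infty e^{-\lambda t}f(X_t)\,dt,$$ where $\mathscr{U}$ is the set of adapted real-valued processes $u=(u_t)_{t\ge0}$ with $|u|_\infty\le\kappa$ and, for $u\in\mathscr{U}$, $X$ is the controlled process reflected at zero $X_t=x+W_t+\int_0^tu_s\,ds+L_t^u$. (i) If $f(x)=x$, then for $x\in[0,\infty)$ $$v(x)=\frac{e^{(\kappa-\sqrt{\kappa^2+2\lambda})x}}{\lambda(-\kappa+\sqrt{\kappa^2+2\lambda})}+\frac{x}{\lambda}-\frac{\kappa}{\lambda^2}.$$ (ii) If $f(x)=x^2$, then for $x\in[0,\infty)$ $$v(x)=\frac{2\kappa\,e^{(\kappa-\sqrt{\kappa^2+2\lambda})x}}{\lambda^2(\kappa-\sqrt{\kappa^2+2\lambda})}+\frac{x^2}{\lambda}-\frac{2\kappa x}{\lambda^2}+\frac{2\kappa^2+\lambda}{\lambda^3}.$$ In both cases $v'(x)>0$ for every $x>0$, and the constant control $u_t^*=-\kappa$ is optimal (attains the infimum), the optimal controlled process being $X_t=x+W_t-\kappa t+L_t$.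
   Context: $W$ is a standard one-dimensional Brownian motion on a filtered probability space; controls $u$ are adapted (progressively measurable) to its filtration. $X\ge0$, and $L^u$ (written $L$ for the optimal process) is continuous, increasing, $L_0^u=0$, and increases only on $\{t\ge0:X_t=0\}$. $\mathbb{E}_x$ denotes expectation when $X_0=x$. *)

theory Defs
  imports "HOL-Probability.Probability"
begin

text \<open>
  Time is indexed by type \<^typ>\<open>real\<close>; only times \<open>t \<ge> 0\<close> matter. A filtration \<open>(F\<^sub>t)\<close>
  on \<open>[0,\<infinity>)\<close> fits the library locale by setting \<open>F\<^sub>t = F\<^sub>0\<close> for \<open>t < 0\<close>.
  Neither completeness nor right-continuity of the filtration is assumed; path properties and
  the state equation are therefore required almost surely.
\<close>

locale filtered_prob_space = prob_space M + filtration "space M" F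
  for M :: "'a measure" and F :: "real \<Rightarrow> 'a measure" +
  assumes subalgebra_F: "t \<ge> 0 \<Longrightarrow> subalgebra M (F t)"

definition adapted :: "(real \<Rightarrow> 'a measure) \<Rightarrow> (real \<Rightarrow> 'a \<Rightarrow> real) \<Rightarrow> bool" where
  "adapted F Y \<longleftrightarrow> (\<forall>t\<ge>0. Y t \<in> borel_measurable (F t))"

definition progressively_measurable ::
    "(real \<Rightarrow> 'a measure) \<Rightarrow> (real \<Rightarrow> 'a \<Rightarrow> real) \<Rightarrow> bool" where
  "progressively_measurable F Y \<longleftrightarrow>
     (\<forall>t\<ge>0. (\<lambda>(s, \<omega>). Y s \<omega>) \<in> borel_measurable (restrict_space borel {0..t} \<Otimes>\<^sub>M F t))"

locale standard_brownian_motion = filtered_prob_space M F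
  for M :: "'a measure" and F :: "real \<Rightarrow> 'a measure" +
  fixes W :: "real \<Rightarrow> 'a \<Rightarrow> real"
  assumes adapted_W: "adapted F W"
    and W_zero: "AE \<omega> in M. W 0 \<omega> = 0"
    and W_continuous: "AE \<omega> in M. continuous_on {0..} (\<lambda>t. W t \<omega>)"
    and W_normal: "0 \<le> s \<Longrightarrow> s < t \<Longrightarrow>
      distributed M lborel (\<lambda>\<omega>. W t \<omega> - W s \<omega>) (normal_density 0 (sqrt (t - s)))"
    and W_indep: "0 \<le> s \<Longrightarrow> s < t \<Longrightarrow>
      indep_set {(\<lambda>\<omega>. W t \<omega> - W s \<omega>) -` A \<inter> space M |A. A \<in> sets borel} (sets (F s))"

text \<open>\<open>|u|\<^sub>\<infinity>\<close> is the essential supremum over \<open>[0,\<infinity>) \<times> \<Omega>\<close> with respect to \<open>dt \<Otimes> P\<close>.\<close>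

definition controls ::
    "'a measure \<Rightarrow> (real \<Rightarrow> 'a measure) \<Rightarrow> real \<Rightarrow> (real \<Rightarrow> 'a \<Rightarrow> real) set" where
  "controls M F \<kappa> = {u. progressively_measurable F u \<and>
     esssup (restrict_space lborel {0..} \<Otimes>\<^sub>M M) (\<lambda>(t, \<omega>). ereal \<bar>u t \<omega>\<bar>) \<le> ereal \<kappa>}"

text \<open>Points of increase of an increasing path \<open>l\<close> on \<open>[0,\<infinity>)\<close>: \<open>l\<close> is not constant on any
  neighbourhood (relative to \<open>[0,\<infinity>)\<close>) of \<open>t\<close>. This is the support of the measure \<open>dl\<close>.\<close>

definition point_of_increase :: "(real \<Rightarrow> real) \<Rightarrow> real \<Rightarrow> bool" where
  "point_of_increase l t \<longleftrightarrow> 0 \<le> t \<and>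
     (\<forall>e>0. \<exists>r s. 0 \<le> r \<and> r < s \<and> \<bar>r - t\<bar> < e \<and> \<bar>s - t\<bar> < e \<and> l r < l s)"

definition reflected_process ::
    "'a measure \<Rightarrow> (real \<Rightarrow> 'a measure) \<Rightarrow> (real \<Rightarrow> 'a \<Rightarrow> real) \<Rightarrow> real \<Rightarrow> (real \<Rightarrow> 'a \<Rightarrow> real)
      \<Rightarrow> (real \<Rightarrow> 'a \<Rightarrow> real) \<Rightarrow> (real \<Rightarrow> 'a \<Rightarrow> real) \<Rightarrow> bool" where
  "reflected_process M F W x u X L \<longleftrightarrow>
     adapted F X \<and> adapted F L \<and>
     (AE \<omega> in M.
        (\<forall>t\<ge>0. X t \<omega> = x + W t \<omega> + (LBINT s:{0..t}. u s \<omega>) + L t \<omega>) \<and>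
        (\<forall>t\<ge>0. 0 \<le> X t \<omega>) \<and>
        continuous_on {0..} (\<lambda>t. L t \<omega>) \<and>
        mono_on {0..} (\<lambda>t. L t \<omega>) \<and>
        L 0 \<omega> = 0 \<and>
        (\<forall>t. point_of_increase (\<lambda>s. L s \<omega>) t \<longrightarrow> X t \<omega> = 0))"

text \<open>Integral with values in the extended reals, so that no integrability of the cost has to be
  presupposed. As \<open>\<infinity> - \<infinity> = \<infinity>\<close> in \<^typ>\<open>ereal\<close>, an undefined cost counts as \<open>\<infinity>\<close>.\<close>

definition extended_integral :: "'b measure \<Rightarrow> ('b \<Rightarrow> ereal) \<Rightarrow> ereal" where
  "extended_integral N g =
     enn2ereal (\<integral>\<^sup>+ y. e2ennreal (g y) \<partial>N) - enn2ereal (\<integral>\<^sup>+ y. e2ennreal (- g y) \<partial>N)"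

definition discounted_cost ::
    "'a measure \<Rightarrow> real \<Rightarrow> (real \<Rightarrow> real) \<Rightarrow> (real \<Rightarrow> 'a \<Rightarrow> real) \<Rightarrow> ereal" where
  "discounted_cost M lam f X =
     extended_integral M (\<lambda>\<omega>.
       extended_integral (restrict_space lborel {0..}) (\<lambda>t. ereal (exp (- lam * t) * f (X t \<omega>))))"

text \<open>The pair \<open>(X, L)\<close> is determined by \<open>u\<close> up to indistinguishability, so the infimum over all
  triples \<open>(u, X, L)\<close> is the infimum over \<open>u\<close>.\<close>

definition value_function ::
    "'a measure \<Rightarrow> (real \<Rightarrow> 'a measure) \<Rightarrow> (real \<Rightarrow> 'a \<Rightarrow> real) \<Rightarrow> real \<Rightarrow> real
      \<Rightarrow> (real \<Rightarrow> real) \<Rightarrow> real \<Rightarrow> ereal" where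
  "value_function M F W \<kappa> lam f x =
     Inf {discounted_cost M lam f X |u X L. u \<in> controls M F \<kappa> \<and> reflected_process M F W x u X L}"

end

theory Submission
  imports Defs "HOL-Real_Asymp.Real_Asymp"
begin

text \<open>
  If \<open>u \<ge> -\<kappa>\<close>, the increments of the driving path dominate those of \<open>Y\<^sub>t = W\<^sub>t - \<kappa> t\<close>, so by
  Skorokhod's formula the reflected path dominates, pathwise, the path
  \<open>X\<^sub>t = x + Y\<^sub>t + (D\<^sub>t - x)\<^sup>+\<close> with \<open>D\<^sub>t = sup\<^bsub>s \<le> t\<^esub> (- Y\<^sub>s)\<close>, which belongs to \<open>u = -\<kappa>\<close>. As both
  cost functions increase on \<open>[0,\<infinity>)\<close>, the value is the cost of \<open>u = -\<kappa>\<close>, and no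
  Hamilton-Jacobi-Bellman equation is needed.

  That cost is computed by cutting \<open>L\<^sub>t = (D\<^sub>t - x)\<^sup>+ = \<integral>\<^sub>x\<^sup>\<infinity> 1{D\<^sub>t \<ge> z} dz\<close> into layers. Let \<open>\<tau>\<^sub>z\<close> be the first
  time at which \<open>Y = -z\<close>, so that \<open>D\<^sub>t \<ge> z\<close> means \<open>\<tau>\<^sub>z \<le> t\<close>. Stopping \<open>exp(\<gamma> Y\<^sub>t - \<lambda> t)\<close> at \<open>\<tau>\<^sub>z\<close>
  gives \<open>E exp(-\<lambda> \<tau>\<^sub>z) = exp(\<gamma> z)\<close> and hence the discounted mean of \<open>L\<close>. Stopping \<open>W\<close> itself gives
  \<open>E[(z + Y\<^sub>t) 1{\<tau>\<^sub>z \<le> t}] = - \<kappa> \<integral>\<^sub>0\<^sup>t P(\<tau>\<^sub>z \<le> s) ds\<close>, and integrating this over \<open>z \<ge> x\<close> yields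
  \<open>E X\<^sub>t\<^sup>2 = x\<^sup>2 + t - 2 \<kappa> \<integral>\<^sub>0\<^sup>t E X\<^sub>s ds\<close>, the identity that Ito's formula would provide; it reduces the
  quadratic cost to the linear one.
\<close>

section \<open>Square integrable martingales of Brownian motion\<close>

text \<open>The setting itself creates an obstacle. Paths of \<open>W\<close> are continuous only
  almost surely and \<open>F\<close> need not contain the null sets, whereas suprema, hitting times
  and the intermediate value theorem want every path continuous. All pathwise work is therefore done
  for a modification \<open>W'\<close> adapted to an augmented filtration \<open>F'\<close>. The
  optimal pair must nevertheless be adapted to \<open>F\<close> itself, so it is rebuilt from
  \<open>W\<close> by a countable supremum and only then identified, almost surely, with the one
  built from \<open>W'\<close>.

  Optional stopping is proved without a maximal inequality: uniformly bounded second moments take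
  the place of a dominating function.

  The quadratic case rests on 2 (z + Y_t) being the derivative of (z + Y_t)^2 in z. Integrating it
  from x to D_t gives X_t^2 - (x + Y_t)^2, which is why the mean of z + Y_t on the hitting event is
  the quantity to compute.\<close>

lemma (in prob_space) integral_tendsto_of_second_moment_bound:
  fixes f :: "nat \<Rightarrow> 'a \<Rightarrow> real"
  assumes f: "\<And>n. f n \<in> borel_measurable M" and g: "g \<in> borel_measurable M"
    and lim: "\<And>\<omega>. \<omega> \<in> space M \<Longrightarrow> (\<lambda>n. f n \<omega>) \<longlonglongrightarrow> g \<omega>"
    and sq: "\<And>n. integrable M (\<lambda>\<omega>. (f n \<omega>)\<^sup>2)" and bound: "\<And>n. (\<integral>\<omega>. (f n \<omega>)\<^sup>2 \<partial>M) \<le> C"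
  shows "integrable M g" and "(\<lambda>n. \<integral>\<omega>. f n \<omega> \<partial>M) \<longlonglongrightarrow> (\<integral>\<omega>. g \<omega> \<partial>M)"
proof -
  note [measurable] = f g
  have C0: "C \<ge> 0"
    using order_trans[OF integral_nonneg_AE bound[of 0]] by simp
  \<comment> \<open>Fatou's lemma hands the bound \<open>C\<close> on to the limit, so that the
    differences f n - g have second moments at most 4 C.\<close>
  have "(\<integral>\<^sup>+\<omega>. ennreal ((g \<omega>)\<^sup>2) \<partial>M) = (\<integral>\<^sup>+\<omega>. liminf (\<lambda>n. ennreal ((f n \<omega>)\<^sup>2)) \<partial>M)"
  proof (intro nn_integral_cong)
    fix \<omega> assume "\<omega> \<in> space M"
    then have "(\<lambda>n. ennreal ((f n \<omega>)\<^sup>2)) \<longlonglongrightarrow> ennreal ((g \<omega>)\<^sup>2)"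
      by (intro tendsto_ennrealI tendsto_power lim)
    then show "ennreal ((g \<omega>)\<^sup>2) = liminf (\<lambda>n. ennreal ((f n \<omega>)\<^sup>2))"
      by (intro lim_imp_Liminf[symmetric]) auto
  qed
  also have "\<dots> \<le> liminf (\<lambda>n. \<integral>\<^sup>+\<omega>. ennreal ((f n \<omega>)\<^sup>2) \<partial>M)"
    by (intro nn_integral_liminf) auto
  also have "\<dots> \<le> ennreal C"
    by (intro Liminf_le always_eventually allI) (auto simp: nn_integral_eq_integral[OF sq] bound ennreal_leI)
  finally have gC: "(\<integral>\<^sup>+\<omega>. ennreal ((g \<omega>)\<^sup>2) \<partial>M) \<le> ennreal C" .
  have g2: "integrable M (\<lambda>\<omega>. (g \<omega>)\<^sup>2)"
    by (rule integrableI_bounded) (use gC in \<open>auto simp: less_top[symmetric] top_unique\<close>)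
  have gC': "(\<integral>\<omega>. (g \<omega>)\<^sup>2 \<partial>M) \<le> C"
    using gC C0 by (simp add: nn_integral_eq_integral[OF g2])
  show ig: "integrable M g"
    by (rule square_integrable_imp_integrable[OF g g2])
  have ifn: "integrable M (f n)" for n
    by (rule square_integrable_imp_integrable[OF f sq])
  have id: "integrable M (\<lambda>\<omega>. \<bar>f n \<omega> - g \<omega>\<bar>)" for n
    using ifn ig by auto
  have d2: "integrable M (\<lambda>\<omega>. (f n \<omega> - g \<omega>)\<^sup>2)" and d2C: "(\<integral>\<omega>. (f n \<omega> - g \<omega>)\<^sup>2 \<partial>M) \<le> 4 * C" for n
  proof -
    have le: "(f n \<omega> - g \<omega>)\<^sup>2 \<le> 2 * (f n \<omega>)\<^sup>2 + 2 * (g \<omega>)\<^sup>2" for \<omega>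
      using zero_le_power2[of "f n \<omega> + g \<omega>"] by (simp add: power2_eq_square algebra_simps)
    show d2: "integrable M (\<lambda>\<omega>. (f n \<omega> - g \<omega>)\<^sup>2)"
      by (rule Bochner_Integration.integrable_bound[where f="\<lambda>\<omega>. 2 * (f n \<omega>)\<^sup>2 + 2 * (g \<omega>)\<^sup>2"])
         (use le sq g2 in auto)
    have "(\<integral>\<omega>. (f n \<omega> - g \<omega>)\<^sup>2 \<partial>M) \<le> (\<integral>\<omega>. 2 * (f n \<omega>)\<^sup>2 + 2 * (g \<omega>)\<^sup>2 \<partial>M)"
      by (intro integral_mono d2 le) (use sq g2 in auto)
    also have "\<dots> = 2 * (\<integral>\<omega>. (f n \<omega>)\<^sup>2 \<partial>M) + 2 * (\<integral>\<omega>. (g \<omega>)\<^sup>2 \<partial>M)"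
      using sq g2 by simp
    finally show "(\<integral>\<omega>. (f n \<omega> - g \<omega>)\<^sup>2 \<partial>M) \<le> 4 * C"
      using bound[of n] gC' by simp
  qed
  show "(\<lambda>n. \<integral>\<omega>. f n \<omega> \<partial>M) \<longlonglongrightarrow> (\<integral>\<omega>. g \<omega> \<partial>M)"
  proof (rule LIMSEQ_I)
    fix e :: real assume e: "e > 0"
    \<comment> \<open>The bound |d| \<le> min |d| K + d^2 / K splits the error into a part dominated
      by \<open>K\<close> and a part of mean at most 4 C / K. This \<open>K\<close> makes the latter
      at most e / 2; the added 1 keeps it positive when C = 0.\<close>
    define K where "K = 8 * C / e + 1"
    have K: "K > 0" using C0 e by (auto simp: K_def add_nonneg_pos)
    have "(\<lambda>n. \<integral>\<omega>. min \<bar>f n \<omega> - g \<omega>\<bar> K \<partial>M) \<longlonglongrightarrow> (\<integral>\<omega>. 0 \<partial>M)"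
    proof (rule integral_dominated_convergence[where w="\<lambda>_. K"])
      show "AE \<omega> in M. (\<lambda>n. min \<bar>f n \<omega> - g \<omega>\<bar> K) \<longlonglongrightarrow> 0"
      proof (intro AE_I2)
        fix \<omega> assume "\<omega> \<in> space M"
        then have "(\<lambda>n. min \<bar>f n \<omega> - g \<omega>\<bar> K) \<longlonglongrightarrow> min \<bar>g \<omega> - g \<omega>\<bar> K"
          by (intro tendsto_intros lim)
        then show "(\<lambda>n. min \<bar>f n \<omega> - g \<omega>\<bar> K) \<longlonglongrightarrow> 0" using K by simp
      qed
    qed (use K in auto)
    then obtain n0 where n0: "\<And>n. n \<ge> n0 \<Longrightarrow> \<bar>\<integral>\<omega>. min \<bar>f n \<omega> - g \<omega>\<bar> K \<partial>M\<bar> < e / 2"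
      using LIMSEQ_D[of "\<lambda>n. \<integral>\<omega>. min \<bar>f n \<omega> - g \<omega>\<bar> K \<partial>M" 0 "e/2"] e by auto
    have "norm ((\<integral>\<omega>. f n \<omega> \<partial>M) - (\<integral>\<omega>. g \<omega> \<partial>M)) < e" if n: "n \<ge> n0" for n
    proof -
      have im: "integrable M (\<lambda>\<omega>. min \<bar>f n \<omega> - g \<omega>\<bar> K)"
        by (rule Bochner_Integration.integrable_bound[OF id[of n]]) (use K in auto)
      have le: "\<bar>f n \<omega> - g \<omega>\<bar> \<le> min \<bar>f n \<omega> - g \<omega>\<bar> K + (f n \<omega> - g \<omega>)\<^sup>2 / K" for \<omega>
      proof (cases "\<bar>f n \<omega> - g \<omega>\<bar> \<le> K")
        case True then show ?thesis using K by simp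
      next
        case False
        then have "K * \<bar>f n \<omega> - g \<omega>\<bar> \<le> \<bar>f n \<omega> - g \<omega>\<bar> * \<bar>f n \<omega> - g \<omega>\<bar>"
          by (intro mult_right_mono) auto
        then have "\<bar>f n \<omega> - g \<omega>\<bar> \<le> (f n \<omega> - g \<omega>)\<^sup>2 / K"
          using K by (simp add: pos_le_divide_eq power2_eq_square mult.commute)
        then show ?thesis using K False by simp
      qed
      have "norm ((\<integral>\<omega>. f n \<omega> \<partial>M) - (\<integral>\<omega>. g \<omega> \<partial>M)) = \<bar>\<integral>\<omega>. f n \<omega> - g \<omega> \<partial>M\<bar>"
        using ifn ig by simp
      also have "\<dots> \<le> (\<integral>\<omega>. \<bar>f n \<omega> - g \<omega>\<bar> \<partial>M)" by (rule integral_abs_bound)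
      also have "\<dots> \<le> (\<integral>\<omega>. min \<bar>f n \<omega> - g \<omega>\<bar> K + (f n \<omega> - g \<omega>)\<^sup>2 / K \<partial>M)"
        by (intro integral_mono id le) (use im d2 in auto)
      also have "\<dots> = (\<integral>\<omega>. min \<bar>f n \<omega> - g \<omega>\<bar> K \<partial>M) + (\<integral>\<omega>. (f n \<omega> - g \<omega>)\<^sup>2 \<partial>M) / K"
        using im d2 by simp
      also have "\<dots> < e / 2 + 4 * C / K"
        using n0[OF n] divide_right_mono[OF d2C[of n], of K] K by auto
      also have "4 * C / K \<le> e / 2"
      proof -
        have "e / 2 * K = 4 * C + e / 2" using e by (simp add: K_def distrib_left)
        then show ?thesis using K e by (simp add: pos_divide_le_eq)
      qed
      finally show ?thesis by simp
    qed
    then show "\<exists>no. \<forall>n\<ge>no. norm ((\<integral>\<omega>. f n \<omega> \<partial>M) - (\<integral>\<omega>. g \<omega> \<partial>M)) < e" by blast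
  qed
qed

text \<open>Here every path is continuous, and setting it to 0 at negative times makes continuity
  hold on all of \<open>UNIV\<close>. Closed level sets, compactness and joint measurability then
  carry no exceptional null set and no side condition on time.\<close>

locale continuous_brownian_motion = prob_space M
  for M :: "'a measure" +
  fixes F :: "real \<Rightarrow> 'a measure" and W :: "real \<Rightarrow> 'a \<Rightarrow> real"
  assumes subalg: "0 \<le> t \<Longrightarrow> subalgebra M (F t)"
    and F_mono: "0 \<le> s \<Longrightarrow> s \<le> t \<Longrightarrow> sets (F s) \<subseteq> sets (F t)"
    and W_adapted: "0 \<le> t \<Longrightarrow> W t \<in> borel_measurable (F t)"
    and W_nonpos: "t \<le> 0 \<Longrightarrow> W t \<omega> = 0"
    and W_cont: "continuous_on UNIV (\<lambda>t. W t \<omega>)"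
    and W_incr: "0 \<le> s \<Longrightarrow> s < t \<Longrightarrow>
      distributed M lborel (\<lambda>\<omega>. W t \<omega> - W s \<omega>) (normal_density 0 (sqrt (t - s)))"
    and W_indep_past: "0 \<le> s \<Longrightarrow> s < t \<Longrightarrow>
      indep_set {(\<lambda>\<omega>. W t \<omega> - W s \<omega>) -` A \<inter> space M |A. A \<in> sets borel} (sets (F s))"
begin

section \<open>Independence and moments of the increments\<close>

lemma measurable_F: "0 \<le> t \<Longrightarrow> f \<in> borel_measurable (F t) \<Longrightarrow> f \<in> borel_measurable M"
  using measurable_from_subalg[OF subalg] by blast

lemma measurable_F_mono: "0 \<le> s \<Longrightarrow> s \<le> t \<Longrightarrow> f \<in> borel_measurable (F s) \<Longrightarrow> f \<in> borel_measurable (F t)"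
  using measurable_from_subalg[of "F t" "F s"] subalg[of s] subalg[of t] F_mono[of s t]
  by (auto simp: subalgebra_def)

lemma sets_F: "0 \<le> t \<Longrightarrow> A \<in> sets (F t) \<Longrightarrow> A \<in> sets M"
  using subalg by (auto simp: subalgebra_def)

lemma W_measurable [measurable]: "W t \<in> borel_measurable M"
proof (cases "t \<ge> 0")
  case True then show ?thesis using measurable_F W_adapted by blast
next
  case False
  then have "W t = (\<lambda>\<omega>. 0)" using W_nonpos by force
  then show ?thesis by simp
qed

text \<open>Preimages under \<open>g\<close> lie in \<open>F s\<close>, and preimages of Borel sets
  form a pi-system, so independence of events extends to the generated sigma-algebras and hence to
  the random variables.\<close>

lemma increment_indep_var:
  assumes "0 \<le> s" "s < t" and g: "g \<in> borel_measurable (F s)" and h: "h \<in> borel_measurable borel"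
  shows "indep_var borel g borel (\<lambda>\<omega>. h (W t \<omega> - W s \<omega>) :: real)"
proof -
  let ?D = "\<lambda>\<omega>. W t \<omega> - W s \<omega>"
  have gM: "g \<in> borel_measurable M" using measurable_F[OF assms(1) g] .
  have "indep_set (sets (F s)) {?D -` A \<inter> space M |A. A \<in> sets borel}"
    using W_indep_past[OF assms(1,2)] unfolding indep_sets2_eq
  proof (elim conjE, intro conjI ballI)
    fix a b assume ab: "a \<in> sets (F s)" "b \<in> {?D -` A \<inter> space M |A. A \<in> sets borel}"
      and *: "\<forall>a\<in>{?D -` A \<inter> space M |A. A \<in> sets borel}. \<forall>b\<in>sets (F s). prob (a \<inter> b) = prob a * prob b"
    show "prob (a \<inter> b) = prob a * prob b"
      using bspec[OF bspec[OF * ab(2)] ab(1)] by (simp only: Int_commute mult.commute)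
  qed
  moreover have sub: "{g -` A \<inter> space M |A. A \<in> sets borel} \<subseteq> sets (F s)"
    using measurable_sets[OF g] subalg[OF assms(1)] by (auto simp: subalgebra_def)
  ultimately have *: "indep_set {g -` A \<inter> space M |A. A \<in> sets borel} {?D -` A \<inter> space M |A. A \<in> sets borel}"
    unfolding indep_sets2_eq using sub by (meson subset_iff subset_trans)
  have Int: "Int_stable {f -` A \<inter> space M |A. A \<in> sets borel}" for f :: "'a \<Rightarrow> real"
  proof (rule Int_stableI)
    fix a b assume "a \<in> {f -` A \<inter> space M |A. A \<in> sets borel}" "b \<in> {f -` A \<inter> space M |A. A \<in> sets borel}"
    then obtain A B where "A \<in> sets borel" "B \<in> sets borel" "a = f -` A \<inter> space M" "b = f -` B \<inter> space M"
      by blast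
    then have "a \<inter> b = f -` (A \<inter> B) \<inter> space M" "A \<inter> B \<in> sets borel" by auto
    then show "a \<inter> b \<in> {f -` A \<inter> space M |A. A \<in> sets borel}" by blast
  qed
  have i: "indep_var borel g borel ?D"
    unfolding indep_var_eq by (intro conjI indep_set_sigma_sets Int * gM) measurable
  show ?thesis
    using indep_var_compose[OF i measurable_ident h] by (simp add: comp_def)
qed

lemma expectation_mult_increment:
  assumes "0 \<le> s" "s < t" "g \<in> borel_measurable (F s)" "h \<in> borel_measurable borel"
    "integrable M g" "integrable M (\<lambda>\<omega>. h (W t \<omega> - W s \<omega>) :: real)"
  shows "integrable M (\<lambda>\<omega>. g \<omega> * h (W t \<omega> - W s \<omega>))"
    and "(\<integral>\<omega>. g \<omega> * h (W t \<omega> - W s \<omega>) \<partial>M) = (\<integral>\<omega>. g \<omega> \<partial>M) * (\<integral>\<omega>. h (W t \<omega> - W s \<omega>) \<partial>M)"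
  using indep_var_integrable[OF increment_indep_var[OF assms(1-4)] assms(5,6)]
    indep_var_lebesgue_integral[OF increment_indep_var[OF assms(1-4)] assms(5,6)] by auto

lemma increment_moments:
  assumes "0 \<le> s" "s < t"
  shows "integrable M (\<lambda>\<omega>. W t \<omega> - W s \<omega>)" "(\<integral>\<omega>. W t \<omega> - W s \<omega> \<partial>M) = 0"
    "integrable M (\<lambda>\<omega>. (W t \<omega> - W s \<omega>)\<^sup>2)" "(\<integral>\<omega>. (W t \<omega> - W s \<omega>)\<^sup>2 \<partial>M) = t - s"
proof -
  note D = W_incr[OF assms]
  let ?\<sigma> = "sqrt (t - s)"
  have s: "?\<sigma> > 0" using assms by simp
  show "(\<integral>\<omega>. W t \<omega> - W s \<omega> \<partial>M) = 0"
    using normal_distributed_expectation[OF s D] .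
  show "(\<integral>\<omega>. (W t \<omega> - W s \<omega>)\<^sup>2 \<partial>M) = t - s"
    using normal_distributed_variance[OF s D] normal_distributed_expectation[OF s D] s by simp
  show "integrable M (\<lambda>\<omega>. (W t \<omega> - W s \<omega>)\<^sup>2)"
    using distributed_integrable[OF D, of "\<lambda>x. x\<^sup>2"] integrable_normal_moment[OF s, of 0 2] by simp
  show "integrable M (\<lambda>\<omega>. W t \<omega> - W s \<omega>)"
    using distributed_integrable[OF D, of "\<lambda>x. x"] integrable_normal_moment[OF s, of 0 1] by simp
qed

lemma increment_exp_moment:
  assumes "0 \<le> s" "s < t"
  shows "integrable M (\<lambda>\<omega>. exp (c * (W t \<omega> - W s \<omega>)))"
    and "(\<integral>\<omega>. exp (c * (W t \<omega> - W s \<omega>)) \<partial>M) = exp (c\<^sup>2 / 2 * (t - s))"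
proof -
  note D = W_incr[OF assms]
  define v where "v = t - s"
  have v: "v > 0" using assms by (simp add: v_def)
  have eq: "normal_density 0 (sqrt v) x * exp (c * x) = exp (c\<^sup>2 / 2 * v) * normal_density (c * v) (sqrt v) x" for x
  proof -
    \<comment> \<open>Completing the square: tilting the centred normal density by exp (c x) moves
      its mean to c v and leaves the factor exp (c^2 v / 2).\<close>
    have "- (x\<^sup>2 / (2 * v)) + c * x = c\<^sup>2 / 2 * v - (x - c * v)\<^sup>2 / (2 * v)"
      using v by (simp add: field_simps power2_eq_square)
    then have "exp (- (x\<^sup>2 / (2 * v))) * exp (c * x) = exp (c\<^sup>2 / 2 * v) * exp (- ((x - c * v)\<^sup>2 / (2 * v)))"
      by (simp add: mult_exp_exp)
    then show ?thesis using v by (simp add: normal_density_def)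
  qed
  have "integrable lborel (\<lambda>x. normal_density 0 (sqrt v) x * exp (c * x))"
    unfolding eq using v by simp
  then show "integrable M (\<lambda>\<omega>. exp (c * (W t \<omega> - W s \<omega>)))"
    using distributed_integrable[OF D, of "\<lambda>x. exp (c * x)"] by (simp add: v_def)
  have "(\<integral>\<omega>. exp (c * (W t \<omega> - W s \<omega>)) \<partial>M) = (\<integral>x. normal_density 0 (sqrt v) x * exp (c * x) \<partial>lborel)"
    using distributed_integral[OF D, of "\<lambda>x. exp (c * x)"] by (simp add: v_def)
  also have "\<dots> = exp (c\<^sup>2 / 2 * v)"
    unfolding eq using v by simp
  finally show "(\<integral>\<omega>. exp (c * (W t \<omega> - W s \<omega>)) \<partial>M) = exp (c\<^sup>2 / 2 * (t - s))" by (simp add: v_def)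
qed

lemma W_moments:
  assumes "0 \<le> t"
  shows "integrable M (W t)" "(\<integral>\<omega>. W t \<omega> \<partial>M) = 0" "integrable M (\<lambda>\<omega>. (W t \<omega>)\<^sup>2)" "(\<integral>\<omega>. (W t \<omega>)\<^sup>2 \<partial>M) = t"
proof -
  have "integrable M (W t) \<and> (\<integral>\<omega>. W t \<omega> \<partial>M) = 0 \<and> integrable M (\<lambda>\<omega>. (W t \<omega>)\<^sup>2) \<and> (\<integral>\<omega>. (W t \<omega>)\<^sup>2 \<partial>M) = t"
  proof (cases "t = 0")
    case True
    moreover have "W 0 = (\<lambda>\<omega>. 0)" using W_nonpos[of 0] by auto
    ultimately show ?thesis by simp
  next
    case False
    then show ?thesis
      using increment_moments[of 0 t] assms W_nonpos[of 0] by simp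
  qed
  then show "integrable M (W t)" "(\<integral>\<omega>. W t \<omega> \<partial>M) = 0" "integrable M (\<lambda>\<omega>. (W t \<omega>)\<^sup>2)" "(\<integral>\<omega>. (W t \<omega>)\<^sup>2 \<partial>M) = t"
    by auto
qed

end

text \<open>A square integrable martingale, restricted to the two consequences of the martingale property
  that optional stopping uses.\<close>

definition (in continuous_brownian_motion) L2_martingale :: "(real \<Rightarrow> 'a \<Rightarrow> real) \<Rightarrow> bool" where
  "L2_martingale N \<longleftrightarrow>
     (\<forall>\<omega>. continuous_on {0..} (\<lambda>t. N t \<omega>)) \<and>
     (\<forall>t\<ge>0. N t \<in> borel_measurable (F t) \<and> integrable M (\<lambda>\<omega>. (N t \<omega>)\<^sup>2)) \<and>
     (\<forall>s t A. 0 \<le> s \<longrightarrow> s \<le> t \<longrightarrow> A \<in> sets (F s) \<longrightarrow>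
        (\<integral>\<omega>. N t \<omega> * indicator A \<omega> \<partial>M) = (\<integral>\<omega>. N s \<omega> * indicator A \<omega> \<partial>M) \<and>
        (\<integral>\<omega>. (N s \<omega>)\<^sup>2 * indicator A \<omega> \<partial>M) \<le> (\<integral>\<omega>. (N t \<omega>)\<^sup>2 * indicator A \<omega> \<partial>M))"

section \<open>The martingales to be stopped: Brownian motion and its exponentials\<close>

context continuous_brownian_motion
begin

lemma L2_martingale_W: "L2_martingale W"
  unfolding L2_martingale_def
proof (intro conjI allI impI)
  show "continuous_on {0..} (\<lambda>t. W t \<omega>)" for \<omega>
    using W_cont continuous_on_subset by blast
  fix t :: real assume "0 \<le> t"
  then show "W t \<in> borel_measurable (F t)" "integrable M (\<lambda>\<omega>. (W t \<omega>)\<^sup>2)"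
    using W_adapted W_moments by auto
next
  fix s t A assume st: "0 \<le> s" "s \<le> t" and A: "A \<in> sets (F s)"
  have AM[measurable]: "A \<in> sets M" using sets_F[OF st(1) A] .
  have iA: "integrable M (indicator A :: _ \<Rightarrow> real)" by (simp add: integrable_real_indicator emeasure_eq_measure)
  have iWA: "integrable M (\<lambda>\<omega>. W r \<omega> * indicator A \<omega>)" if "r \<ge> 0" for r
    using integrable_mult_indicator[OF AM W_moments(1)[OF that]] by (simp add: mult.commute)
  have iW2A: "integrable M (\<lambda>\<omega>. (W r \<omega>)\<^sup>2 * indicator A \<omega>)" if "r \<ge> 0" for r
    using integrable_mult_indicator[OF AM W_moments(3)[OF that]] by (simp add: mult.commute)
  have mA: "(indicator A :: _ \<Rightarrow> real) \<in> borel_measurable (F s)" using A by simp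
  have mWA: "(\<lambda>\<omega>. W s \<omega> * indicator A \<omega>) \<in> borel_measurable (F s)"
    using W_adapted[OF st(1)] A by simp
  show "(\<integral>\<omega>. W t \<omega> * indicator A \<omega> \<partial>M) = (\<integral>\<omega>. W s \<omega> * indicator A \<omega> \<partial>M)"
  proof (cases "s = t")
    case False
    then have st': "s < t" using st by simp
    note im = increment_moments[OF st(1) st']
    note e = expectation_mult_increment[OF st(1) st' mA measurable_ident iA, simplified, OF im(1)]
    have "(\<integral>\<omega>. W t \<omega> * indicator A \<omega> \<partial>M)
        = (\<integral>\<omega>. W s \<omega> * indicator A \<omega> + indicator A \<omega> * (W t \<omega> - W s \<omega>) \<partial>M)"
      by (intro Bochner_Integration.integral_cong) (auto simp: algebra_simps)
    also have "\<dots> = (\<integral>\<omega>. W s \<omega> * indicator A \<omega> \<partial>M) + (\<integral>\<omega>. indicator A \<omega> * (W t \<omega> - W s \<omega>) \<partial>M)"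
      by (intro Bochner_Integration.integral_add iWA st e)
    finally show ?thesis using e(2) im(2) by simp
  qed simp
  show "(\<integral>\<omega>. (W s \<omega>)\<^sup>2 * indicator A \<omega> \<partial>M) \<le> (\<integral>\<omega>. (W t \<omega>)\<^sup>2 * indicator A \<omega> \<partial>M)"
  proof (cases "s = t")
    case False
    then have st': "s < t" using st by simp
    note im = increment_moments[OF st(1) st']
    note e = expectation_mult_increment[OF st(1) st' mWA measurable_ident iWA[OF st(1)], simplified, OF im(1)]
    \<comment> \<open>Expanding the square of W_t = W_s + (W_t - W_s): the cross term has mean zero
      on \<open>A\<close> by independence, and dropping the squared increment leaves the
      inequality.\<close>
    have "(\<integral>\<omega>. (W s \<omega>)\<^sup>2 * indicator A \<omega> \<partial>M) = (\<integral>\<omega>. (W s \<omega>)\<^sup>2 * indicator A \<omega> + 2 * (W s \<omega> * indicator A \<omega> * (W t \<omega> - W s \<omega>)) \<partial>M)"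
      using e im(2) iW2A[OF st(1)] by (subst Bochner_Integration.integral_add) (auto simp only: integrable_mult_right, simp)
    also have "\<dots> \<le> (\<integral>\<omega>. (W t \<omega>)\<^sup>2 * indicator A \<omega> \<partial>M)"
    proof (rule integral_mono)
      show "integrable M (\<lambda>\<omega>. (W s \<omega>)\<^sup>2 * indicator A \<omega> + 2 * (W s \<omega> * indicator A \<omega> * (W t \<omega> - W s \<omega>)))"
        using e(1) iW2A[OF st(1)] by (intro Bochner_Integration.integrable_add integrable_mult_right)
      show "integrable M (\<lambda>\<omega>. (W t \<omega>)\<^sup>2 * indicator A \<omega>)" using iW2A st by simp
      fix \<omega>
      have "(W s \<omega>)\<^sup>2 + 2 * (W s \<omega> * (W t \<omega> - W s \<omega>)) \<le> (W t \<omega>)\<^sup>2"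
        using zero_le_power2[of "W t \<omega> - W s \<omega>"] by (simp add: power2_eq_square algebra_simps)
      then show "(W s \<omega>)\<^sup>2 * indicator A \<omega> + 2 * (W s \<omega> * indicator A \<omega> * (W t \<omega> - W s \<omega>)) \<le> (W t \<omega>)\<^sup>2 * indicator A \<omega>"
        by (auto simp: indicator_def)
    qed
    finally show ?thesis .
  qed simp
qed

lemma L2_martingale_exp: "L2_martingale (\<lambda>t \<omega>. exp (c * W t \<omega> - c\<^sup>2 / 2 * t))"
  unfolding L2_martingale_def
proof (intro conjI allI impI)
  show "continuous_on {0..} (\<lambda>t. exp (c * W t \<omega> - c\<^sup>2 / 2 * t))" for \<omega>
    by (intro continuous_intros continuous_on_subset[OF W_cont]) auto
  fix t :: real assume t: "0 \<le> t"
  then show "(\<lambda>\<omega>. exp (c * W t \<omega> - c\<^sup>2 / 2 * t)) \<in> borel_measurable (F t)"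
    using W_adapted[OF t] by simp
next
  have iexp: "integrable M (\<lambda>\<omega>. exp (d * W r \<omega> - d' * r))" if "r \<ge> 0" for r d d'
    using increment_exp_moment(1)[of 0 r d] that
    by (cases "r = 0") (simp_all add: W_nonpos exp_diff)
  have sq: "(exp (c * W r \<omega> - c\<^sup>2 / 2 * r))\<^sup>2 = exp (2 * c * W r \<omega> - c\<^sup>2 * r)" for r \<omega>
    by (simp add: exp_double[symmetric] algebra_simps)
  fix t :: real assume t: "0 \<le> t"
  show "integrable M (\<lambda>\<omega>. (exp (c * W t \<omega> - c\<^sup>2 / 2 * t))\<^sup>2)"
    unfolding sq using iexp[OF t] .
next
  fix s t A assume st: "0 \<le> s" "s \<le> t" and A: "A \<in> sets (F s)"
  have AM[measurable]: "A \<in> sets M" using sets_F[OF st(1) A] .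
  have iexp: "integrable M (\<lambda>\<omega>. exp (d * W s \<omega> - d' * s) * indicator A \<omega>)" for d d'
    using increment_exp_moment(1)[of 0 s d] st integrable_mult_indicator[OF AM, of "\<lambda>\<omega>. exp (d * W s \<omega> - d' * s)"]
    by (cases "s = 0") (simp_all add: W_nonpos exp_diff mult.commute)
  have m: "(\<lambda>\<omega>. exp (d * W s \<omega> - d' * s) * indicator A \<omega>) \<in> borel_measurable (F s)" for d d'
    using W_adapted[OF st(1)] A by simp
  \<comment> \<open>Kept general in \<open>d\<close> and \<open>d'\<close> because it is used twice:
    d = c, d' = c^2 / 2 makes the growth factor 1 (the martingale property), while d = 2 c, d' = c^2
    makes it exp (c^2 (t - s)) \<ge> 1 (the inequality for the squares).\<close>
  have key: "(\<integral>\<omega>. exp (d * W t \<omega> - d' * t) * indicator A \<omega> \<partial>M)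
      = exp ((d\<^sup>2 / 2 - d') * (t - s)) * (\<integral>\<omega>. exp (d * W s \<omega> - d' * s) * indicator A \<omega> \<partial>M)" for d d'
  proof (cases "s = t")
    case False
    then have st': "s < t" using st by simp
    note e = expectation_mult_increment(2)[OF st(1) st' m _ iexp increment_exp_moment(1)[OF st(1) st']]
    have "(\<integral>\<omega>. exp (d * W t \<omega> - d' * t) * indicator A \<omega> \<partial>M)
      = (\<integral>\<omega>. exp (- d' * (t - s)) * ((exp (d * W s \<omega> - d' * s) * indicator A \<omega>) * exp (d * (W t \<omega> - W s \<omega>))) \<partial>M)"
      by (intro Bochner_Integration.integral_cong refl) (auto simp: indicator_def mult_exp_exp algebra_simps)
    also have "\<dots> = exp (- d' * (t - s)) * ((\<integral>\<omega>. exp (d * W s \<omega> - d' * s) * indicator A \<omega> \<partial>M) * exp (d\<^sup>2 / 2 * (t - s)))"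
      by (subst integral_mult_right_zero, subst e) (simp_all add: increment_exp_moment[OF st(1) st'])
    finally show ?thesis by (simp add: mult_exp_exp algebra_simps diff_divide_distrib)
  qed simp
  show "(\<integral>\<omega>. exp (c * W t \<omega> - c\<^sup>2 / 2 * t) * indicator A \<omega> \<partial>M) = (\<integral>\<omega>. exp (c * W s \<omega> - c\<^sup>2 / 2 * s) * indicator A \<omega> \<partial>M)"
    using key[of c "c\<^sup>2 / 2"] by simp
  have sq: "(exp (c * W r \<omega> - c\<^sup>2 / 2 * r))\<^sup>2 = exp (2 * c * W r \<omega> - c\<^sup>2 * r)" for r \<omega>
    by (simp add: exp_double[symmetric] algebra_simps)
  have "1 * (\<integral>\<omega>. exp (2 * c * W s \<omega> - c\<^sup>2 * s) * indicator A \<omega> \<partial>M) \<le> exp (((2 * c)\<^sup>2 / 2 - c\<^sup>2) * (t - s)) * (\<integral>\<omega>. exp (2 * c * W s \<omega> - c\<^sup>2 * s) * indicator A \<omega> \<partial>M)"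
    using st by (intro mult_right_mono) (auto simp: power_mult_distrib)
  then show "(\<integral>\<omega>. (exp (c * W s \<omega> - c\<^sup>2 / 2 * s))\<^sup>2 * indicator A \<omega> \<partial>M) \<le> (\<integral>\<omega>. (exp (c * W t \<omega> - c\<^sup>2 / 2 * t))\<^sup>2 * indicator A \<omega> \<partial>M)"
    unfolding sq using key[of "2 * c" "c\<^sup>2"] by simp
qed

end

section \<open>The running maximum and optional stopping\<close>

text \<open>Passing to a countable index set is what makes the running maximum measurable, both at a
  fixed time and jointly in time and path.\<close>

lemma SUP_unit_interval_eq_rational:
  fixes g :: "real \<Rightarrow> real"
  assumes g: "continuous_on UNIV g"
  shows "bdd_above (g ` {0..1})" "(SUP u\<in>{0..1}. g u) = (SUP u\<in>{0..1} \<inter> \<rat>. g u)"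
proof -
  have "compact (g ` {0..1})"
    by (intro compact_continuous_image continuous_on_subset[OF g]) auto
  then show bdd: "bdd_above (g ` {0..1})"
    by (intro bounded_imp_bdd_above compact_imp_bounded)
  have bdd': "bdd_above (g ` ({0..1} \<inter> \<rat>))"
    by (rule bdd_above_mono[OF bdd]) auto
  have rat_ne: "{0..1} \<inter> \<rat> \<noteq> ({} :: real set)"
    using Rats_0 by (metis IntI atLeastAtMost_iff empty_iff le_numeral_extra(3) zero_le_one)
  show "(SUP u\<in>{0..1}. g u) = (SUP u\<in>{0..1} \<inter> \<rat>. g u)"
  proof (rule antisym)
    show "(SUP u\<in>{0..1} \<inter> \<rat>. g u) \<le> (SUP u\<in>{0..1}. g u)"
      by (rule cSUP_subset_mono[OF rat_ne bdd]) auto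
    show "(SUP u\<in>{0..1}. g u) \<le> (SUP u\<in>{0..1} \<inter> \<rat>. g u)"
    proof (rule cSUP_least)
      fix u :: real assume u: "u \<in> {0..1}"
      show "g u \<le> (SUP u\<in>{0..1} \<inter> \<rat>. g u)"
      proof (rule ccontr)
        assume "\<not> ?thesis"
        then have "u \<in> g -` {(SUP u\<in>{0..1} \<inter> \<rat>. g u)<..}" by simp
        moreover have "open (g -` {(SUP u\<in>{0..1} \<inter> \<rat>. g u)<..})"
          using g by (intro open_vimage) auto
        ultimately obtain e where e: "e > 0" "ball u e \<subseteq> g -` {(SUP u\<in>{0..1} \<inter> \<rat>. g u)<..}"
          using openE by blast
        \<comment> \<open>The rational approximating \<open>u\<close> has to stay inside the unit
          interval, also when \<open>u\<close> is an endpoint.\<close>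
        have "max 0 (u - e) < min 1 (u + e)" using u e by auto
        from Rats_dense_in_real[OF this] obtain r
          where r: "r \<in> \<rat>" "max 0 (u - e) < r" "r < min 1 (u + e)" by auto
        then have "r \<in> ball u e" by (auto simp: dist_real_def)
        then have "(SUP u\<in>{0..1} \<inter> \<rat>. g u) < g r" using e by auto
        moreover have "g r \<le> (SUP u\<in>{0..1} \<inter> \<rat>. g u)"
          using r by (intro cSUP_upper[OF _ bdd']) auto
        ultimately show False by simp
      qed
    qed (use rat_ne in auto)
  qed
qed

text \<open>Rounding time down to multiples of 1 / (n + 1) leaves countably many times, where
  measurability of each single f t is enough; continuity of the paths then gives the limit.\<close>

lemma borel_measurable_continuous_process:
  fixes f :: "real \<Rightarrow> 'a \<Rightarrow> real"
  assumes [measurable]: "\<And>t. f t \<in> borel_measurable M"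
    and cont: "\<And>\<omega>. continuous_on UNIV (\<lambda>t. f t \<omega>)"
  shows "(\<lambda>(t, \<omega>). f t \<omega>) \<in> borel_measurable (borel \<Otimes>\<^sub>M M)"
proof (rule borel_measurable_LIMSEQ_real)
  let ?a = "\<lambda>(n::nat) (t::real). real_of_int \<lfloor>t * real (Suc n)\<rfloor> / real (Suc n)"
  fix y :: "real \<times> 'a"
  have "(\<lambda>n. ?a n (fst y)) \<longlonglongrightarrow> fst y"
  proof (rule LIMSEQ_I)
    fix e :: real assume "e > 0"
    then obtain n0 where n0: "1 / real (Suc n0) < e" using nat_approx_posE by blast
    have "norm (?a n (fst y) - fst y) < e" if "n \<ge> n0" for n
    proof -
      have "\<bar>real_of_int \<lfloor>fst y * real (Suc n)\<rfloor> - fst y * real (Suc n)\<bar> \<le> 1" by linarith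
      moreover have "?a n (fst y) - fst y = (real_of_int \<lfloor>fst y * real (Suc n)\<rfloor> - fst y * real (Suc n)) / real (Suc n)"
        by (simp add: field_simps)
      ultimately have "norm (?a n (fst y) - fst y) \<le> 1 / real (Suc n)"
        by (simp add: divide_right_mono)
      also have "\<dots> \<le> 1 / real (Suc n0)" using that by (intro divide_left_mono) auto
      finally show ?thesis using n0 by simp
    qed
    then show "\<exists>no. \<forall>n\<ge>no. norm (?a n (fst y) - fst y) < e" by blast
  qed
  then show "(\<lambda>n. f (?a n (fst y)) (snd y)) \<longlonglongrightarrow> (\<lambda>(t, \<omega>). f t \<omega>) y"
    unfolding case_prod_beta
    by (intro continuous_on_tendsto_compose[OF cont]) auto
next
  fix n :: nat
  let ?h = "\<lambda>y :: real \<times> 'a. \<lfloor>fst y * real (Suc n)\<rfloor>"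
  show "(\<lambda>y. f (real_of_int (?h y) / real (Suc n)) (snd y)) \<in> borel_measurable (borel \<Otimes>\<^sub>M M)"
    by (rule measurable_compose_countable[where f="\<lambda>i y. f (real_of_int i / real (Suc n)) (snd y)" and g="?h"]) measurable
qed

section \<open>Brownian motion with drift, its running maximum and its hitting times\<close>

locale drifted_brownian_motion = continuous_brownian_motion M F W
  for M :: "'a measure" and F :: "real \<Rightarrow> 'a measure" and W :: "real \<Rightarrow> 'a \<Rightarrow> real" +
  fixes \<kappa> :: real
begin

definition Y :: "real \<Rightarrow> 'a \<Rightarrow> real" where
  "Y t \<omega> = W t \<omega> - \<kappa> * t"

text \<open>For \<open>t \<ge> 0\<close> this is \<open>sup\<^bsub>s \<le> t\<^esub> (- Y\<^sub>s)\<close>; the rescaling to \<open>[0,1]\<close> makes the supremum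
  range over an index set that does not depend on \<open>t\<close>.\<close>

definition D :: "real \<Rightarrow> 'a \<Rightarrow> real" where
  "D t \<omega> = (SUP u\<in>{0..1}. - Y (u * t) \<omega>)"

text \<open>Meaningful only on \<open>E z t\<close>, where the infimum is over a nonempty set.\<close>

definition \<tau> :: "real \<Rightarrow> 'a \<Rightarrow> real" where
  "\<tau> z \<omega> = Inf {s. 0 \<le> s \<and> z \<le> D s \<omega>}"

definition E :: "real \<Rightarrow> real \<Rightarrow> 'a set" where
  "E z t = {\<omega> \<in> space M. z \<le> D t \<omega>}"

lemma Y_cont: "continuous_on A (\<lambda>t. Y t \<omega>)"
  unfolding Y_def by (intro continuous_intros continuous_on_subset[OF W_cont]) auto

lemma Y_0: "Y 0 \<omega> = 0"
  by (simp add: Y_def W_nonpos)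

lemma Y_scaled_cont: "continuous_on UNIV (\<lambda>u. - Y (u * t) \<omega>)"
  by (intro continuous_intros continuous_on_compose2[OF Y_cont[of UNIV]]) auto

lemma D_rational: "D t \<omega> = (SUP u\<in>{0..1} \<inter> \<rat>. - Y (u * t) \<omega>)"
  unfolding D_def using SUP_unit_interval_eq_rational(2)[OF Y_scaled_cont] .

lemma D_upper: "s \<in> {0..t} \<Longrightarrow> - Y s \<omega> \<le> D t \<omega>"
proof (cases "t = 0")
  case False
  assume s: "s \<in> {0..t}"
  then have "- Y (s / t * t) \<omega> \<le> D t \<omega>"
    unfolding D_def using False
    by (intro cSUP_upper[OF _ SUP_unit_interval_eq_rational(1)[OF Y_scaled_cont]]) (auto simp: field_simps)
  then show ?thesis using False by simp
qed (simp add: D_def)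

lemma D_attained:
  assumes "0 \<le> t"
  obtains s where "s \<in> {0..t}" "D t \<omega> = - Y s \<omega>"
proof -
  obtain u where u: "u \<in> {0..1}" and le: "\<And>u'. u' \<in> {0..1} \<Longrightarrow> - Y (u' * t) \<omega> \<le> - Y (u * t) \<omega>"
    using continuous_attains_sup[of "{0..1::real}" "\<lambda>u. - Y (u * t) \<omega>"] continuous_on_subset[OF Y_scaled_cont] by auto
  have "D t \<omega> = - Y (u * t) \<omega>"
    unfolding D_def
  proof (rule antisym)
    show "(SUP u\<in>{0..1}. - Y (u * t) \<omega>) \<le> - Y (u * t) \<omega>"
      by (rule cSUP_least) (use le in auto)
    show "- Y (u * t) \<omega> \<le> (SUP u\<in>{0..1}. - Y (u * t) \<omega>)"
      by (rule cSUP_upper[OF u SUP_unit_interval_eq_rational(1)[OF Y_scaled_cont]])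
  qed
  moreover have "u * t \<in> {0..t}" using u assms by (auto simp: mult_left_le_one_le)
  ultimately show ?thesis using that by blast
qed

lemma le_D_iff: "0 \<le> t \<Longrightarrow> z \<le> D t \<omega> \<longleftrightarrow> (\<exists>s\<in>{0..t}. Y s \<omega> \<le> - z)"
  using D_attained[of t \<omega>] D_upper[of _ t \<omega>] by (smt (verit))

lemma D_mono: "0 \<le> s \<Longrightarrow> s \<le> t \<Longrightarrow> D s \<omega> \<le> D t \<omega>"
  using D_attained[of s \<omega>] D_upper[of _ t \<omega>] by (smt (verit) atLeastAtMost_iff)

lemma D_0: "D 0 \<omega> = 0"
  by (simp add: D_def Y_0)

lemma D_nonneg: "0 \<le> t \<Longrightarrow> 0 \<le> D t \<omega>"
  using D_mono[of 0 t \<omega>] by (simp add: D_0)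

lemma Y_measurable [measurable]: "Y t \<in> borel_measurable M"
  unfolding Y_def[abs_def] by measurable

lemma Y_adapted: "0 \<le> t \<Longrightarrow> Y t \<in> borel_measurable (F t)"
  unfolding Y_def[abs_def] using W_adapted by simp

lemma D_adapted:
  assumes "0 \<le> t" shows "D t \<in> borel_measurable (F t)"
  unfolding D_rational[abs_def]
proof (rule borel_measurable_cSUP)
  show "countable ({0..1} \<inter> \<rat> :: real set)" using countable_rat by auto
  fix u :: real assume "u \<in> {0..1} \<inter> \<rat>"
  then have "0 \<le> u * t" "u * t \<le> t" using assms by (auto simp: mult_left_le_one_le)
  then show "(\<lambda>\<omega>. - Y (u * t) \<omega>) \<in> borel_measurable (F t)"
    using measurable_F_mono[OF _ _ Y_adapted, of "u * t" t] by simp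
next
  fix \<omega>
  show "bdd_above ((\<lambda>u. - Y (u * t) \<omega>) ` ({0..1} \<inter> \<rat>))"
    by (rule bdd_above_mono[OF SUP_unit_interval_eq_rational(1)[OF Y_scaled_cont]]) auto
qed

lemma Y_joint_measurable: "(\<lambda>(t, \<omega>). Y t \<omega>) \<in> borel_measurable (borel \<Otimes>\<^sub>M M)"
  by (rule borel_measurable_continuous_process[OF Y_measurable Y_cont])

lemma Y_joint_measurable' [measurable (raw)]:
  assumes "f \<in> borel_measurable N" "g \<in> measurable N M"
  shows "(\<lambda>x. Y (f x) (g x)) \<in> borel_measurable N"
  using measurable_compose[OF measurable_Pair[OF assms] Y_joint_measurable] by simp

lemma D_joint_measurable [measurable (raw)]:
  assumes [measurable]: "f \<in> borel_measurable N" "g \<in> measurable N M"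
  shows "(\<lambda>x. D (f x) (g x)) \<in> borel_measurable N"
  unfolding D_rational[abs_def]
proof (rule borel_measurable_cSUP)
  show "countable ({0..1} \<inter> \<rat> :: real set)" using countable_rat by auto
  show "bdd_above ((\<lambda>u. - Y (u * f x) (g x)) ` ({0..1} \<inter> \<rat>))" for x
    by (rule bdd_above_mono[OF SUP_unit_interval_eq_rational(1)[OF Y_scaled_cont]]) auto
qed measurable

lemma E_F: "0 \<le> t \<Longrightarrow> E z t \<in> sets (F t)"
  unfolding E_def using subalg[of t] D_adapted[of t] borel_measurable_iff_ge[of "D t" "F t"]
  by (auto simp: subalgebra_def)

lemma E_sets [measurable]: "E z t \<in> sets M"
  unfolding E_def by measurable

lemma E_mono: "0 \<le> s \<Longrightarrow> s \<le> t \<Longrightarrow> E z s \<subseteq> E z t"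
  unfolding E_def using D_mono by (auto intro: order_trans)

text \<open>The set of times with Y_s \<le> -z is closed by continuity and nonempty by the
  assumption on \<open>D\<close>, so it contains its infimum. As Y starts at 0 > -z, that infimum is
  positive, and the intermediate value theorem excludes an overshoot.\<close>

lemma hitting_time:
  assumes z: "0 < z" and t: "0 \<le> t" and D: "z \<le> D t \<omega>"
  shows "0 < \<tau> z \<omega>" "\<tau> z \<omega> \<le> t" "Y (\<tau> z \<omega>) \<omega> = - z" "\<And>s. 0 \<le> s \<Longrightarrow> z \<le> D s \<omega> \<longleftrightarrow> \<tau> z \<omega> \<le> s"
proof -
  define S where "S = {s. 0 \<le> s \<and> Y s \<omega> \<le> - z}"
  define m where "m = Inf S"
  have S: "closed S"
    unfolding S_def by (intro closed_Collect_conj closed_Collect_le continuous_intros Y_cont)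
  have ne: "S \<noteq> {}" using D le_D_iff[OF t] by (auto simp: S_def)
  have bd: "bdd_below S" by (auto simp: S_def intro!: bdd_belowI[of _ 0])
  have mS: "m \<in> S" unfolding m_def by (rule closed_contains_Inf[OF ne bd S])
  have mle: "m \<le> s" if "s \<in> S" for s unfolding m_def using that bd by (rule cInf_lower)
  have m0: "0 < m"
    using mS z Y_0 by (cases "m = 0") (auto simp: S_def)
  have iff: "z \<le> D s \<omega> \<longleftrightarrow> m \<le> s" if "0 \<le> s" for s
    unfolding le_D_iff[OF that] using mS mle that m0 by (fastforce simp: S_def)
  have Ym: "Y m \<omega> = - z"
  proof (rule ccontr)
    assume "Y m \<omega> \<noteq> - z"
    then have lt: "Y m \<omega> < - z" using mS by (simp add: S_def)
    obtain r where r: "0 \<le> r" "r \<le> m" "Y r \<omega> = - z"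
      using IVT2'[of "\<lambda>s. Y s \<omega>" m "- z" 0] lt z m0 Y_0 Y_cont by auto
    then have "r \<in> S" by (simp add: S_def)
    then have "r = m" using mle r by force
    then show False using r lt by simp
  qed
  have "{s. 0 \<le> s \<and> z \<le> D s \<omega>} = {m..}" using iff m0 by auto
  then have "\<tau> z \<omega> = m" by (simp add: \<tau>_def)
  then show "0 < \<tau> z \<omega>" "\<tau> z \<omega> \<le> t" "Y (\<tau> z \<omega>) \<omega> = - z" "\<And>s. 0 \<le> s \<Longrightarrow> z \<le> D s \<omega> \<longleftrightarrow> \<tau> z \<omega> \<le> s"
    using m0 Ym iff D t by auto
qed

text \<open>Rounding the hitting time up to the grid \<open>t k / (n + 1)\<close> gives a stopping time with finitely many
  values; the left-hand side evaluates \<open>G\<close> there.\<close>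

lemma sum_over_grid:
  fixes G :: "real \<Rightarrow> real" and n :: nat
  assumes z: "0 < z" and t: "0 < t" and \<omega>: "\<omega> \<in> space M"
  defines "s \<equiv> \<lambda>k::nat. t * real k / real (Suc n)"
  shows "(\<Sum>k<Suc n. G (s (Suc k)) * indicator (E z (s (Suc k)) - E z (s k)) \<omega>)
    = (if \<omega> \<in> E z t then G (s (nat \<lceil>\<tau> z \<omega> * real (Suc n) / t\<rceil>)) else 0)"
proof (cases "\<omega> \<in> E z t")
  case False
  have "\<omega> \<notin> E z (s (Suc k))" if "k < Suc n" for k
  proof -
    have "0 \<le> s (Suc k)" "s (Suc k) \<le> t"
      using that t unfolding s_def by (auto simp: divide_le_eq)
    from E_mono[OF this] False show ?thesis by auto
  qed
  with False show ?thesis by simp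
next
  case True
  then have D: "z \<le> D t \<omega>" by (simp add: E_def)
  note h = hitting_time[OF z less_imp_le[OF t] D]
  let ?c = "\<tau> z \<omega> * real (Suc n) / t"
  have c0: "0 < ?c" using h t by simp
  have cn: "?c \<le> real (Suc n)" using h t by (simp add: divide_le_eq mult_right_mono)
  define m where "m = nat \<lceil>?c\<rceil>"
  have m: "0 < m" "m \<le> Suc n" using c0 cn by (simp_all add: m_def nat_le_iff ceiling_le_iff)
  have s0: "0 \<le> s k" for k using t by (simp add: s_def)
  have inE: "\<omega> \<in> E z (s k) \<longleftrightarrow> m \<le> k" for k
  proof -
    have "\<omega> \<in> E z (s k) \<longleftrightarrow> \<tau> z \<omega> \<le> s k" using h(4)[OF s0] \<omega> by (simp add: E_def)
    also have "\<dots> \<longleftrightarrow> ?c \<le> real k" using t by (simp add: s_def field_simps)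
    also have "\<dots> \<longleftrightarrow> m \<le> k" unfolding m_def by (simp add: nat_le_iff ceiling_le_iff)
    finally show ?thesis .
  qed
  \<comment> \<open>The level is crossed in exactly one grid cell, the one that ends at s m. Its
    index m - 1 is meaningful because the hitting time is positive.\<close>
  have "indicator (E z (s (Suc k)) - E z (s k)) \<omega> = (if k = m - 1 then 1 else 0 :: real)" for k
    using m by (auto simp: indicator_def inE)
  then have "(\<Sum>k<Suc n. G (s (Suc k)) * indicator (E z (s (Suc k)) - E z (s k)) \<omega>)
    = (\<Sum>k<Suc n. if k = m - 1 then G (s (Suc k)) else 0)"
    by (intro sum.cong) auto
  also have "\<dots> = G (s m)" using m by (subst sum.delta) auto
  finally show ?thesis using True by (simp add: m_def)
qed

text \<open>On each event \<open>B n k\<close> the martingale property at the right end of the grid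
  cell replaces the value there by N t, so every discretised stopped value has the same mean. The
  inequality for squares bounds the second moments uniformly in n, which permits the passage to the
  limit along refining grids.\<close>

lemma optional_stopping:
  assumes N: "L2_martingale N" and z: "0 < z" and t: "0 < t"
  shows "integrable M (\<lambda>\<omega>. N (\<tau> z \<omega>) \<omega> * indicator (E z t) \<omega>)"
    and "(\<integral>\<omega>. N t \<omega> * indicator (E z t) \<omega> \<partial>M) = (\<integral>\<omega>. N (\<tau> z \<omega>) \<omega> * indicator (E z t) \<omega> \<partial>M)"
proof -
  define s where "s n k = t * real k / real (Suc n)" for n k :: nat
  define B where "B n k = E z (s n (Suc k)) - E z (s n k)" for n k
  define c where "c n \<omega> = s n (nat \<lceil>\<tau> z \<omega> * real (Suc n) / t\<rceil>)" for n \<omega>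
  define f where "f n \<omega> = (\<Sum>k<Suc n. N (s n (Suc k)) \<omega> * indicator (B n k) \<omega>)" for n \<omega>
  have s0: "0 \<le> s n k" for n k using t by (simp add: s_def)
  have st: "s n (Suc k) \<le> t" if "k < Suc n" for n k
    using that t unfolding s_def by (auto simp: divide_le_eq)
  have grid: "(\<Sum>k<Suc n. G (s n (Suc k)) * indicator (B n k) \<omega>) = (if \<omega> \<in> E z t then G (c n \<omega>) else 0)"
    if "\<omega> \<in> space M" for G :: "real \<Rightarrow> real" and n \<omega>
    using sum_over_grid[OF z t that] unfolding s_def B_def c_def .
  have N_cont: "continuous_on {0..} (\<lambda>t. N t \<omega>)"
    and N_F: "r \<ge> 0 \<Longrightarrow> N r \<in> borel_measurable (F r)"
    and N2: "r \<ge> 0 \<Longrightarrow> integrable M (\<lambda>\<omega>. (N r \<omega>)\<^sup>2)" for r \<omega>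
    using N by (auto simp: L2_martingale_def)
  have N_M: "r \<ge> 0 \<Longrightarrow> N r \<in> borel_measurable M" for r using N_F measurable_F by blast
  have N1: "r \<ge> 0 \<Longrightarrow> integrable M (N r)" for r
    using square_integrable_imp_integrable[OF N_M N2] .
  \<comment> \<open>The time is rounded up so that crossing in the k-th cell is an event of the
    sigma-algebra at the right end of the cell, where \<open>N\<close> is evaluated.\<close>
  have BF: "B n k \<in> sets (F (s n (Suc k)))" for n k
  proof -
    have "s n k \<le> s n (Suc k)" using t unfolding s_def by (intro divide_right_mono) auto
    then have "E z (s n k) \<in> sets (F (s n (Suc k)))"
      using E_F[OF s0] F_mono[OF s0] by blast
    then show ?thesis unfolding B_def using E_F[OF s0] by blast
  qed
  have BM [measurable]: "B n k \<in> sets M" for n k unfolding B_def by measurable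
  have mart: "(\<integral>\<omega>. N t \<omega> * indicator (B n k) \<omega> \<partial>M) = (\<integral>\<omega>. N (s n (Suc k)) \<omega> * indicator (B n k) \<omega> \<partial>M)"
    and mart2: "(\<integral>\<omega>. (N (s n (Suc k)) \<omega>)\<^sup>2 * indicator (B n k) \<omega> \<partial>M) \<le> (\<integral>\<omega>. (N t \<omega>)\<^sup>2 * indicator (B n k) \<omega> \<partial>M)"
    if "k < Suc n" for n k
    using N s0 st[OF that] BF[of n k] by (auto simp: L2_martingale_def)
  have i1: "integrable M (\<lambda>\<omega>. N r \<omega> * indicator A \<omega>)" if "r \<ge> 0" "A \<in> sets M" for r A
    using integrable_mult_indicator[OF that(2) N1[OF that(1)]] by (simp add: mult.commute)
  have i2: "integrable M (\<lambda>\<omega>. (N r \<omega>)\<^sup>2 * indicator A \<omega>)" if "r \<ge> 0" "A \<in> sets M" for r A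
    using integrable_mult_indicator[OF that(2) N2[OF that(1)]] by (simp add: mult.commute)
  have f_eq: "f n \<omega> = (if \<omega> \<in> E z t then N (c n \<omega>) \<omega> else 0)" if "\<omega> \<in> space M" for n \<omega>
    unfolding f_def using grid[OF that, of "\<lambda>r. N r \<omega>"] .
  have f2_eq: "(f n \<omega>)\<^sup>2 = (\<Sum>k<Suc n. (N (s n (Suc k)) \<omega>)\<^sup>2 * indicator (B n k) \<omega>)" if "\<omega> \<in> space M" for n \<omega>
    using grid[OF that, of "\<lambda>r. (N r \<omega>)\<^sup>2"] f_eq[OF that] by simp
  have f_M: "f n \<in> borel_measurable M" for n
    unfolding f_def using N_M[OF s0] by (intro borel_measurable_sum borel_measurable_times) auto
  have f2_int: "integrable M (\<lambda>\<omega>. (f n \<omega>)\<^sup>2)" for n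
  proof -
    have "integrable M (\<lambda>\<omega>. \<Sum>k<Suc n. (N (s n (Suc k)) \<omega>)\<^sup>2 * indicator (B n k) \<omega>)"
      by (intro Bochner_Integration.integrable_sum i2 s0 BM)
    then show ?thesis
      by (subst Bochner_Integration.integrable_cong[OF refl f2_eq])
  qed
  have tsum: "g \<omega> * indicator (E z t) \<omega> = (\<Sum>k<Suc n. g \<omega> * indicator (B n k) \<omega>)" if "\<omega> \<in> space M" for n \<omega> and g :: "'a \<Rightarrow> real"
    using grid[OF that, of "\<lambda>_. g \<omega>"] by simp
  have f_int: "(\<integral>\<omega>. f n \<omega> \<partial>M) = (\<integral>\<omega>. N t \<omega> * indicator (E z t) \<omega> \<partial>M)" for n
  proof -
    have "(\<integral>\<omega>. f n \<omega> \<partial>M) = (\<Sum>k<Suc n. \<integral>\<omega>. N (s n (Suc k)) \<omega> * indicator (B n k) \<omega> \<partial>M)"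
      unfolding f_def by (intro Bochner_Integration.integral_sum i1 s0 BM)
    also have "\<dots> = (\<Sum>k<Suc n. \<integral>\<omega>. N t \<omega> * indicator (B n k) \<omega> \<partial>M)"
      by (intro sum.cong refl mart[symmetric]) auto
    also have "\<dots> = (\<integral>\<omega>. (\<Sum>k<Suc n. N t \<omega> * indicator (B n k) \<omega>) \<partial>M)"
      by (intro Bochner_Integration.integral_sum[symmetric] i1 BM) (use t in auto)
    also have "\<dots> = (\<integral>\<omega>. N t \<omega> * indicator (E z t) \<omega> \<partial>M)"
      by (intro Bochner_Integration.integral_cong refl tsum[symmetric])
    finally show ?thesis .
  qed
  have f2_le: "(\<integral>\<omega>. (f n \<omega>)\<^sup>2 \<partial>M) \<le> (\<integral>\<omega>. (N t \<omega>)\<^sup>2 * indicator (E z t) \<omega> \<partial>M)" for n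
  proof -
    have "(\<integral>\<omega>. (f n \<omega>)\<^sup>2 \<partial>M) = (\<integral>\<omega>. (\<Sum>k<Suc n. (N (s n (Suc k)) \<omega>)\<^sup>2 * indicator (B n k) \<omega>) \<partial>M)"
      by (intro Bochner_Integration.integral_cong refl f2_eq)
    also have "\<dots> = (\<Sum>k<Suc n. \<integral>\<omega>. (N (s n (Suc k)) \<omega>)\<^sup>2 * indicator (B n k) \<omega> \<partial>M)"
      by (intro Bochner_Integration.integral_sum i2 s0 BM)
    also have "\<dots> \<le> (\<Sum>k<Suc n. \<integral>\<omega>. (N t \<omega>)\<^sup>2 * indicator (B n k) \<omega> \<partial>M)"
      by (intro sum_mono mart2) auto
    also have "\<dots> = (\<integral>\<omega>. (\<Sum>k<Suc n. (N t \<omega>)\<^sup>2 * indicator (B n k) \<omega>) \<partial>M)"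
      by (intro Bochner_Integration.integral_sum[symmetric] i2 BM) (use t in auto)
    also have "\<dots> = (\<integral>\<omega>. (N t \<omega>)\<^sup>2 * indicator (E z t) \<omega> \<partial>M)"
      by (intro Bochner_Integration.integral_cong refl tsum[symmetric])
    finally show ?thesis .
  qed
  have lim: "(\<lambda>n. f n \<omega>) \<longlonglongrightarrow> N (\<tau> z \<omega>) \<omega> * indicator (E z t) \<omega>" if \<omega>: "\<omega> \<in> space M" for \<omega>
  proof (cases "\<omega> \<in> E z t")
    case True
    then have D: "z \<le> D t \<omega>" by (simp add: E_def)
    note h = hitting_time[OF z less_imp_le[OF t] D]
    have "(\<lambda>n. c n \<omega>) \<longlonglongrightarrow> \<tau> z \<omega>"
    proof (rule LIMSEQ_I)
      fix e :: real assume "e > 0"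
      then have "e / t > 0" using t by simp
      then obtain n0 where n0: "1 / real (Suc n0) < e / t" using nat_approx_posE by blast
      have "norm (c n \<omega> - \<tau> z \<omega>) < e" if "n \<ge> n0" for n
      proof -
        let ?c = "\<tau> z \<omega> * real (Suc n) / t"
        have "0 \<le> ?c" using h t by simp
        then have "\<bar>real (nat \<lceil>?c\<rceil>) - ?c\<bar> \<le> 1" by linarith
        moreover have "c n \<omega> - \<tau> z \<omega> = (real (nat \<lceil>?c\<rceil>) - ?c) * (t / real (Suc n))"
        proof -
          have "t * r / N - u = (r - u * N / t) * (t / N)" if "N > 0" for r N u :: real
            using t that by (simp add: field_simps)
          from this[of "real (Suc n)"] show ?thesis unfolding c_def s_def by simp
        qed
        ultimately have "norm (c n \<omega> - \<tau> z \<omega>) \<le> 1 * (t / real (Suc n))"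
          using mult_mono[of "\<bar>real (nat \<lceil>?c\<rceil>) - ?c\<bar>" 1 "t / real (Suc n)" "t / real (Suc n)"] t
          by (simp add: abs_mult)
        also have "\<dots> \<le> t / real (Suc n0)" using that t by (intro order_trans[OF eq_refl divide_left_mono]) auto
        also have "\<dots> < e" using n0 t by (simp add: field_simps)
        finally show ?thesis .
      qed
      then show "\<exists>no. \<forall>n\<ge>no. norm (c n \<omega> - \<tau> z \<omega>) < e" by blast
    qed
    moreover have "c n \<omega> \<in> {0..}" for n unfolding c_def using s0 by auto
    ultimately have "(\<lambda>n. N (c n \<omega>) \<omega>) \<longlonglongrightarrow> N (\<tau> z \<omega>) \<omega>"
      by (intro continuous_on_tendsto_compose[OF N_cont]) (use h in auto)
    then show ?thesis using True f_eq[OF \<omega>] by simp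
  next
    case False then show ?thesis using f_eq[OF \<omega>] by simp
  qed
  have g_M: "(\<lambda>\<omega>. N (\<tau> z \<omega>) \<omega> * indicator (E z t) \<omega>) \<in> borel_measurable M"
    by (rule borel_measurable_LIMSEQ_real[OF lim f_M])
  \<comment> \<open>By \<open>f_int\<close> the integrals of f n do not depend on n, so their limit
    is the common value.\<close>
  note ui = integral_tendsto_of_second_moment_bound[OF f_M g_M lim f2_int f2_le]
  show "integrable M (\<lambda>\<omega>. N (\<tau> z \<omega>) \<omega> * indicator (E z t) \<omega>)" by (rule ui(1))
  show "(\<integral>\<omega>. N t \<omega> * indicator (E z t) \<omega> \<partial>M) = (\<integral>\<omega>. N (\<tau> z \<omega>) \<omega> * indicator (E z t) \<omega> \<partial>M)"
    using ui(2) unfolding f_int by (simp add: LIMSEQ_const_iff)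
qed

end

section \<open>Discounted hitting probabilities\<close>

text \<open>Costs are computed in \<open>ennreal\<close>, where subtraction truncates. Identities
  with negative terms are therefore proved with those terms added on the other side, and this lemma
  moves them back.\<close>

lemma ennreal_eq_diff_of_add_eq:
  assumes "c + ennreal a = ennreal b" "0 \<le> a"
  shows "c = ennreal (b - a)"
  using assms by (metis ennreal_add_diff_cancel_right ennreal_minus ennreal_neq_top)

lemma nn_integral_exp_tail:
  fixes a c :: real
  assumes "0 < c"
  shows "(\<integral>\<^sup>+s. ennreal (c * exp (- c * s)) * indicator {a..} s \<partial>lborel) = ennreal (exp (- c * a))"
proof -
  have "(\<integral>\<^sup>+s. ennreal (c * exp (- c * s)) * indicator {a..} s \<partial>lborel) = ennreal (0 - (- exp (- c * a)))"
  proof (rule nn_integral_FTC_atLeast[where F="\<lambda>s. - exp (- c * s)"])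
    show "((\<lambda>s. - exp (- c * s)) \<longlongrightarrow> 0) at_top" using assms by real_asymp
  qed (use assms in \<open>auto intro!: derivative_eq_intros\<close>)
  then show ?thesis by simp
qed

lemma nn_integral_linear_exp:
  fixes c :: real
  assumes "0 < c"
  shows "(\<integral>\<^sup>+s. ennreal (s * exp (- c * s)) * indicator {0..} s \<partial>lborel) = ennreal (1 / c\<^sup>2)"
proof -
  have "(\<integral>\<^sup>+s. ennreal (s * exp (- c * s)) * indicator {0..} s \<partial>lborel)
      = ennreal (0 - (- (0 / c + 1 / c\<^sup>2) * exp (- c * 0)))"
  proof (rule nn_integral_FTC_atLeast[where F="\<lambda>s. - (s / c + 1 / c\<^sup>2) * exp (- c * s)"])
    show "((\<lambda>s. - (s / c + 1 / c\<^sup>2) * exp (- c * s)) \<longlongrightarrow> 0) at_top" using assms by real_asymp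
    show "((\<lambda>s. - (s / c + 1 / c\<^sup>2) * exp (- c * s)) has_real_derivative s * exp (- c * s)) (at s)" for s
      using assms by (auto intro!: derivative_eq_intros simp: field_simps power2_eq_square)
  qed (use assms in auto)
  then show ?thesis by simp
qed

text \<open>By the equation for \<open>\<gamma>\<close>, the martingale exp (\<gamma> W_t -
  \<gamma>^2 t / 2) equals exp (\<gamma> Y_t - lam t). The negative root is chosen because then exp
  (\<gamma> Y_t) stays below exp (-\<gamma> z) as long as Y stays above -z. Describing
  \<open>\<gamma>\<close> by its equation keeps the square root out of the calculations.\<close>

locale discounted_brownian_motion = drifted_brownian_motion M F W \<kappa>
  for M :: "'a measure" and F :: "real \<Rightarrow> 'a measure" and W :: "real \<Rightarrow> 'a \<Rightarrow> real" and \<kappa> :: real +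
  fixes lam \<gamma> :: real
  assumes lam: "0 < lam" and \<kappa>: "0 \<le> \<kappa>" and \<gamma>: "\<gamma> < 0" and \<gamma>_eq: "\<gamma>\<^sup>2 / 2 - \<kappa> * \<gamma> = lam"
begin

sublocale time_space: pair_sigma_finite lborel M ..

text \<open>The indicator of \<open>E z t\<close> as a function of level, time and path together, in
  the type in which Tonelli's theorem is applied to it.\<close>

definition hit :: "real \<Rightarrow> real \<Rightarrow> 'a \<Rightarrow> ennreal" where
  "hit z t \<omega> = (if z \<le> D t \<omega> then 1 else 0)"

lemma hit_measurable [measurable (raw)]:
  assumes [measurable]: "f \<in> borel_measurable N" "g \<in> borel_measurable N" "h \<in> measurable N M"
  shows "(\<lambda>x. hit (f x) (g x) (h x)) \<in> borel_measurable N"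
  unfolding hit_def by measurable

lemma emeasure_E: "emeasure M (E z t) = (\<integral>\<^sup>+\<omega>. hit z t \<omega> \<partial>M)"
proof -
  have "(\<integral>\<^sup>+\<omega>. hit z t \<omega> \<partial>M) = (\<integral>\<^sup>+\<omega>. indicator (E z t) \<omega> \<partial>M)"
    by (intro nn_integral_cong) (auto simp: hit_def E_def)
  then show ?thesis by simp
qed

lemma emeasure_E_measurable [measurable (raw)]:
  assumes [measurable]: "f \<in> borel_measurable N" "g \<in> borel_measurable N"
  shows "(\<lambda>x. emeasure M (E (f x) (g x))) \<in> borel_measurable N"
  unfolding emeasure_E by measurable

text \<open>Stopping at the hitting time gives E[N_t 1_E] = exp (-\<gamma> z) I for the exponential
  martingale N of mean 1. Off \<open>E z t\<close> one has Y_t > -z, so there N_t lies between 0 and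
  exp (-\<gamma> z - lam t); hence E[N_t 1_E] differs from 1 by no more than that. Multiplying by
  exp (\<gamma> z) gives both bounds.\<close>

lemma stopped_exp_bounds:
  assumes z: "0 < z" and t: "0 < t"
  defines "I \<equiv> \<integral>\<omega>. exp (- lam * \<tau> z \<omega>) * indicator (E z t) \<omega> \<partial>M"
  shows "integrable M (\<lambda>\<omega>. exp (- lam * \<tau> z \<omega>) * indicator (E z t) \<omega>)"
    and "I \<le> exp (\<gamma> * z)" and "exp (\<gamma> * z) - exp (- lam * t) \<le> I"
proof -
  let ?N = "\<lambda>t \<omega>. exp (\<gamma> * W t \<omega> - \<gamma>\<^sup>2 / 2 * t)"
  have t0: "0 \<le> t" using t by simp
  note mart = L2_martingale_exp[of \<gamma>]
  note os = optional_stopping[OF mart z t]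
  have N_eq: "?N s \<omega> = exp (\<gamma> * Y s \<omega> - lam * s)" for s \<omega>
    unfolding Y_def \<gamma>_eq[symmetric] by (simp add: algebra_simps)
  have at_\<tau>: "?N (\<tau> z \<omega>) \<omega> * indicator (E z t) \<omega>
      = exp (- (\<gamma> * z)) * (exp (- lam * \<tau> z \<omega>) * indicator (E z t) \<omega>)" for \<omega>
  proof (cases "\<omega> \<in> E z t")
    case True
    then have "z \<le> D t \<omega>" by (simp add: E_def)
    from hitting_time(3)[OF z t0 this] show ?thesis
      unfolding N_eq by (simp add: mult_exp_exp algebra_simps)
  qed simp
  have "integrable M (\<lambda>\<omega>. exp (\<gamma> * z) * (exp (- (\<gamma> * z)) * (exp (- lam * \<tau> z \<omega>) * indicator (E z t) \<omega>)))"
    using os(1) unfolding at_\<tau> by (rule integrable_mult_right)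
  then show "integrable M (\<lambda>\<omega>. exp (- lam * \<tau> z \<omega>) * indicator (E z t) \<omega>)"
    by (simp add: mult.assoc[symmetric] mult_exp_exp)
  have "(\<integral>\<omega>. ?N t \<omega> * indicator (E z t) \<omega> \<partial>M) = exp (- (\<gamma> * z)) * I"
    unfolding os(2) at_\<tau> I_def by simp
  then have I_eq: "I = exp (\<gamma> * z) * (\<integral>\<omega>. ?N t \<omega> * indicator (E z t) \<omega> \<partial>M)"
    by (simp add: mult.assoc[symmetric] mult_exp_exp)
  have N2: "integrable M (\<lambda>\<omega>. (?N t \<omega>)\<^sup>2)"
    and N_int: "(\<integral>\<omega>. ?N t \<omega> * indicator (space M) \<omega> \<partial>M) = (\<integral>\<omega>. ?N 0 \<omega> * indicator (space M) \<omega> \<partial>M)"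
    using mart t0 sets.top[of "F 0"] subalg[of 0] unfolding L2_martingale_def subalgebra_def by auto
  have Ni: "integrable M (?N t)"
    by (rule square_integrable_imp_integrable[OF _ N2]) measurable
  have "(\<integral>\<omega>. ?N t \<omega> \<partial>M) = (\<integral>\<omega>. ?N t \<omega> * indicator (space M) \<omega> \<partial>M)"
    by (intro Bochner_Integration.integral_cong) auto
  also have "\<dots> = (\<integral>\<omega>. 1 \<partial>M)"
    unfolding N_int by (intro Bochner_Integration.integral_cong) (auto simp: W_nonpos)
  finally have N1: "(\<integral>\<omega>. ?N t \<omega> \<partial>M) = 1" by (simp add: prob_space)
  have NEi: "integrable M (\<lambda>\<omega>. ?N t \<omega> * indicator (E z t) \<omega>)"
    using integrable_mult_indicator[OF E_sets Ni, of z t] by (simp add: mult.commute)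
  have "(\<integral>\<omega>. ?N t \<omega> * indicator (E z t) \<omega> \<partial>M) \<le> (\<integral>\<omega>. ?N t \<omega> \<partial>M)"
    by (intro integral_mono NEi Ni) (auto simp: indicator_def)
  then show "I \<le> exp (\<gamma> * z)" unfolding I_eq N1 by simp
  have "(\<integral>\<omega>. ?N t \<omega> - exp (- (\<gamma> * z) - lam * t) \<partial>M) \<le> (\<integral>\<omega>. ?N t \<omega> * indicator (E z t) \<omega> \<partial>M)"
  proof (intro integral_mono NEi Bochner_Integration.integrable_diff Ni)
    fix \<omega> assume \<omega>: "\<omega> \<in> space M"
    show "?N t \<omega> - exp (- (\<gamma> * z) - lam * t) \<le> ?N t \<omega> * indicator (E z t) \<omega>"
    proof (cases "\<omega> \<in> E z t")
      case False
      then have "- Y t \<omega> < z" using D_upper[of t t \<omega>] t0 \<omega> by (simp add: E_def)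
      then have "\<gamma> * Y t \<omega> \<le> - (\<gamma> * z)"
        using \<gamma> mult_left_mono_neg[of "- z" "Y t \<omega>" \<gamma>] by simp
      then show ?thesis using False unfolding N_eq by simp
    qed simp
  qed simp
  then have "1 - exp (- (\<gamma> * z) - lam * t) \<le> (\<integral>\<omega>. ?N t \<omega> * indicator (E z t) \<omega> \<partial>M)"
    using Ni N1 by (simp add: prob_space)
  then have "exp (\<gamma> * z) * (1 - exp (- (\<gamma> * z) - lam * t)) \<le> I"
    unfolding I_eq by (intro mult_left_mono) auto
  then show "exp (\<gamma> * z) - exp (- lam * t) \<le> I"
    by (simp add: right_diff_distrib mult_exp_exp)
qed

text \<open>By Tonelli the left-hand side is the mean of \<open>\<phi>\<close>, which is exp (-lam
  \<tau>) on paths that hit the level. Paths that have not hit it by time t contribute at most exp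
  (-lam t), so the bounds at a finite horizon close up as t grows.\<close>

lemma discounted_hitting_probability_pos:
  assumes z: "0 < z"
  shows "(\<integral>\<^sup>+s. ennreal (lam * exp (- lam * s)) * emeasure M (E z s) * indicator {0..} s \<partial>lborel) = ennreal (exp (\<gamma> * z))"
proof -
  define \<phi> where "\<phi> \<omega> = (\<integral>\<^sup>+s. ennreal (lam * exp (- lam * s)) * hit z s \<omega> * indicator {0..} s \<partial>lborel)" for \<omega>
  have \<phi>_M [measurable]: "\<phi> \<in> borel_measurable M"
    unfolding \<phi>_def by measurable
  have "(\<integral>\<^sup>+s. ennreal (lam * exp (- lam * s)) * emeasure M (E z s) * indicator {0..} s \<partial>lborel)
      = (\<integral>\<^sup>+s. \<integral>\<^sup>+\<omega>. ennreal (lam * exp (- lam * s)) * hit z s \<omega> * indicator {0..} s \<partial>M \<partial>lborel)"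
    unfolding emeasure_E by (simp add: nn_integral_cmult nn_integral_multc)
  also have "\<dots> = (\<integral>\<^sup>+\<omega>. \<phi> \<omega> \<partial>M)"
    unfolding \<phi>_def by (intro time_space.Fubini'[symmetric]) measurable
  finally have eq: "(\<integral>\<^sup>+s. ennreal (lam * exp (- lam * s)) * emeasure M (E z s) * indicator {0..} s \<partial>lborel) = (\<integral>\<^sup>+\<omega>. \<phi> \<omega> \<partial>M)" .
  have \<phi>_in: "\<phi> \<omega> = ennreal (exp (- lam * \<tau> z \<omega>))" if \<omega>: "\<omega> \<in> E z t" and t: "0 < t" for t \<omega>
  proof -
    have D: "z \<le> D t \<omega>" using \<omega> by (simp add: E_def)
    note h = hitting_time[OF z less_imp_le[OF t] D]
    have "\<phi> \<omega> = (\<integral>\<^sup>+s. ennreal (lam * exp (- lam * s)) * indicator {\<tau> z \<omega>..} s \<partial>lborel)"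
      unfolding \<phi>_def using h by (intro nn_integral_cong) (auto simp: hit_def indicator_def)
    then show ?thesis using nn_integral_exp_tail[OF lam] by simp
  qed
  have \<phi>_out: "\<phi> \<omega> \<le> ennreal (exp (- lam * t))" if \<omega>: "\<omega> \<in> space M - E z t" and t: "0 < t" for t \<omega>
  proof -
    have "\<phi> \<omega> \<le> (\<integral>\<^sup>+s. ennreal (lam * exp (- lam * s)) * indicator {t..} s \<partial>lborel)"
      unfolding \<phi>_def
    proof (intro nn_integral_mono)
      fix s :: real
      show "ennreal (lam * exp (- lam * s)) * hit z s \<omega> * indicator {0..} s \<le> ennreal (lam * exp (- lam * s)) * indicator {t..} s"
        using \<omega> D_mono[of s t \<omega>] by (auto simp: hit_def E_def indicator_def)
    qed
    then show ?thesis using nn_integral_exp_tail[OF lam] by simp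
  qed
  have lower: "ennreal (exp (\<gamma> * z) - exp (- lam * t)) \<le> (\<integral>\<^sup>+\<omega>. \<phi> \<omega> \<partial>M)"
    and upper: "(\<integral>\<^sup>+\<omega>. \<phi> \<omega> \<partial>M) \<le> ennreal (exp (\<gamma> * z) + exp (- lam * t))" if t: "0 < t" for t
  proof -
    let ?f = "\<lambda>\<omega>. exp (- lam * \<tau> z \<omega>) * indicator (E z t) \<omega> :: real"
    note b = stopped_exp_bounds[OF z t]
    have nn: "(\<integral>\<^sup>+\<omega>. ennreal (?f \<omega>) \<partial>M) = ennreal (\<integral>\<omega>. ?f \<omega> \<partial>M)"
      by (rule nn_integral_eq_integral[OF b(1)]) auto
    have "ennreal (exp (\<gamma> * z) - exp (- lam * t)) \<le> (\<integral>\<^sup>+\<omega>. ennreal (?f \<omega>) \<partial>M)"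
      unfolding nn using b(3) by (rule ennreal_leI)
    also have "\<dots> \<le> (\<integral>\<^sup>+\<omega>. \<phi> \<omega> \<partial>M)"
      using \<phi>_in[OF _ t] by (intro nn_integral_mono) (auto simp: indicator_def)
    finally show "ennreal (exp (\<gamma> * z) - exp (- lam * t)) \<le> (\<integral>\<^sup>+\<omega>. \<phi> \<omega> \<partial>M)" .
    have "(\<integral>\<^sup>+\<omega>. \<phi> \<omega> \<partial>M) \<le> (\<integral>\<^sup>+\<omega>. ennreal (?f \<omega>) + ennreal (exp (- lam * t)) \<partial>M)"
    proof (intro nn_integral_mono)
      fix \<omega> assume "\<omega> \<in> space M"
      then show "\<phi> \<omega> \<le> ennreal (?f \<omega>) + ennreal (exp (- lam * t))"
        using \<phi>_in[of \<omega> t] \<phi>_out[of \<omega> t] t by (cases "\<omega> \<in> E z t") auto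
    qed
    also have "\<dots> = ennreal (\<integral>\<omega>. ?f \<omega> \<partial>M) + ennreal (exp (- lam * t))"
      using borel_measurable_integrable[OF b(1)]
      by (subst nn_integral_add) (simp_all add: nn[unfolded mult_minus_left] emeasure_space_1)
    also have "\<dots> \<le> ennreal (exp (\<gamma> * z)) + ennreal (exp (- lam * t))"
      using b(2) by (intro add_right_mono ennreal_leI)
    finally show "(\<integral>\<^sup>+\<omega>. \<phi> \<omega> \<partial>M) \<le> ennreal (exp (\<gamma> * z) + exp (- lam * t))" by simp
  qed
  have lim: "(\<lambda>n. exp (- lam * real (Suc n))) \<longlonglongrightarrow> 0" using lam by real_asymp
  have "(\<lambda>n. ennreal (exp (\<gamma> * z) - exp (- lam * real (Suc n)))) \<longlonglongrightarrow> ennreal (exp (\<gamma> * z) - 0)"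
    by (intro tendsto_ennrealI tendsto_diff tendsto_const lim)
  then have "ennreal (exp (\<gamma> * z)) \<le> (\<integral>\<^sup>+\<omega>. \<phi> \<omega> \<partial>M)"
    using lower by (intro LIMSEQ_le_const2) auto
  moreover have "(\<lambda>n. ennreal (exp (\<gamma> * z) + exp (- lam * real (Suc n)))) \<longlonglongrightarrow> ennreal (exp (\<gamma> * z) + 0)"
    by (intro tendsto_ennrealI tendsto_add tendsto_const lim)
  then have "(\<integral>\<^sup>+\<omega>. \<phi> \<omega> \<partial>M) \<le> ennreal (exp (\<gamma> * z))"
    using upper by (intro LIMSEQ_le_const) auto
  ultimately show ?thesis unfolding eq by (rule antisym[rotated])
qed

text \<open>Level 0 is reached at time 0, outside the range of the stopping argument; there the
  exponential density simply integrates to 1.\<close>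

lemma discounted_hitting_probability:
  assumes z: "0 \<le> z"
  shows "(\<integral>\<^sup>+s. ennreal (lam * exp (- lam * s)) * emeasure M (E z s) * indicator {0..} s \<partial>lborel) = ennreal (exp (\<gamma> * z))"
proof (cases "z = 0")
  case True
  have "E 0 s = space M" if "0 \<le> s" for s using D_nonneg[OF that] by (auto simp: E_def)
  then have "(\<integral>\<^sup>+s. ennreal (lam * exp (- lam * s)) * emeasure M (E z s) * indicator {0..} s \<partial>lborel)
      = (\<integral>\<^sup>+s. ennreal (lam * exp (- lam * s)) * indicator {0..} s \<partial>lborel)"
    by (intro nn_integral_cong) (auto simp: True indicator_def emeasure_space_1)
  then show ?thesis using nn_integral_exp_tail[OF lam, of 0] True by simp
qed (use discounted_hitting_probability_pos z in auto)

text \<open>A Markov-type bound: hitting probabilities increase in time, so the discounted integral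
  is at least its part after t, which is at least exp (-lam t) P(E z t). The exponential decay in z
  it provides makes the second moment of \<open>L\<close> finite.\<close>

lemma emeasure_E_le:
  assumes z: "0 \<le> z" and t: "0 \<le> t"
  shows "emeasure M (E z t) \<le> ennreal (exp (lam * t) * exp (\<gamma> * z))"
proof -
  have "ennreal (exp (- lam * t)) * emeasure M (E z t)
      = (\<integral>\<^sup>+s. ennreal (lam * exp (- lam * s)) * indicator {t..} s \<partial>lborel) * emeasure M (E z t)"
    by (simp only: nn_integral_exp_tail[OF lam])
  also have "\<dots> = (\<integral>\<^sup>+s. ennreal (lam * exp (- lam * s)) * indicator {t..} s * emeasure M (E z t) \<partial>lborel)"
    by (simp add: nn_integral_multc)
  also have "\<dots> \<le> (\<integral>\<^sup>+s. ennreal (lam * exp (- lam * s)) * emeasure M (E z s) * indicator {0..} s \<partial>lborel)"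
  proof (intro nn_integral_mono)
    fix s :: real
    show "ennreal (lam * exp (- lam * s)) * indicator {t..} s * emeasure M (E z t)
      \<le> ennreal (lam * exp (- lam * s)) * emeasure M (E z s) * indicator {0..} s"
    proof (cases "t \<le> s")
      case True
      then have "emeasure M (E z t) \<le> emeasure M (E z s)"
        using t by (intro emeasure_mono E_mono E_sets)
      then show ?thesis using True t by (simp add: mult_left_mono)
    qed simp
  qed
  also have "\<dots> = ennreal (exp (\<gamma> * z))" by (rule discounted_hitting_probability[OF z])
  finally have "ennreal (exp (lam * t)) * (ennreal (exp (- lam * t)) * emeasure M (E z t))
      \<le> ennreal (exp (lam * t)) * ennreal (exp (\<gamma> * z))" by (rule mult_left_mono) simp
  then show ?thesis
    by (simp add: mult.assoc[symmetric] ennreal_mult[symmetric] mult_exp_exp)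
qed

text \<open>At the hitting time W equals \<kappa> \<tau> - z, so on \<open>E z t\<close> one has z +
  Y_t = (W_t - W_\<tau>) - \<kappa> (t - \<tau>). Optional stopping removes the first difference,
  and t - \<tau> is the time in [0, t] during which the level has already been hit.\<close>

lemma expectation_Y_on_hit:
  assumes z: "0 \<le> z" and t: "0 \<le> t"
  shows "(\<integral>\<omega>. (z + Y t \<omega>) * indicator (E z t) \<omega> \<partial>M)
    = - \<kappa> * enn2real (\<integral>\<^sup>+s. emeasure M (E z s) * indicator {0..t} s \<partial>lborel)"
proof -
  have WtE: "integrable M (\<lambda>\<omega>. W t \<omega> * indicator (E z t) \<omega>)"
    using integrable_mult_indicator[OF E_sets W_moments(1)[OF t], of z t] by (simp add: mult.commute)
  show ?thesis
  proof (cases "z = 0 \<or> t = 0")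
    case True
    show ?thesis
    proof (cases "t = 0")
      case True
      \<comment> \<open>At time 0 the maximum \<open>D\<close> is 0, so the event is empty unless z
        = 0, and in that case z + Y_0 = 0.\<close>
      have "(\<integral>\<omega>. (z + Y t \<omega>) * indicator (E z t) \<omega> \<partial>M) = (\<integral>\<omega>. 0 \<partial>M)"
        using z by (intro Bochner_Integration.integral_cong) (auto simp: True Y_0 E_def D_0 indicator_def)
      moreover have "(\<integral>\<^sup>+s. emeasure M (E z s) * indicator {0..t} s \<partial>lborel) = (\<integral>\<^sup>+s. 0 \<partial>(lborel::real measure))"
        unfolding True by (intro nn_integral_cong_AE) (use AE_lborel_singleton[of "0::real"] in \<open>eventually_elim, auto\<close>)
      ultimately show ?thesis by simp
    next
      case False
      then have z0: "z = 0" using True by simp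
      have E: "E z s = space M" if "0 \<le> s" for s
        using D_nonneg[OF that] z0 by (auto simp: E_def)
      have "(\<integral>\<^sup>+s. emeasure M (E z s) * indicator {0..t} s \<partial>lborel) = (\<integral>\<^sup>+s. indicator {0..t} s \<partial>lborel)"
        by (intro nn_integral_cong) (auto simp: indicator_def E emeasure_space_1)
      also have "\<dots> = ennreal t" using t by simp
      finally have "(\<integral>\<^sup>+s. emeasure M (E z s) * indicator {0..t} s \<partial>lborel) = ennreal t" .
      moreover have "(\<integral>\<omega>. (z + Y t \<omega>) * indicator (E z t) \<omega> \<partial>M) = (\<integral>\<omega>. W t \<omega> - \<kappa> * t \<partial>M)"
        unfolding E[OF t] by (intro Bochner_Integration.integral_cong) (auto simp: z0 Y_def)
      ultimately show ?thesis using t W_moments[OF t] by (simp add: prob_space)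
    qed
  next
    case False
    then have z: "0 < z" and t': "0 < t" using z t by auto
    note os = optional_stopping[OF L2_martingale_W z t']
    let ?g = "\<lambda>\<omega>. (t - \<tau> z \<omega>) * indicator (E z t) \<omega>"
    have W\<tau>: "W (\<tau> z \<omega>) \<omega> * indicator (E z t) \<omega> = (\<kappa> * \<tau> z \<omega> - z) * indicator (E z t) \<omega>" for \<omega>
      using hitting_time(3)[OF z t, of \<omega>] by (auto simp: indicator_def E_def Y_def)
    have g: "(\<integral>\<^sup>+s. hit z s \<omega> * indicator {0..t} s \<partial>lborel) = ennreal (?g \<omega>)" if \<omega>: "\<omega> \<in> space M" for \<omega>
    proof (cases "\<omega> \<in> E z t")
      case True
      then have D: "z \<le> D t \<omega>" by (simp add: E_def)
      note h = hitting_time[OF z t D]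
      have "(\<integral>\<^sup>+s. hit z s \<omega> * indicator {0..t} s \<partial>lborel) = (\<integral>\<^sup>+s. indicator {\<tau> z \<omega>..t} s \<partial>lborel)"
        using h by (intro nn_integral_cong) (auto simp: hit_def indicator_def)
      also have "\<dots> = ennreal (t - \<tau> z \<omega>)" using h by simp
      finally show ?thesis using True by simp
    next
      case False
      have "hit z s \<omega> * indicator {0..t} s = 0" for s
        using False \<omega> D_mono[of s t \<omega>] by (auto simp: hit_def E_def indicator_def)
      then show ?thesis using False by (simp only: nn_integral_const, simp)
    qed
    have g_eq: "?g \<omega> = enn2real (\<integral>\<^sup>+s. hit z s \<omega> * indicator {0..t} s \<partial>lborel)" and g_nn: "0 \<le> ?g \<omega>" if "\<omega> \<in> space M" for \<omega>
      using g[OF that] hitting_time(2)[OF z t, of \<omega>] by (auto simp: indicator_def E_def)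
    \<comment> \<open>\<open>\<tau>\<close> is given by an infimum over uncountably many times;
      measurability of t - \<tau> is read off from its representation as a time integral of
      \<open>hit\<close>.\<close>
    have gM: "?g \<in> borel_measurable M"
      by (subst measurable_cong[OF g_eq]) measurable
    have "(\<integral>\<omega>. ?g \<omega> \<partial>M) = enn2real (\<integral>\<^sup>+\<omega>. ennreal (?g \<omega>) \<partial>M)"
      using g_nn by (intro integral_eq_nn_integral gM AE_I2)
    also have "(\<integral>\<^sup>+\<omega>. ennreal (?g \<omega>) \<partial>M) = (\<integral>\<^sup>+\<omega>. \<integral>\<^sup>+s. hit z s \<omega> * indicator {0..t} s \<partial>lborel \<partial>M)"
      by (intro nn_integral_cong g[symmetric])
    also have "\<dots> = (\<integral>\<^sup>+s. \<integral>\<^sup>+\<omega>. hit z s \<omega> * indicator {0..t} s \<partial>M \<partial>lborel)"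
      by (intro time_space.Fubini') measurable
    also have "\<dots> = (\<integral>\<^sup>+s. emeasure M (E z s) * indicator {0..t} s \<partial>lborel)"
      unfolding emeasure_E by (intro nn_integral_cong nn_integral_multc) measurable
    finally have gint: "(\<integral>\<omega>. ?g \<omega> \<partial>M) = enn2real (\<integral>\<^sup>+s. emeasure M (E z s) * indicator {0..t} s \<partial>lborel)" .
    have "(\<integral>\<omega>. (z + Y t \<omega>) * indicator (E z t) \<omega> \<partial>M)
        = (\<integral>\<omega>. W t \<omega> * indicator (E z t) \<omega> - W (\<tau> z \<omega>) \<omega> * indicator (E z t) \<omega> + - \<kappa> * ?g \<omega> \<partial>M)"
      unfolding W\<tau> by (intro Bochner_Integration.integral_cong) (auto simp: Y_def algebra_simps)
    also have "\<dots> = (\<integral>\<omega>. W t \<omega> * indicator (E z t) \<omega> \<partial>M) - (\<integral>\<omega>. W (\<tau> z \<omega>) \<omega> * indicator (E z t) \<omega> \<partial>M) + - \<kappa> * (\<integral>\<omega>. ?g \<omega> \<partial>M)"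
    proof -
      have "integrable M ?g"
        by (rule integrable_const_bound[where B=t, OF _ gM])
           (use g_nn hitting_time(1)[OF z t] t in \<open>force simp: indicator_def E_def intro!: AE_I2\<close>)
      then show ?thesis
        using os(1) WtE by simp
    qed
    finally show ?thesis unfolding os(2) gint by simp
  qed
qed

end

section \<open>The linear cost\<close>

context discounted_brownian_motion
begin

definition L :: "real \<Rightarrow> real \<Rightarrow> 'a \<Rightarrow> real" where
  "L x t \<omega> = max 0 (D t \<omega> - x)"

definition X :: "real \<Rightarrow> real \<Rightarrow> 'a \<Rightarrow> real" where
  "X x t \<omega> = x + Y t \<omega> + L x t \<omega>"

definition mean_L :: "real \<Rightarrow> real \<Rightarrow> real" where
  "mean_L x t = (\<integral>\<omega>. L x t \<omega> \<partial>M)"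

definition mean_X :: "real \<Rightarrow> real \<Rightarrow> real" where
  "mean_X x t = (\<integral>\<omega>. X x t \<omega> \<partial>M)"

section \<open>Layer formulas and moments of the reflection term and the reflected path\<close>

lemma L_measurable [measurable (raw)]:
  assumes [measurable]: "f \<in> borel_measurable N" "g \<in> borel_measurable N" "h \<in> measurable N M"
  shows "(\<lambda>y. L (f y) (g y) (h y)) \<in> borel_measurable N"
  unfolding L_def by measurable

lemma X_measurable [measurable (raw)]:
  assumes [measurable]: "f \<in> borel_measurable N" "g \<in> borel_measurable N" "h \<in> measurable N M"
  shows "(\<lambda>y. X (f y) (g y) (h y)) \<in> borel_measurable N"
  unfolding X_def by measurable

lemma L_nonneg: "0 \<le> L x t \<omega>"
  by (simp add: L_def)

lemma X_nonneg: "0 \<le> t \<Longrightarrow> 0 \<le> X x t \<omega>"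
  using D_upper[of t t \<omega>] by (auto simp: X_def L_def)

lemma L_layers: "ennreal (L x t \<omega>) = (\<integral>\<^sup>+z. hit z t \<omega> * indicator {x..} z \<partial>lborel)"
proof -
  have "(\<integral>\<^sup>+z. hit z t \<omega> * indicator {x..} z \<partial>lborel) = (\<integral>\<^sup>+z. indicator {x..D t \<omega>} z \<partial>lborel)"
    by (intro nn_integral_cong) (auto simp: hit_def indicator_def)
  also have "\<dots> = ennreal (L x t \<omega>)"
    by (cases "x \<le> D t \<omega>") (auto simp: L_def max_def)
  finally show ?thesis by simp
qed

text \<open>The weight is the derivative of (z - x)^2, so the second moment of \<open>L\<close>
  becomes a weighted integral of hitting probabilities over the level.\<close>

lemma L_square_layers: "ennreal ((L x t \<omega>)\<^sup>2) = (\<integral>\<^sup>+z. ennreal (2 * (z - x)) * hit z t \<omega> * indicator {x..} z \<partial>lborel)"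
proof -
  have "(\<integral>\<^sup>+z. ennreal (2 * (z - x)) * hit z t \<omega> * indicator {x..} z \<partial>lborel)
      = (\<integral>\<^sup>+z. ennreal (2 * (z - x)) * indicator {x..D t \<omega>} z \<partial>lborel)"
    by (intro nn_integral_cong) (auto simp: hit_def indicator_def)
  also have "\<dots> = ennreal ((L x t \<omega>)\<^sup>2)"
  proof (cases "x \<le> D t \<omega>")
    case True
    have "(\<integral>\<^sup>+z. ennreal (2 * (z - x)) * indicator {x..D t \<omega>} z \<partial>lborel) = ennreal ((D t \<omega> - x)\<^sup>2 - (x - x)\<^sup>2)"
      by (rule nn_integral_FTC_Icc[where F="\<lambda>z. (z - x)\<^sup>2"]) (use True in \<open>auto intro!: derivative_eq_intros\<close>)
    then show ?thesis using True by (simp add: L_def max_def)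
  next
    case False
    then show ?thesis by (simp add: L_def)
  qed
  finally show ?thesis by simp
qed

lemma nn_expectation_L: "(\<integral>\<^sup>+\<omega>. ennreal (L x t \<omega>) \<partial>M) = (\<integral>\<^sup>+z. emeasure M (E z t) * indicator {x..} z \<partial>lborel)"
proof -
  have "(\<integral>\<^sup>+\<omega>. ennreal (L x t \<omega>) \<partial>M) = (\<integral>\<^sup>+z. \<integral>\<^sup>+\<omega>. hit z t \<omega> * indicator {x..} z \<partial>M \<partial>lborel)"
    unfolding L_layers by (intro time_space.Fubini') measurable
  also have "\<dots> = (\<integral>\<^sup>+z. emeasure M (E z t) * indicator {x..} z \<partial>lborel)"
    unfolding emeasure_E by (intro nn_integral_cong nn_integral_multc) measurable
  finally show ?thesis .
qed

lemma nn_expectation_L_square_finite: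
  assumes x: "0 \<le> x" and t: "0 \<le> t"
  shows "(\<integral>\<^sup>+\<omega>. ennreal ((L x t \<omega>)\<^sup>2) \<partial>M) < \<infinity>"
proof -
  \<comment> \<open>Half of the decay rate in z pays for the linear weight, since z - x \<le> exp (a
    z) / a; the other half remains and makes the integral converge.\<close>
  define a where "a = - \<gamma> / 2"
  have a: "0 < a" using \<gamma> by (simp add: a_def)
  have "(\<integral>\<^sup>+\<omega>. ennreal ((L x t \<omega>)\<^sup>2) \<partial>M)
      = (\<integral>\<^sup>+z. \<integral>\<^sup>+\<omega>. ennreal (2 * (z - x)) * hit z t \<omega> * indicator {x..} z \<partial>M \<partial>lborel)"
    unfolding L_square_layers by (intro time_space.Fubini') measurable
  also have "\<dots> = (\<integral>\<^sup>+z. ennreal (2 * (z - x)) * emeasure M (E z t) * indicator {x..} z \<partial>lborel)"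
    unfolding emeasure_E by (simp add: nn_integral_cmult nn_integral_multc)
  also have "\<dots> \<le> (\<integral>\<^sup>+z. ennreal (2 / a\<^sup>2 * exp (lam * t)) * (ennreal (a * exp (- a * z)) * indicator {0..} z) \<partial>lborel)"
  proof (intro nn_integral_mono)
    fix z :: real
    show "ennreal (2 * (z - x)) * emeasure M (E z t) * indicator {x..} z
      \<le> ennreal (2 / a\<^sup>2 * exp (lam * t)) * (ennreal (a * exp (- a * z)) * indicator {0..} z)"
    proof (cases "x \<le> z")
      case True
      then have z0: "0 \<le> z" using x by simp
      have "a * (z - x) \<le> a * z" using a x by simp
      also have "\<dots> \<le> exp (a * z)" using exp_ge_add_one_self[of "a * z"] by linarith
      finally have "z - x \<le> exp (a * z) / a" using a by (simp add: field_simps)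
      then have "2 * (z - x) * (exp (lam * t) * exp (\<gamma> * z)) \<le> 2 * (exp (a * z) / a) * (exp (lam * t) * exp (\<gamma> * z))"
        by (intro mult_right_mono) auto
      also have "\<dots> = 2 / a * exp (lam * t) * (exp (a * z) * exp (\<gamma> * z))" by simp
      also have "exp (a * z) * exp (\<gamma> * z) = exp (- a * z)"
        unfolding mult_exp_exp by (simp add: a_def field_simps)
      also have "2 / a * exp (lam * t) * exp (- a * z) = 2 / a\<^sup>2 * exp (lam * t) * (a * exp (- a * z))"
        using a by (simp add: power2_eq_square)
      finally have *: "2 * (z - x) * (exp (lam * t) * exp (\<gamma> * z)) \<le> 2 / a\<^sup>2 * exp (lam * t) * (a * exp (- a * z))" .
      have "ennreal (2 * (z - x)) * emeasure M (E z t) \<le> ennreal (2 * (z - x)) * ennreal (exp (lam * t) * exp (\<gamma> * z))"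
        by (intro mult_left_mono emeasure_E_le z0 t) simp
      also have "\<dots> = ennreal (2 * (z - x) * (exp (lam * t) * exp (\<gamma> * z)))"
        using True by (simp add: ennreal_mult)
      also have "\<dots> \<le> ennreal (2 / a\<^sup>2 * exp (lam * t) * (a * exp (- a * z)))"
        by (intro ennreal_leI *)
      also have "\<dots> = ennreal (2 / a\<^sup>2 * exp (lam * t)) * ennreal (a * exp (- a * z))"
        using a by (intro ennreal_mult) auto
      finally show ?thesis using True z0 by simp
    qed simp
  qed
  also have "\<dots> = ennreal (2 / a\<^sup>2 * exp (lam * t)) * ennreal (exp (- a * 0))"
    using nn_integral_exp_tail[OF a, of 0] by (subst nn_integral_cmult) auto
  also have "\<dots> < \<infinity>" by (simp add: ennreal_mult_less_top)
  finally show ?thesis .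
qed

lemma integrable_L:
  assumes x: "0 \<le> x" and t: "0 \<le> t"
  shows "integrable M (\<lambda>\<omega>. (L x t \<omega>)\<^sup>2)" "integrable M (L x t)"
proof -
  show 1: "integrable M (\<lambda>\<omega>. (L x t \<omega>)\<^sup>2)"
    by (rule integrableI_bounded) (use nn_expectation_L_square_finite[OF assms] in auto)
  show "integrable M (L x t)"
    by (rule square_integrable_imp_integrable[OF _ 1]) measurable
qed

lemma mean_L_nn: "0 \<le> x \<Longrightarrow> 0 \<le> t \<Longrightarrow> ennreal (mean_L x t) = (\<integral>\<^sup>+z. emeasure M (E z t) * indicator {x..} z \<partial>lborel)"
  unfolding mean_L_def nn_expectation_L[symmetric] using L_nonneg
  by (intro nn_integral_eq_integral[symmetric] integrable_L) auto

lemma mean_L_nonneg: "0 \<le> mean_L x t"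
  unfolding mean_L_def by (intro integral_nonneg_AE) (simp add: L_nonneg)

lemma mean_L_mono: "0 \<le> x \<Longrightarrow> 0 \<le> s \<Longrightarrow> s \<le> t \<Longrightarrow> mean_L x s \<le> mean_L x t"
  unfolding mean_L_def
proof (intro integral_mono integrable_L)
  fix \<omega> assume "0 \<le> s" "s \<le> t"
  then show "L x s \<omega> \<le> L x t \<omega>"
    using D_mono[of s t \<omega>] by (simp add: L_def max_def)
qed auto

lemma mean_L_measurable [measurable]: "mean_L x \<in> borel_measurable borel"
  unfolding mean_L_def[abs_def] by measurable

lemma mean_X_measurable [measurable]: "mean_X x \<in> borel_measurable borel"
  unfolding mean_X_def[abs_def] by measurable

lemma integrable_Y: "0 \<le> t \<Longrightarrow> integrable M (Y t)" "0 \<le> t \<Longrightarrow> integrable M (\<lambda>\<omega>. (Y t \<omega>)\<^sup>2)"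
  and expectation_Y: "0 \<le> t \<Longrightarrow> (\<integral>\<omega>. Y t \<omega> \<partial>M) = - \<kappa> * t"
  and expectation_Y_square: "0 \<le> t \<Longrightarrow> (\<integral>\<omega>. (Y t \<omega>)\<^sup>2 \<partial>M) = t + (\<kappa> * t)\<^sup>2"
  using W_moments[of t] by (auto simp: Y_def[abs_def] power2_diff prob_space)

lemma integrable_X: "0 \<le> x \<Longrightarrow> 0 \<le> t \<Longrightarrow> integrable M (X x t)"
  unfolding X_def[abs_def] using integrable_L integrable_Y by auto

lemma mean_X_eq: "0 \<le> x \<Longrightarrow> 0 \<le> t \<Longrightarrow> mean_X x t = x - \<kappa> * t + mean_L x t"
  unfolding mean_X_def X_def[abs_def] mean_L_def using integrable_L integrable_Y expectation_Y
  by (simp add: prob_space)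

lemma mean_X_nonneg: "0 \<le> t \<Longrightarrow> 0 \<le> mean_X x t"
  unfolding mean_X_def by (intro integral_nonneg_AE) (simp add: X_nonneg)

lemma mean_X_nn: "0 \<le> x \<Longrightarrow> 0 \<le> t \<Longrightarrow> (\<integral>\<^sup>+\<omega>. ennreal (X x t \<omega>) \<partial>M) = ennreal (mean_X x t)"
  unfolding mean_X_def by (intro nn_integral_eq_integral integrable_X) (auto simp: X_nonneg)

text \<open>After exchanging the integrals, the discounted time integral at level z is exp (\<gamma>
  z) / lam, and integrating it over z \<ge> x yields the further factor 1 / (-\<gamma>).\<close>

lemma discounted_mean_L:
  assumes x: "0 \<le> x"
  shows "(\<integral>\<^sup>+t. ennreal (exp (- lam * t) * mean_L x t) * indicator {0..} t \<partial>lborel) = ennreal (exp (\<gamma> * x) / (- \<gamma> * lam))"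
proof -
  have "(\<integral>\<^sup>+t. ennreal (exp (- lam * t) * mean_L x t) * indicator {0..} t \<partial>lborel)
      = (\<integral>\<^sup>+t. \<integral>\<^sup>+z. ennreal (exp (- lam * t)) * emeasure M (E z t) * indicator {0..} t * indicator {x..} z \<partial>lborel \<partial>lborel)"
  proof (intro nn_integral_cong)
    fix t :: real
    show "ennreal (exp (- lam * t) * mean_L x t) * indicator {0..} t
      = (\<integral>\<^sup>+z. ennreal (exp (- lam * t)) * emeasure M (E z t) * indicator {0..} t * indicator {x..} z \<partial>lborel)"
    proof (cases "0 \<le> t")
      case True
      then show ?thesis
        by (simp add: ennreal_mult mean_L_nonneg mean_L_nn[OF x] nn_integral_cmult mult.assoc)
    qed simp
  qed
  also have "\<dots> = (\<integral>\<^sup>+z. \<integral>\<^sup>+t. ennreal (exp (- lam * t)) * emeasure M (E z t) * indicator {0..} t * indicator {x..} z \<partial>lborel \<partial>lborel)"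
    by (intro lborel_pair.Fubini') measurable
  also have "\<dots> = (\<integral>\<^sup>+z. ennreal (1 / (- \<gamma> * lam)) * (ennreal (- \<gamma> * exp (\<gamma> * z)) * indicator {x..} z) \<partial>lborel)"
  proof (intro nn_integral_cong)
    fix z :: real
    show "(\<integral>\<^sup>+t. ennreal (exp (- lam * t)) * emeasure M (E z t) * indicator {0..} t * indicator {x..} z \<partial>lborel)
      = ennreal (1 / (- \<gamma> * lam)) * (ennreal (- \<gamma> * exp (\<gamma> * z)) * indicator {x..} z)"
    proof (cases "x \<le> z")
      case True
      then have z: "0 \<le> z" using x by simp
      have "ennreal (exp (- lam * t)) = ennreal (1 / lam) * ennreal (lam * exp (- lam * t))" for t
        using lam by (simp add: ennreal_mult[symmetric])
      then have "(\<integral>\<^sup>+t. ennreal (exp (- lam * t)) * emeasure M (E z t) * indicator {0..} t * indicator {x..} z \<partial>lborel)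
        = (\<integral>\<^sup>+t. ennreal (1 / lam) * (ennreal (lam * exp (- lam * t)) * emeasure M (E z t) * indicator {0..} t) \<partial>lborel)"
        using True by (simp add: mult.assoc)
      also have "\<dots> = ennreal (1 / lam) * ennreal (exp (\<gamma> * z))"
        unfolding discounted_hitting_probability[OF z, symmetric] by (intro nn_integral_cmult) measurable
      also have "\<dots> = ennreal (1 / (- \<gamma> * lam)) * ennreal (- \<gamma> * exp (\<gamma> * z))"
        using lam \<gamma> by (simp add: ennreal_mult[symmetric] mult_nonneg_nonpos zero_le_mult_iff mult_le_0_iff)
      finally show ?thesis using True by simp
    qed simp
  qed
  also have "\<dots> = ennreal (1 / (- \<gamma> * lam)) * ennreal (exp (\<gamma> * x))"
    using nn_integral_exp_tail[of "- \<gamma>" x] \<gamma> by (subst nn_integral_cmult) auto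
  also have "\<dots> = ennreal (exp (\<gamma> * x) / (- \<gamma> * lam))"
    using lam \<gamma> by (subst ennreal_mult[symmetric]) (auto simp: mult_le_0_iff)
  finally show ?thesis .
qed

definition linear_cost :: "real \<Rightarrow> real" where
  "linear_cost x = exp (\<gamma> * x) / (- \<gamma> * lam) + x / lam - \<kappa> / lam\<^sup>2"

lemma discounted_mean_X:
  assumes x: "0 \<le> x"
  shows "(\<integral>\<^sup>+t. ennreal (exp (- lam * t) * mean_X x t) * indicator {0..} t \<partial>lborel) = ennreal (linear_cost x)" (is "?c = _")
proof -
  \<comment> \<open>The mean x - \<kappa> t + E L_t contains a negative term; its discounted
    integral \<kappa> / lam^2 is added on the left so that all integrands are nonnegative.\<close>
  have "?c + ennreal (\<kappa> / lam\<^sup>2) = (\<integral>\<^sup>+t. ennreal (exp (- lam * t) * mean_X x t) * indicator {0..} t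
       + ennreal \<kappa> * (ennreal (t * exp (- lam * t)) * indicator {0..} t) \<partial>lborel)"
    using \<kappa> by (subst nn_integral_add)
      (simp_all add: nn_integral_cmult nn_integral_linear_exp[OF lam, simplified] ennreal_mult[symmetric])
  also have "\<dots> = (\<integral>\<^sup>+t. ennreal (x / lam) * (ennreal (lam * exp (- lam * t)) * indicator {0..} t)
       + ennreal (exp (- lam * t) * mean_L x t) * indicator {0..} t \<partial>lborel)"
  proof (intro nn_integral_cong)
    fix t :: real
    show "ennreal (exp (- lam * t) * mean_X x t) * indicator {0..} t + ennreal \<kappa> * (ennreal (t * exp (- lam * t)) * indicator {0..} t)
       = ennreal (x / lam) * (ennreal (lam * exp (- lam * t)) * indicator {0..} t) + ennreal (exp (- lam * t) * mean_L x t) * indicator {0..} t"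
    proof (cases "0 \<le> t")
      case True
      have "exp (- lam * t) * mean_X x t + \<kappa> * (t * exp (- lam * t)) = x / lam * (lam * exp (- lam * t)) + exp (- lam * t) * mean_L x t"
        using lam by (simp add: mean_X_eq[OF x True] algebra_simps)
      then show ?thesis
        using True x lam \<kappa> mean_X_nonneg[OF True, of x] mean_L_nonneg[of x t]
        by (simp add: ennreal_mult[symmetric] ennreal_plus[symmetric] del: ennreal_plus)
    qed simp
  qed
  also have "\<dots> = ennreal (x / lam) * ennreal (exp (- lam * 0)) + ennreal (exp (\<gamma> * x) / (- \<gamma> * lam))"
    by (subst nn_integral_add, measurable, subst nn_integral_cmult, measurable)
       (simp only: nn_integral_exp_tail[OF lam] discounted_mean_L[OF x])
  also have "\<dots> = ennreal (exp (\<gamma> * x) / (- \<gamma> * lam) + x / lam)"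
    using x lam \<gamma> by (simp add: ennreal_plus[symmetric] mult_le_0_iff divide_nonneg_neg mult_neg_pos less_imp_le add.commute del: ennreal_plus)
  finally show ?thesis
    using ennreal_eq_diff_of_add_eq[of ?c "\<kappa> / lam\<^sup>2"] \<kappa> by (simp add: linear_cost_def)
qed

end

section \<open>The quadratic cost\<close>

context discounted_brownian_motion
begin

lemma integrable_X_square:
  assumes "0 \<le> x" "0 \<le> t"
  shows "integrable M (\<lambda>\<omega>. (X x t \<omega>)\<^sup>2)"
proof (rule Bochner_Integration.integrable_bound)
  show "integrable M (\<lambda>\<omega>. 3 * (x\<^sup>2 + (Y t \<omega>)\<^sup>2 + (L x t \<omega>)\<^sup>2))"
    using integrable_Y(2)[OF assms(2)] integrable_L(1)[OF assms] by auto
  have "(a + b + c)\<^sup>2 \<le> 3 * (a\<^sup>2 + b\<^sup>2 + c\<^sup>2)" for a b c :: real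
    using zero_le_power2[of "a - b"] zero_le_power2[of "b - c"] zero_le_power2[of "a - c"]
    by (simp add: power2_eq_square algebra_simps)
  then show "AE \<omega> in M. norm ((X x t \<omega>)\<^sup>2) \<le> norm (3 * (x\<^sup>2 + (Y t \<omega>)\<^sup>2 + (L x t \<omega>)\<^sup>2))"
    by (simp add: X_def)
qed measurable

text \<open>The fundamental theorem of calculus applied to (z + Y_t)^2 between x and D_t: if D_t
  \<ge> x the reflected path is D_t + Y_t, otherwise it is x + Y_t and both sides vanish. The
  integrand changes sign, so a Bochner integral is used.\<close>

lemma X_square_layers:
  "(\<integral>z. (if x \<le> z \<and> z \<le> D t \<omega> then 2 * (z + Y t \<omega>) else 0) \<partial>lborel) = (X x t \<omega>)\<^sup>2 - (x + Y t \<omega>)\<^sup>2"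
proof (cases "x \<le> D t \<omega>")
  case True
  have "(\<integral>z. (if x \<le> z \<and> z \<le> D t \<omega> then 2 * (z + Y t \<omega>) else 0) \<partial>lborel)
      = (\<integral>z. 2 * (z + Y t \<omega>) * indicator {x..D t \<omega>} z \<partial>lborel)"
    by (intro Bochner_Integration.integral_cong) auto
  also have "\<dots> = (D t \<omega> + Y t \<omega>)\<^sup>2 - (x + Y t \<omega>)\<^sup>2"
    by (rule integral_FTC_Icc_real[OF True]) (auto intro!: derivative_eq_intros continuous_intros)
  finally show ?thesis using True by (simp add: X_def L_def add.commute)
next
  case False
  then have "(\<lambda>z. if x \<le> z \<and> z \<le> D t \<omega> then 2 * (z + Y t \<omega>) else 0) = (\<lambda>z. 0)" by auto
  then show ?thesis using False by (simp add: X_def L_def)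
qed

text \<open>Justifies Fubini for the signed layers. Between x and D_t the integrand is at most 2 (x
  + L + |Y|) in absolute value, on an interval of length L; the product 2 |Y| L is absorbed by Y^2 +
  L^2.\<close>

lemma integrable_layers:
  assumes x: "0 \<le> x" and t: "0 \<le> t"
  shows "integrable (lborel \<Otimes>\<^sub>M M) (\<lambda>(z, \<omega>). if x \<le> z \<and> z \<le> D t \<omega> then 2 * (z + Y t \<omega>) else 0 :: real)"
    (is "integrable _ (case_prod ?f)")
proof (rule integrableI_bounded)
  let ?g = "\<lambda>\<omega>. 2 * x * L x t \<omega> + 3 * (L x t \<omega>)\<^sup>2 + (Y t \<omega>)\<^sup>2"
  show m: "case_prod ?f \<in> borel_measurable (lborel \<Otimes>\<^sub>M M)" by measurable
  have "(\<integral>\<^sup>+p. ennreal (norm (case_prod ?f p)) \<partial>(lborel \<Otimes>\<^sub>M M))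
      = (\<integral>\<^sup>+\<omega>. \<integral>\<^sup>+z. ennreal (norm (?f z \<omega>)) \<partial>lborel \<partial>M)"
    using time_space.nn_integral_snd[of "\<lambda>p. ennreal (norm (case_prod ?f p))"] m by simp
  also have "\<dots> \<le> (\<integral>\<^sup>+\<omega>. ennreal (?g \<omega>) \<partial>M)"
  proof (intro nn_integral_mono)
    fix \<omega> assume \<omega>: "\<omega> \<in> space M"
    have "(\<integral>\<^sup>+z. ennreal (norm (?f z \<omega>)) \<partial>lborel)
        \<le> (\<integral>\<^sup>+z. ennreal (2 * (x + L x t \<omega> + \<bar>Y t \<omega>\<bar>)) * (hit z t \<omega> * indicator {x..} z) \<partial>lborel)"
    proof (intro nn_integral_mono)
      fix z :: real
      have "norm (2 * (z + Y t \<omega>)) \<le> 2 * (x + L x t \<omega> + \<bar>Y t \<omega>\<bar>)" if "x \<le> z" "z \<le> D t \<omega>"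
        using that x by (simp add: L_def abs_mult)
      then show "ennreal (norm (?f z \<omega>)) \<le> ennreal (2 * (x + L x t \<omega> + \<bar>Y t \<omega>\<bar>)) * (hit z t \<omega> * indicator {x..} z)"
        by (auto simp: hit_def indicator_def simp del: ennreal_plus intro!: ennreal_leI)
    qed
    also have "\<dots> = ennreal (2 * (x + L x t \<omega> + \<bar>Y t \<omega>\<bar>)) * ennreal (L x t \<omega>)"
      unfolding L_layers using \<omega> by (intro nn_integral_cmult) measurable
    also have "\<dots> = ennreal (2 * (x + L x t \<omega> + \<bar>Y t \<omega>\<bar>) * L x t \<omega>)"
      using x L_nonneg[of x t \<omega>] by (simp add: ennreal_mult)
    also have "\<dots> \<le> ennreal (?g \<omega>)"
    proof (rule ennreal_leI)
      have "2 * \<bar>Y t \<omega>\<bar> * L x t \<omega> \<le> (Y t \<omega>)\<^sup>2 + (L x t \<omega>)\<^sup>2"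
        using zero_le_power2[of "\<bar>Y t \<omega>\<bar> - L x t \<omega>"] by (simp add: power2_diff)
      then show "2 * (x + L x t \<omega> + \<bar>Y t \<omega>\<bar>) * L x t \<omega> \<le> ?g \<omega>"
        by (simp add: algebra_simps power2_eq_square)
    qed
    finally show "(\<integral>\<^sup>+z. ennreal (norm (?f z \<omega>)) \<partial>lborel) \<le> ennreal (?g \<omega>)" .
  qed
  also have "\<dots> = ennreal (\<integral>\<omega>. ?g \<omega> \<partial>M)"
    using integrable_L[OF assms] integrable_Y(2)[OF t] x L_nonneg
    by (intro nn_integral_eq_integral) auto
  also have "\<dots> < \<infinity>" by simp
  finally show "(\<integral>\<^sup>+p. ennreal (norm (case_prod ?f p)) \<partial>(lborel \<Otimes>\<^sub>M M)) < \<infinity>" .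
qed

lemma nn_integral_mean_L:
  assumes x: "0 \<le> x"
  shows "(\<integral>\<^sup>+s. ennreal (mean_L x s) * indicator {0..t} s \<partial>lborel)
    = (\<integral>\<^sup>+z. (\<integral>\<^sup>+s. emeasure M (E z s) * indicator {0..t} s \<partial>lborel) * indicator {x..} z \<partial>lborel)"
proof -
  have "(\<integral>\<^sup>+s. ennreal (mean_L x s) * indicator {0..t} s \<partial>lborel)
      = (\<integral>\<^sup>+s. \<integral>\<^sup>+z. emeasure M (E z s) * indicator {x..} z * indicator {0..t} s \<partial>lborel \<partial>lborel)"
  proof (intro nn_integral_cong)
    fix s :: real
    show "ennreal (mean_L x s) * indicator {0..t} s = (\<integral>\<^sup>+z. emeasure M (E z s) * indicator {x..} z * indicator {0..t} s \<partial>lborel)"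
      by (cases "0 \<le> s") (simp_all add: mean_L_nn[OF x] nn_integral_multc)
  qed
  also have "\<dots> = (\<integral>\<^sup>+z. \<integral>\<^sup>+s. emeasure M (E z s) * indicator {x..} z * indicator {0..t} s \<partial>lborel \<partial>lborel)"
    by (intro lborel_pair.Fubini') measurable
  also have "\<dots> = (\<integral>\<^sup>+z. \<integral>\<^sup>+s. emeasure M (E z s) * indicator {0..t} s * indicator {x..} z \<partial>lborel \<partial>lborel)"
    by (intro nn_integral_cong) (simp only: mult.assoc mult.commute mult.left_commute)
  also have "\<dots> = (\<integral>\<^sup>+z. (\<integral>\<^sup>+s. emeasure M (E z s) * indicator {0..t} s \<partial>lborel) * indicator {x..} z \<partial>lborel)"
    by (intro nn_integral_cong nn_integral_multc) measurable
  finally show ?thesis .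
qed

lemma expectation_X_square_diff:
  assumes x: "0 \<le> x" and t: "0 \<le> t"
  shows "(\<integral>\<omega>. (X x t \<omega>)\<^sup>2 - (x + Y t \<omega>)\<^sup>2 \<partial>M)
    = - 2 * \<kappa> * enn2real (\<integral>\<^sup>+s. ennreal (mean_L x s) * indicator {0..t} s \<partial>lborel)"
proof -
  let ?f = "\<lambda>z \<omega>. if x \<le> z \<and> z \<le> D t \<omega> then 2 * (z + Y t \<omega>) else 0 :: real"
  let ?h = "\<lambda>z. \<integral>\<^sup>+s. emeasure M (E z s) * indicator {0..t} s \<partial>lborel"
  \<comment> \<open>Finiteness matters because \<open>enn2real\<close> would turn an infinite value
    into 0.\<close>
  have h_fin: "?h z < \<infinity>" for z
  proof -
    have "?h z \<le> (\<integral>\<^sup>+s. indicator {0..t} s \<partial>lborel)"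
      by (intro nn_integral_mono) (auto simp: indicator_def emeasure_le_1)
    also have "\<dots> = ennreal t" using t by simp
    finally show ?thesis by (simp add: le_less_trans)
  qed
  have "(\<integral>\<omega>. (X x t \<omega>)\<^sup>2 - (x + Y t \<omega>)\<^sup>2 \<partial>M) = (\<integral>\<omega>. \<integral>z. ?f z \<omega> \<partial>lborel \<partial>M)"
    by (simp only: X_square_layers)
  also have "\<dots> = (\<integral>z. \<integral>\<omega>. ?f z \<omega> \<partial>M \<partial>lborel)"
    by (rule time_space.Fubini_integral[OF integrable_layers[OF assms]])
  also have "\<dots> = (\<integral>z. - 2 * \<kappa> * (enn2real (?h z) * indicator {x..} z) \<partial>lborel)"
  proof (intro Bochner_Integration.integral_cong refl)
    fix z :: real
    show "(\<integral>\<omega>. ?f z \<omega> \<partial>M) = - 2 * \<kappa> * (enn2real (?h z) * indicator {x..} z)"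
    proof (cases "x \<le> z")
      case True
      then have z: "0 \<le> z" using x by simp
      have "(\<integral>\<omega>. ?f z \<omega> \<partial>M) = (\<integral>\<omega>. 2 * ((z + Y t \<omega>) * indicator (E z t) \<omega>) \<partial>M)"
        using True by (intro Bochner_Integration.integral_cong) (auto simp: E_def indicator_def)
      then show ?thesis using True expectation_Y_on_hit[OF z t] by simp
    qed simp
  qed
  also have "\<dots> = - 2 * \<kappa> * (\<integral>z. enn2real (?h z) * indicator {x..} z \<partial>lborel)"
    by (rule integral_mult_right_zero)
  also have "(\<integral>z. enn2real (?h z) * indicator {x..} z \<partial>lborel) = enn2real (\<integral>\<^sup>+z. ennreal (enn2real (?h z) * indicator {x..} z) \<partial>lborel)"
    by (intro integral_eq_nn_integral) auto
  also have "(\<integral>\<^sup>+z. ennreal (enn2real (?h z) * indicator {x..} z) \<partial>lborel) = (\<integral>\<^sup>+z. ?h z * indicator {x..} z \<partial>lborel)"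
    using h_fin by (intro nn_integral_cong) (auto simp: indicator_def)
  finally show ?thesis unfolding nn_integral_mean_L[OF x] .
qed

lemma nn_expectation_X_square:
  assumes x: "0 \<le> x" and t: "0 \<le> t"
  shows "(\<integral>\<^sup>+\<omega>. ennreal ((X x t \<omega>)\<^sup>2) \<partial>M)
      + ennreal (2 * \<kappa>) * (\<integral>\<^sup>+s. ennreal (mean_X x s) * indicator {0..t} s \<partial>lborel) = ennreal (x\<^sup>2 + t)"
proof -
  let ?J = "\<integral>\<^sup>+s. ennreal (mean_L x s) * indicator {0..t} s \<partial>lborel"
  let ?K = "\<integral>\<^sup>+s. ennreal (mean_X x s) * indicator {0..t} s \<partial>lborel"
  define j where "j = enn2real ?J"
  have j0: "0 \<le> j" by (simp add: j_def)
  \<comment> \<open>Monotonicity of the mean in time bounds the integral on [0, t], so that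
    \<open>j\<close> is its true value and not the value 0 that \<open>enn2real\<close> assigns to
    infinity.\<close>
  have "?J \<le> (\<integral>\<^sup>+s. ennreal (mean_L x t) * indicator {0..t} s \<partial>lborel)"
    by (intro nn_integral_mono) (auto simp: indicator_def intro!: ennreal_leI mean_L_mono x)
  also have "\<dots> < \<infinity>" using t by (simp add: nn_integral_cmult ennreal_mult_less_top)
  finally have J: "?J = ennreal j" by (simp add: j_def)
  have quad: "(\<integral>\<^sup>+s. ennreal (\<kappa> * s) * indicator {0..t} s \<partial>lborel) = ennreal (\<kappa> * t\<^sup>2 / 2)"
  proof -
    have "(\<integral>\<^sup>+s. ennreal (\<kappa> * s) * indicator {0..t} s \<partial>lborel) = ennreal (\<kappa> * t\<^sup>2 / 2 - \<kappa> * 0\<^sup>2 / 2)"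
      by (rule nn_integral_FTC_Icc[where F="\<lambda>s. \<kappa> * s\<^sup>2 / 2"]) (use \<kappa> t in \<open>auto intro!: derivative_eq_intros\<close>)
    then show ?thesis by simp
  qed
  have "?K + ennreal (\<kappa> * t\<^sup>2 / 2) = (\<integral>\<^sup>+s. ennreal (mean_X x s) * indicator {0..t} s + ennreal (\<kappa> * s) * indicator {0..t} s \<partial>lborel)"
    unfolding quad[symmetric] by (subst nn_integral_add) auto
  also have "\<dots> = (\<integral>\<^sup>+s. ennreal x * indicator {0..t} s + ennreal (mean_L x s) * indicator {0..t} s \<partial>lborel)"
  proof (intro nn_integral_cong)
    fix s :: real
    show "ennreal (mean_X x s) * indicator {0..t} s + ennreal (\<kappa> * s) * indicator {0..t} s
      = ennreal x * indicator {0..t} s + ennreal (mean_L x s) * indicator {0..t} s"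
    proof (cases "s \<in> {0..t}")
      case True
      then have "mean_X x s + \<kappa> * s = x + mean_L x s" using mean_X_eq[OF x] by simp
      then show ?thesis
        using True x \<kappa> mean_X_nonneg[of s x] mean_L_nonneg[of x s] by (simp add: ennreal_plus[symmetric] del: ennreal_plus)
    qed simp
  qed
  also have "\<dots> = ennreal x * ennreal t + ennreal j"
    using t by (subst nn_integral_add) (auto simp: J nn_integral_cmult)
  also have "\<dots> = ennreal (x * t + j)" using x t j0 by (simp add: ennreal_mult)
  finally have K_add: "?K + ennreal (\<kappa> * t\<^sup>2 / 2) = ennreal (x * t + j)" .
  have K: "?K = ennreal (x * t + j - \<kappa> * t\<^sup>2 / 2)"
    using K_add \<kappa> by (intro ennreal_eq_diff_of_add_eq) auto
  have "ennreal (\<kappa> * t\<^sup>2 / 2) \<le> ennreal (x * t + j)"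
    unfolding K_add[symmetric] by (rule add_increasing) auto
  then have K0: "0 \<le> x * t + j - \<kappa> * t\<^sup>2 / 2"
    using x t j0 by (subst (asm) ennreal_le_iff) auto
  have i1: "integrable M (\<lambda>\<omega>. (x + Y t \<omega>)\<^sup>2)"
    unfolding power2_sum using integrable_Y[OF t] by auto
  have "(\<integral>\<omega>. (x + Y t \<omega>)\<^sup>2 \<partial>M) = x\<^sup>2 + (t + (\<kappa> * t)\<^sup>2) + 2 * x * (- \<kappa> * t)"
    unfolding power2_sum using integrable_Y[OF t] expectation_Y[OF t] expectation_Y_square[OF t]
    by (simp add: prob_space)
  then have EX2: "(\<integral>\<omega>. (X x t \<omega>)\<^sup>2 \<partial>M) = x\<^sup>2 + (t + (\<kappa> * t)\<^sup>2) + 2 * x * (- \<kappa> * t) - 2 * \<kappa> * j"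
    using expectation_X_square_diff[OF assms] integrable_X_square[OF assms] i1 by (simp add: j_def)
  have X2: "(\<integral>\<^sup>+\<omega>. ennreal ((X x t \<omega>)\<^sup>2) \<partial>M) = ennreal (\<integral>\<omega>. (X x t \<omega>)\<^sup>2 \<partial>M)" and pos: "0 \<le> (\<integral>\<omega>. (X x t \<omega>)\<^sup>2 \<partial>M)"
    by (auto intro!: nn_integral_eq_integral integrable_X_square assms)
  \<comment> \<open>The \<kappa>-terms from (x + Y_t)^2 and the term -2 \<kappa> j cancel against 2
    \<kappa> times the time integral of x - \<kappa> s + E L_s.\<close>
  have "(\<integral>\<omega>. (X x t \<omega>)\<^sup>2 \<partial>M) + 2 * \<kappa> * (x * t + j - \<kappa> * t\<^sup>2 / 2) = x\<^sup>2 + t"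
    unfolding EX2 by (simp add: power2_eq_square algebra_simps)
  then show ?thesis
    unfolding X2 K using K0 \<kappa> pos by (simp add: ennreal_mult[symmetric] ennreal_plus[symmetric] del: ennreal_plus)
qed

text \<open>Needed because \<open>ennreal\<close> sends negative reals to 0. By exp y \<ge> 1 + y
  the cost is at least 1 / (-\<gamma> lam) - \<kappa> / lam^2, and this is nonnegative since
  -\<kappa> \<gamma> \<le> lam by the equation for \<open>\<gamma>\<close>.\<close>

lemma linear_cost_nonneg: "0 \<le> linear_cost x"
proof -
  have "1 + \<gamma> * x \<le> exp (\<gamma> * x)" by (rule exp_ge_add_one_self)
  then have "(1 + \<gamma> * x) / (- \<gamma> * lam) \<le> exp (\<gamma> * x) / (- \<gamma> * lam)"
    using \<gamma> lam by (intro divide_right_mono) (auto simp: mult_le_0_iff)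
  moreover have "(1 + \<gamma> * x) / (- \<gamma> * lam) + x / lam = 1 / (- \<gamma> * lam)"
    using \<gamma> lam by (simp add: field_simps)
  moreover have "\<kappa> / lam\<^sup>2 \<le> 1 / (- \<gamma> * lam)"
  proof -
    have "\<kappa> * (- \<gamma>) \<le> lam" unfolding \<gamma>_eq[symmetric] by simp
    then have "\<kappa> * (- \<gamma>) / (- \<gamma> * lam\<^sup>2) \<le> lam / (- \<gamma> * lam\<^sup>2)"
      using \<gamma> lam by (intro divide_right_mono) (auto simp: mult_le_0_iff)
    then show ?thesis using \<gamma> lam by (simp add: power2_eq_square)
  qed
  ultimately show ?thesis unfolding linear_cost_def by linarith
qed

text \<open>The first two terms are the discounted integral of x^2 + t. The last comes from the
  running integral 2 \<kappa> \<integral> E X_s ds over [0, t], whose discounting costs one further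
  factor 1 / lam.\<close>

definition quadratic_cost :: "real \<Rightarrow> real" where
  "quadratic_cost x = x\<^sup>2 / lam + 1 / lam\<^sup>2 - 2 * \<kappa> / lam * linear_cost x"

text \<open>Integration by parts in the form of Tonelli: for fixed s the discount factor integrated
  over t \<ge> s is exp (-lam s) / lam.\<close>

lemma discounted_mean_X_integral:
  assumes x: "0 \<le> x"
  shows "(\<integral>\<^sup>+t. ennreal (exp (- lam * t)) * (\<integral>\<^sup>+s. ennreal (mean_X x s) * indicator {0..t} s \<partial>lborel) * indicator {0..} t \<partial>lborel)
    = ennreal (linear_cost x / lam)"
proof -
  have "(\<integral>\<^sup>+t. ennreal (exp (- lam * t)) * (\<integral>\<^sup>+s. ennreal (mean_X x s) * indicator {0..t} s \<partial>lborel) * indicator {0..} t \<partial>lborel)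
      = (\<integral>\<^sup>+t. \<integral>\<^sup>+s. (if 0 \<le> s \<and> s \<le> t then ennreal (exp (- lam * t)) * ennreal (mean_X x s) else 0) \<partial>lborel \<partial>lborel)"
  proof (intro nn_integral_cong)
    fix t :: real
    have "ennreal (exp (- lam * t)) * (\<integral>\<^sup>+s. ennreal (mean_X x s) * indicator {0..t} s \<partial>lborel) * indicator {0..} t
       = (\<integral>\<^sup>+s. ennreal (exp (- lam * t)) * (ennreal (mean_X x s) * indicator {0..t} s) * indicator {0..} t \<partial>lborel)"
      by (simp add: nn_integral_cmult nn_integral_multc)
    also have "\<dots> = (\<integral>\<^sup>+s. (if 0 \<le> s \<and> s \<le> t then ennreal (exp (- lam * t)) * ennreal (mean_X x s) else 0) \<partial>lborel)"
      by (intro nn_integral_cong) (auto simp: indicator_def)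
    finally show "ennreal (exp (- lam * t)) * (\<integral>\<^sup>+s. ennreal (mean_X x s) * indicator {0..t} s \<partial>lborel) * indicator {0..} t = \<dots>" .
  qed
  also have "\<dots> = (\<integral>\<^sup>+s. \<integral>\<^sup>+t. (if 0 \<le> s \<and> s \<le> t then ennreal (exp (- lam * t)) * ennreal (mean_X x s) else 0) \<partial>lborel \<partial>lborel)"
    by (intro lborel_pair.Fubini') measurable
  also have "\<dots> = (\<integral>\<^sup>+s. ennreal (1 / lam) * (ennreal (exp (- lam * s) * mean_X x s) * indicator {0..} s) \<partial>lborel)"
  proof (intro nn_integral_cong)
    fix s :: real
    show "(\<integral>\<^sup>+t. (if 0 \<le> s \<and> s \<le> t then ennreal (exp (- lam * t)) * ennreal (mean_X x s) else 0) \<partial>lborel)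
      = ennreal (1 / lam) * (ennreal (exp (- lam * s) * mean_X x s) * indicator {0..} s)"
    proof (cases "0 \<le> s")
      case True
      have "ennreal (exp (- lam * t)) = ennreal (1 / lam) * ennreal (lam * exp (- lam * t))" for t
        using lam by (simp add: ennreal_mult[symmetric])
      then have "(\<integral>\<^sup>+t. (if 0 \<le> s \<and> s \<le> t then ennreal (exp (- lam * t)) * ennreal (mean_X x s) else 0) \<partial>lborel)
          = (\<integral>\<^sup>+t. ennreal (1 / lam) * (ennreal (lam * exp (- lam * t)) * indicator {s..} t) * ennreal (mean_X x s) \<partial>lborel)"
        using True by (intro nn_integral_cong) (auto simp: indicator_def)
      also have "\<dots> = ennreal (1 / lam) * ennreal (exp (- lam * s)) * ennreal (mean_X x s)"
        unfolding nn_integral_exp_tail[OF lam, of s, symmetric] by (subst nn_integral_multc, measurable, subst nn_integral_cmult) auto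
      finally show ?thesis
        using True mean_X_nonneg[OF True, of x] by (simp add: ennreal_mult mult.assoc)
    qed simp
  qed
  also have "\<dots> = ennreal (1 / lam) * ennreal (linear_cost x)"
    unfolding discounted_mean_X[OF x, symmetric] by (intro nn_integral_cmult) measurable
  also have "\<dots> = ennreal (linear_cost x / lam)"
    using lam linear_cost_nonneg[of x] by (simp add: ennreal_mult[symmetric])
  finally show ?thesis .
qed

lemma discounted_mean_X_square:
  assumes x: "0 \<le> x"
  shows "(\<integral>\<^sup>+t. ennreal (exp (- lam * t)) * (\<integral>\<^sup>+\<omega>. ennreal ((X x t \<omega>)\<^sup>2) \<partial>M) * indicator {0..} t \<partial>lborel) = ennreal (quadratic_cost x)"
    (is "?c = _") and "0 \<le> quadratic_cost x"
proof -
  let ?K = "\<lambda>t. \<integral>\<^sup>+s. ennreal (mean_X x s) * indicator {0..t} s \<partial>lborel"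
  have K_meas [measurable]: "?K \<in> borel_measurable borel"
  proof -
    \<comment> \<open>With the moving interval written as a condition on the pair (t, s), the
      integrand is visibly jointly measurable.\<close>
    have "?K = (\<lambda>t. \<integral>\<^sup>+s. (if 0 \<le> s \<and> s \<le> t then ennreal (mean_X x s) else 0) \<partial>lborel)"
      by (intro ext nn_integral_cong) (auto simp: indicator_def)
    then show ?thesis by simp
  qed
  have "?c + ennreal (2 * \<kappa>) * ennreal (linear_cost x / lam)
      = (\<integral>\<^sup>+t. ennreal (exp (- lam * t)) * (\<integral>\<^sup>+\<omega>. ennreal ((X x t \<omega>)\<^sup>2) \<partial>M) * indicator {0..} t
          + ennreal (2 * \<kappa>) * (ennreal (exp (- lam * t)) * ?K t * indicator {0..} t) \<partial>lborel)"
  proof -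
    have "(\<integral>\<^sup>+t. ennreal (2 * \<kappa>) * (ennreal (exp (- lam * t)) * ?K t * indicator {0..} t) \<partial>lborel)
        = ennreal (2 * \<kappa>) * ennreal (linear_cost x / lam)"
      unfolding discounted_mean_X_integral[OF x, symmetric] by (intro nn_integral_cmult) measurable
    then show ?thesis
      by (subst nn_integral_add) (simp_all only:, measurable)
  qed
  also have "\<dots> = (\<integral>\<^sup>+t. ennreal (x\<^sup>2 / lam) * (ennreal (lam * exp (- lam * t)) * indicator {0..} t)
          + ennreal (t * exp (- lam * t)) * indicator {0..} t \<partial>lborel)"
  proof (intro nn_integral_cong)
    fix t :: real
    show "ennreal (exp (- lam * t)) * (\<integral>\<^sup>+\<omega>. ennreal ((X x t \<omega>)\<^sup>2) \<partial>M) * indicator {0..} t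
          + ennreal (2 * \<kappa>) * (ennreal (exp (- lam * t)) * ?K t * indicator {0..} t)
      = ennreal (x\<^sup>2 / lam) * (ennreal (lam * exp (- lam * t)) * indicator {0..} t)
          + ennreal (t * exp (- lam * t)) * indicator {0..} t"
    proof (cases "0 \<le> t")
      case True
      have "ennreal (exp (- lam * t)) * (\<integral>\<^sup>+\<omega>. ennreal ((X x t \<omega>)\<^sup>2) \<partial>M) + ennreal (2 * \<kappa>) * (ennreal (exp (- lam * t)) * ?K t)
         = ennreal (exp (- lam * t)) * ennreal (x\<^sup>2 + t)"
        unfolding nn_expectation_X_square[OF x True, symmetric] by (simp only: distrib_left mult.left_commute)
      also have "\<dots> = ennreal (x\<^sup>2 / lam * (lam * exp (- lam * t)) + t * exp (- lam * t))"
        using lam True by (simp add: ennreal_mult[symmetric] algebra_simps)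
      also have "\<dots> = ennreal (x\<^sup>2 / lam) * ennreal (lam * exp (- lam * t)) + ennreal (t * exp (- lam * t))"
        using lam True by (subst ennreal_plus) (auto simp: ennreal_mult[symmetric])
      finally show ?thesis using True by simp
    qed simp
  qed
  also have "\<dots> = ennreal (x\<^sup>2 / lam) * ennreal (exp (- lam * 0)) + ennreal (1 / lam\<^sup>2)"
    by (subst nn_integral_add, measurable, subst nn_integral_cmult, measurable)
       (simp only: nn_integral_exp_tail[OF lam] nn_integral_linear_exp[OF lam])
  also have "\<dots> = ennreal (x\<^sup>2 / lam + 1 / lam\<^sup>2)" using lam by simp
  also have "ennreal (2 * \<kappa>) * ennreal (linear_cost x / lam) = ennreal (2 * \<kappa> / lam * linear_cost x)"
    using \<kappa> lam linear_cost_nonneg[of x] by (simp add: ennreal_mult[symmetric])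
  finally have sum: "?c + ennreal (2 * \<kappa> / lam * linear_cost x) = ennreal (x\<^sup>2 / lam + 1 / lam\<^sup>2)" .
  then show "?c = ennreal (quadratic_cost x)"
    using ennreal_eq_diff_of_add_eq[of ?c "2 * \<kappa> / lam * linear_cost x"] \<kappa> lam linear_cost_nonneg[of x]
    by (simp add: quadratic_cost_def)
  \<comment> \<open>Nonnegativity of the quadratic cost comes for free: a summand of an
    \<open>ennreal\<close> identity is at most the sum.\<close>
  have "ennreal (2 * \<kappa> / lam * linear_cost x) \<le> ennreal (x\<^sup>2 / lam + 1 / lam\<^sup>2)"
    unfolding sum[symmetric] by (rule add_increasing) auto
  then show "0 \<le> quadratic_cost x"
    using lam by (subst (asm) ennreal_le_iff) (auto simp: quadratic_cost_def)
qed

section \<open>Both costs of the reflected path as iterated integrals\<close>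

lemma nn_cost_linear:
  assumes x: "0 \<le> x"
  shows "(\<integral>\<^sup>+\<omega>. \<integral>\<^sup>+t. ennreal (exp (- lam * t) * X x t \<omega>) * indicator {0..} t \<partial>lborel \<partial>M) = ennreal (linear_cost x)"
proof -
  have "(\<integral>\<^sup>+\<omega>. \<integral>\<^sup>+t. ennreal (exp (- lam * t) * X x t \<omega>) * indicator {0..} t \<partial>lborel \<partial>M)
      = (\<integral>\<^sup>+t. \<integral>\<^sup>+\<omega>. ennreal (exp (- lam * t) * X x t \<omega>) * indicator {0..} t \<partial>M \<partial>lborel)"
    by (intro time_space.Fubini') measurable
  also have "\<dots> = (\<integral>\<^sup>+t. ennreal (exp (- lam * t) * mean_X x t) * indicator {0..} t \<partial>lborel)"
  proof (intro nn_integral_cong)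
    fix t :: real
    show "(\<integral>\<^sup>+\<omega>. ennreal (exp (- lam * t) * X x t \<omega>) * indicator {0..} t \<partial>M) = ennreal (exp (- lam * t) * mean_X x t) * indicator {0..} t"
    proof (cases "0 \<le> t")
      case True
      then show ?thesis
        by (simp add: ennreal_mult X_nonneg mean_X_nonneg nn_integral_cmult mean_X_nn[OF x])
    qed simp
  qed
  finally show ?thesis by (simp only: discounted_mean_X[OF x])
qed

lemma nn_cost_quadratic:
  assumes x: "0 \<le> x"
  shows "(\<integral>\<^sup>+\<omega>. \<integral>\<^sup>+t. ennreal (exp (- lam * t) * (X x t \<omega>)\<^sup>2) * indicator {0..} t \<partial>lborel \<partial>M) = ennreal (quadratic_cost x)"
proof -
  have "(\<integral>\<^sup>+\<omega>. \<integral>\<^sup>+t. ennreal (exp (- lam * t) * (X x t \<omega>)\<^sup>2) * indicator {0..} t \<partial>lborel \<partial>M)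
      = (\<integral>\<^sup>+t. \<integral>\<^sup>+\<omega>. ennreal (exp (- lam * t) * (X x t \<omega>)\<^sup>2) * indicator {0..} t \<partial>M \<partial>lborel)"
    by (intro time_space.Fubini') measurable
  also have "\<dots> = (\<integral>\<^sup>+t. ennreal (exp (- lam * t)) * (\<integral>\<^sup>+\<omega>. ennreal ((X x t \<omega>)\<^sup>2) \<partial>M) * indicator {0..} t \<partial>lborel)"
    by (simp add: ennreal_mult nn_integral_cmult nn_integral_multc)
  finally show ?thesis by (simp only: discounted_mean_X_square[OF x])
qed

end

section \<open>Reflection, modification and control\<close>

context discounted_brownian_motion
begin

text \<open>The maximum can grow between r and s only through a point q in (r, s], where Y is close
  to Y_r by uniform continuity on a compact interval. That interval ends at t + 1, so nearby times
  are kept within distance 1 of t.\<close>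

lemma D_cont: "continuous_on {0..} (\<lambda>t. D t \<omega>)"
  unfolding continuous_on_iff
proof (intro ballI allI impI)
  fix t e :: real assume t: "t \<in> {0..}" and e: "0 < e"
  have "uniformly_continuous_on {0..t + 1} (\<lambda>s. Y s \<omega>)"
    by (intro compact_uniformly_continuous Y_cont) auto
  then obtain d where d: "0 < d"
    and Yd: "\<And>r s. r \<in> {0..t + 1} \<Longrightarrow> s \<in> {0..t + 1} \<Longrightarrow> dist s r < d \<Longrightarrow> dist (Y s \<omega>) (Y r \<omega>) < e"
    unfolding uniformly_continuous_on_def using e by metis
  have osc: "D s \<omega> < D r \<omega> + e" if rs: "0 \<le> r" "r \<le> s" "s \<le> t + 1" "s < r + d" for r s
  proof -
    obtain q where q: "q \<in> {0..s}" "D s \<omega> = - Y q \<omega>" using D_attained[of s \<omega>] rs by auto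
    show ?thesis
    proof (cases "q \<le> r")
      case True
      then show ?thesis using D_upper[of q r \<omega>] q e by auto
    next
      case False
      then have "dist (Y q \<omega>) (Y r \<omega>) < e" using q rs by (intro Yd) (auto simp: dist_real_def)
      then show ?thesis using D_upper[of r r \<omega>] rs q by (auto simp: dist_real_def)
    qed
  qed
  have "dist (D s \<omega>) (D t \<omega>) < e" if s: "s \<in> {0..}" "dist s t < min d 1" for s
  proof (cases "s \<le> t")
    case True
    then show ?thesis using osc[of s t] D_mono[of s t \<omega>] s t by (auto simp: dist_real_def)
  next
    case False
    then show ?thesis using osc[of t s] D_mono[of t s \<omega>] s t by (auto simp: dist_real_def)
  qed
  then show "\<exists>d>0. \<forall>s\<in>{0..}. dist s t < d \<longrightarrow> dist (D s \<omega>) (D t \<omega>) < e"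
    using d by (intro exI[of _ "min d 1"]) auto
qed

lemma L_cont: "continuous_on {0..} (\<lambda>t. L x t \<omega>)"
  unfolding L_def by (intro continuous_intros D_cont)

lemma L_mono: "mono_on {0..} (\<lambda>t. L x t \<omega>)"
proof (rule mono_onI)
  fix s t :: real assume "s \<in> {0..}" "s \<le> t"
  then show "L x s \<omega> \<le> L x t \<omega>" using D_mono[of s t \<omega>] by (auto simp: L_def)
qed

text \<open>If X_t = 2 d > 0, take a neighbourhood in which Y and L vary by less than d. An increase
  of L between r and s there forces a new maximum at some q in (r, s] with x + Y_q + L_s = 0, so X_t
  = (Y_t - Y_q) + (L_t - L_s) < 2 d, a contradiction.\<close>

lemma L_increases_only_at_zero:
  assumes "point_of_increase (\<lambda>s. L x s \<omega>) t"
  shows "X x t \<omega> = 0"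
proof (rule ccontr)
  assume "X x t \<omega> \<noteq> 0"
  have t: "0 \<le> t" using assms by (simp add: point_of_increase_def)
  define d where "d = X x t \<omega> / 2"
  have d: "0 < d" using X_nonneg[OF t, of x \<omega>] \<open>X x t \<omega> \<noteq> 0\<close> by (simp add: d_def)
  obtain e1 where e1: "0 < e1" "\<And>s. s \<in> {0..} \<Longrightarrow> dist s t < e1 \<Longrightarrow> dist (Y s \<omega>) (Y t \<omega>) < d"
    using Y_cont[of "{0..}" \<omega>] t d unfolding continuous_on_iff by (metis atLeast_iff)
  obtain e2 where e2: "0 < e2" "\<And>s. s \<in> {0..} \<Longrightarrow> dist s t < e2 \<Longrightarrow> dist (L x s \<omega>) (L x t \<omega>) < d"
    using L_cont[of x \<omega>] t d unfolding continuous_on_iff by (metis atLeast_iff)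
  obtain r s where rs: "0 \<le> r" "r < s" "\<bar>r - t\<bar> < min e1 e2" "\<bar>s - t\<bar> < min e1 e2" "L x r \<omega> < L x s \<omega>"
    using assms e1 e2 unfolding point_of_increase_def by (metis min_less_iff_conj)
  then have Ds: "L x s \<omega> = D s \<omega> - x" "D r \<omega> < D s \<omega>" by (auto simp: L_def max_def split: if_splits)
  obtain q where q: "q \<in> {0..s}" "D s \<omega> = - Y q \<omega>" using D_attained[of s \<omega>] rs by auto
  have "r < q" using D_upper[of q r \<omega>] q Ds by fastforce
  then have "dist (Y q \<omega>) (Y t \<omega>) < d" using rs q by (intro e1) (auto simp: dist_real_def)
  moreover have "dist (L x s \<omega>) (L x t \<omega>) < d" using rs by (intro e2) (auto simp: dist_real_def)
  ultimately have "Y t \<omega> - Y q \<omega> < d" "L x t \<omega> - L x s \<omega> < d"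
    by (simp_all add: dist_real_def abs_less_iff)
  moreover have "X x t \<omega> = (Y t \<omega> - Y q \<omega>) + (L x t \<omega> - L x s \<omega>)"
    using Ds q by (simp add: X_def)
  ultimately show False by (simp add: d_def)
qed

end

text \<open>The upper half of Skorokhod's formula. If l t exceeded m, the first time q at which l
  attains the value l t would be positive and a point of increase, so Z q = 0 and l q = - y q \<le>
  m.\<close>

lemma reflection_term_le:
  fixes l y Z :: "real \<Rightarrow> real"
  assumes Z: "\<And>s. 0 \<le> s \<Longrightarrow> Z s = y s + l s"
    and cont: "continuous_on {0..} l" and mono: "mono_on {0..} l" and l0: "l 0 = 0"
    and incr: "\<And>s. point_of_increase l s \<Longrightarrow> Z s = 0"
    and t: "0 \<le> t" and m: "0 \<le> m" "\<And>s. s \<in> {0..t} \<Longrightarrow> - y s \<le> m"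
  shows "l t \<le> m"
proof (rule ccontr)
  assume "\<not> l t \<le> m"
  then have lt: "m < l t" by simp
  define S where "S = {0..t} \<inter> l -` {l t..}"
  define q where "q = Inf S"
  have "closed S"
    unfolding S_def by (intro continuous_closed_preimage continuous_on_subset[OF cont]) auto
  moreover have "t \<in> S" using t by (simp add: S_def)
  moreover have bdd: "bdd_below S" by (auto simp: S_def intro!: bdd_belowI[of _ 0])
  ultimately have "q \<in> S" unfolding q_def by (intro closed_contains_Inf) auto
  then have q: "0 \<le> q" "q \<le> t" "l q = l t"
    using mono_onD[OF mono, of q t] by (auto simp: S_def)
  have q0: "0 < q" using q l0 lt m by (cases "q = 0") auto
  have below: "l r < l t" if "0 \<le> r" "r < q" for r
  proof (rule ccontr)
    assume "\<not> l r < l t"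
    then have "r \<in> S" using that q by (simp add: S_def)
    then have "q \<le> r" unfolding q_def by (rule cInf_lower[OF _ bdd])
    then show False using that by simp
  qed
  have "point_of_increase l q"
    unfolding point_of_increase_def
  proof (intro conjI allI impI q)
    fix e :: real assume "0 < e"
    then show "\<exists>r s. 0 \<le> r \<and> r < s \<and> \<bar>r - q\<bar> < e \<and> \<bar>s - q\<bar> < e \<and> l r < l s"
      using q0 q below[of "max 0 (q - e / 2)"] by (intro exI[of _ "max 0 (q - e / 2)"] exI[of _ q]) auto
  qed
  then have "y q + l q = 0" using incr[of q] Z[of q] q(1) by simp
  then show False using m(2)[of q] q lt by simp
qed

text \<open>The filtration is augmented by all null sets, so that \<open>W\<close> stays adapted when it is set to \<open>0\<close>
  where its path is discontinuous.\<close>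

lemma (in standard_brownian_motion) continuous_version:
  obtains F' W' where "continuous_brownian_motion M F' W'" "AE \<omega> in M. \<forall>t\<ge>0. W' t \<omega> = W t \<omega>"
proof -
  have "AE \<omega> in M. W 0 \<omega> = 0 \<and> continuous_on {0..} (\<lambda>t. W t \<omega>)"
    using W_zero W_continuous by auto
  then obtain N where N: "{\<omega> \<in> space M. \<not> (W 0 \<omega> = 0 \<and> continuous_on {0..} (\<lambda>t. W t \<omega>))} \<subseteq> N"
      "emeasure M N = 0" "N \<in> sets M" by (rule AE_E)
  define G where "G = space M - N"
  have G: "W 0 \<omega> = 0" "continuous_on {0..} (\<lambda>t. W t \<omega>)" if "\<omega> \<in> G" for \<omega>
    using that N by (auto simp: G_def)
  have GM [measurable]: "G \<in> sets M" using N by (simp add: G_def)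
  have AEG: "AE \<omega> in M. \<omega> \<in> G"
    by (rule AE_I[of _ _ N]) (use N in \<open>auto simp: G_def\<close>)
  define W' where "W' t \<omega> = (if \<omega> \<in> G then W (max 0 t) \<omega> else 0)" for t \<omega>
  \<comment> \<open>Describing the augmentation by representatives in \<open>F t\<close>, and not by
    generators, lets independence of the past pass over directly: a set and its representative have
    the same probability.\<close>
  define \<Sigma> where "\<Sigma> t = {A \<in> sets M. \<exists>B\<in>sets (F t). AE \<omega> in M. \<omega> \<in> A \<longleftrightarrow> \<omega> \<in> B}" for t
  define F' where "F' t = sigma (space M) (\<Sigma> t)" for t
  have sa: "sigma_algebra (space M) (\<Sigma> t)" for t
    unfolding sigma_algebra_iff2
  proof (intro conjI ballI allI impI)
    show "\<Sigma> t \<subseteq> Pow (space M)" using sets.sets_into_space by (auto simp: \<Sigma>_def)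
    show "{} \<in> \<Sigma> t" by (auto simp: \<Sigma>_def)
    fix A assume "A \<in> \<Sigma> t"
    then obtain B where B: "A \<in> sets M" "B \<in> sets (F t)" "AE \<omega> in M. \<omega> \<in> A \<longleftrightarrow> \<omega> \<in> B" by (auto simp: \<Sigma>_def)
    have "space M - B \<in> sets (F t)" using B(2) space_F[of t] by (metis sets.compl_sets)
    moreover have "AE \<omega> in M. \<omega> \<in> space M - A \<longleftrightarrow> \<omega> \<in> space M - B" using B(3) by eventually_elim auto
    ultimately show "space M - A \<in> \<Sigma> t" unfolding \<Sigma>_def using B(1) by blast
  next
    fix A :: "nat \<Rightarrow> 'a set" assume "range A \<subseteq> \<Sigma> t"
    then have "\<forall>i. \<exists>B\<in>sets (F t). AE \<omega> in M. \<omega> \<in> A i \<longleftrightarrow> \<omega> \<in> B" and A: "\<And>i. A i \<in> sets M"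
      by (auto simp: \<Sigma>_def)
    then obtain B where B: "\<And>i. B i \<in> sets (F t)" "\<And>i. AE \<omega> in M. \<omega> \<in> A i \<longleftrightarrow> \<omega> \<in> B i" by metis
    have "AE \<omega> in M. \<forall>i. \<omega> \<in> A i \<longleftrightarrow> \<omega> \<in> B i" using B(2) by (simp add: AE_all_countable)
    then have "AE \<omega> in M. \<omega> \<in> (\<Union>i. A i) \<longleftrightarrow> \<omega> \<in> (\<Union>i. B i)" by eventually_elim auto
    moreover have "(\<Union>i. B i) \<in> sets (F t)" using B(1) by auto
    moreover have "(\<Union>i. A i) \<in> sets M" using A by auto
    ultimately show "(\<Union>i. A i) \<in> \<Sigma> t" unfolding \<Sigma>_def by blast
  qed
  have sets_F': "sets (F' t) = \<Sigma> t" and space_F': "space (F' t) = space M" for t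
    unfolding F'_def using sigma_algebra.sets_measure_of_eq[OF sa] sigma_algebra.space_measure_of_eq[OF sa]
    by (auto simp: space_measure_of_conv)
  have W_M: "W t \<in> borel_measurable M" if "0 \<le> t" for t
    using adapted_W subalgebra_F[OF that] that by (auto simp: adapted_def intro: measurable_from_subalg)
  have W'_M: "W' t \<in> borel_measurable M" for t
    using W_M[of "max 0 t"] unfolding W'_def by simp
  have W'_AE: "AE \<omega> in M. \<forall>t\<ge>0. W' t \<omega> = W t \<omega>"
    using AEG by eventually_elim (auto simp: W'_def)
  have "continuous_brownian_motion M F' W'"
  proof
    fix t :: real assume t: "0 \<le> t"
    show "subalgebra M (F' t)"
      unfolding subalgebra_def sets_F' space_F' by (auto simp: \<Sigma>_def)
    show "W' t \<in> borel_measurable (F' t)"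
    proof (rule measurableI)
      fix A :: "real set" assume A: "A \<in> sets borel"
      have "AE \<omega> in M. \<omega> \<in> W' t -` A \<inter> space M \<longleftrightarrow> \<omega> \<in> W t -` A \<inter> space M"
        using W'_AE by eventually_elim (use t in auto)
      moreover have "W t -` A \<inter> space M \<in> sets (F t)"
        using adapted_W t measurable_sets[OF _ A, of "W t" "F t"] space_F[of t] by (simp add: adapted_def)
      ultimately show "W' t -` A \<inter> space (F' t) \<in> sets (F' t)"
        using measurable_sets[OF W'_M A] unfolding sets_F' space_F' \<Sigma>_def by blast
    qed simp
  next
    fix s t :: real assume st: "0 \<le> s" "s \<le> t"
    show "sets (F' s) \<subseteq> sets (F' t)"
      unfolding sets_F' \<Sigma>_def using sets_F_mono[OF st(2)] by blast
  next
    fix t \<omega> assume "t \<le> (0::real)"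
    then show "W' t \<omega> = 0" using G(1) by (simp add: W'_def max_def)
  next
    fix \<omega>
    show "continuous_on UNIV (\<lambda>t. W' t \<omega>)"
    proof (cases "\<omega> \<in> G")
      case True
      have "continuous_on UNIV (\<lambda>t. W (max 0 t) \<omega>)"
        by (rule continuous_on_compose2[OF G(2)[OF True]]) (auto intro!: continuous_intros)
      then show ?thesis using True by (simp add: W'_def)
    qed (simp add: W'_def)
  next
    fix s t :: real assume st: "0 \<le> s" "s < t"
    have inc: "AE \<omega> in M. W' t \<omega> - W' s \<omega> = W t \<omega> - W s \<omega>"
      using W'_AE by eventually_elim (use st in auto)
    have mW: "(\<lambda>\<omega>. W t \<omega> - W s \<omega>) \<in> borel_measurable M" using W_M st by auto
    have mW': "(\<lambda>\<omega>. W' t \<omega> - W' s \<omega>) \<in> borel_measurable M" using W'_M by auto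
    have "distr M lborel (\<lambda>\<omega>. W' t \<omega> - W' s \<omega>) = distr M lborel (\<lambda>\<omega>. W t \<omega> - W s \<omega>)"
      by (rule distr_cong_AE) (use inc mW mW' in auto)
    then show "distributed M lborel (\<lambda>\<omega>. W' t \<omega> - W' s \<omega>) (normal_density 0 (sqrt (t - s)))"
      using W_normal[OF st] mW' unfolding distributed_def by auto
    show "indep_set {(\<lambda>\<omega>. W' t \<omega> - W' s \<omega>) -` A \<inter> space M |A. A \<in> sets borel} (sets (F' s))"
      unfolding indep_sets2_eq
    proof (intro conjI ballI)
      show "{(\<lambda>\<omega>. W' t \<omega> - W' s \<omega>) -` A \<inter> space M |A. A \<in> sets borel} \<subseteq> events"
        using measurable_sets[OF mW'] by auto
      show "sets (F' s) \<subseteq> events" by (auto simp: sets_F' \<Sigma>_def)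
      fix a b assume "a \<in> {(\<lambda>\<omega>. W' t \<omega> - W' s \<omega>) -` A \<inter> space M |A. A \<in> sets borel}" "b \<in> sets (F' s)"
      then obtain A B where A: "A \<in> sets borel" "a = (\<lambda>\<omega>. W' t \<omega> - W' s \<omega>) -` A \<inter> space M"
        and b: "b \<in> sets M" and B: "B \<in> sets (F s)" "AE \<omega> in M. \<omega> \<in> b \<longleftrightarrow> \<omega> \<in> B"
        by (auto simp: sets_F' \<Sigma>_def)
      let ?a = "(\<lambda>\<omega>. W t \<omega> - W s \<omega>) -` A \<inter> space M"
      have aM: "a \<in> sets M" using measurable_sets[OF mW' A(1)] A(2) by simp
      have aM': "?a \<in> sets M" using measurable_sets[OF mW A(1)] .
      have BM: "B \<in> sets M" using B subalgebra_F[OF st(1)] by (auto simp: subalgebra_def)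
      have aa: "AE \<omega> in M. \<omega> \<in> a \<longleftrightarrow> \<omega> \<in> ?a" using inc by eventually_elim (auto simp: A)
      have "AE \<omega> in M. \<omega> \<in> a \<inter> b \<longleftrightarrow> \<omega> \<in> ?a \<inter> B" using aa B(2) by eventually_elim auto
      then have "prob (a \<inter> b) = prob (?a \<inter> B)"
        using aM b aM' BM by (intro finite_measure_eq_AE) auto
      also have "\<dots> = prob ?a * prob B"
        using W_indep[OF st] A(1) B(1) unfolding indep_sets2_eq by blast
      also have "prob ?a = prob a" using aa aM aM' by (intro finite_measure_eq_AE) auto
      also have "prob B = prob b" using B(2) b BM by (intro finite_measure_eq_AE) auto
      finally show "prob (a \<inter> b) = prob a * prob b" .
    qed
  qed
  then show ?thesis using W'_AE that by blast
qed

text \<open>For a nonnegative running cost both subtracted integrals are 0, so the convention for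
  \<infinity> - \<infinity> is never met and Tonelli and monotonicity in \<open>ennreal\<close>
  become available.\<close>

lemma discounted_cost_nonneg:
  assumes "AE \<omega> in M. \<forall>t\<ge>0. 0 \<le> f (Z t \<omega>)"
  shows "discounted_cost M lam f Z
    = enn2ereal (\<integral>\<^sup>+\<omega>. \<integral>\<^sup>+t. ennreal (exp (- lam * t) * f (Z t \<omega>)) * indicator {0..} t \<partial>lborel \<partial>M)"
proof -
  let ?I = "\<lambda>\<omega>. extended_integral (restrict_space lborel {0..}) (\<lambda>t. ereal (exp (- lam * t) * f (Z t \<omega>)))"
  let ?J = "\<lambda>\<omega>. \<integral>\<^sup>+t. ennreal (exp (- lam * t) * f (Z t \<omega>)) * indicator {0..} t \<partial>lborel"
  have inner: "AE \<omega> in M. ?I \<omega> = enn2ereal (?J \<omega>)"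
    using assms
  proof eventually_elim
    case (elim \<omega>)
    have "(\<integral>\<^sup>+t. e2ennreal (- ereal (exp (- lam * t) * f (Z t \<omega>))) \<partial>restrict_space lborel {0..})
        = (\<integral>\<^sup>+t. 0 \<partial>restrict_space (lborel :: real measure) {0..})"
      using elim by (intro nn_integral_cong) (auto simp: space_restrict_space ennreal_neg mult_nonneg_nonneg)
    moreover have "(\<integral>\<^sup>+t. e2ennreal (ereal (exp (- lam * t) * f (Z t \<omega>))) \<partial>restrict_space lborel {0..}) = ?J \<omega>"
      by (subst nn_integral_restrict_space) auto
    ultimately show ?case by (simp add: extended_integral_def zero_ennreal.rep_eq)
  qed
  have "(\<integral>\<^sup>+\<omega>. e2ennreal (?I \<omega>) \<partial>M) = (\<integral>\<^sup>+\<omega>. ?J \<omega> \<partial>M)"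
    by (rule nn_integral_cong_AE) (use inner in \<open>eventually_elim, simp\<close>)
  moreover have "(\<integral>\<^sup>+\<omega>. e2ennreal (- ?I \<omega>) \<partial>M) = (\<integral>\<^sup>+\<omega>. 0 \<partial>M)"
    by (rule nn_integral_cong_AE) (use inner in \<open>eventually_elim, simp add: e2ennreal_neg\<close>)
  ultimately show ?thesis
    unfolding discounted_cost_def extended_integral_def[of M] by (simp add: zero_ennreal.rep_eq)
qed

text \<open>The essential bound holds up to a null set of time and path together; Fubini for null
  sets turns it into a bound at almost every time on almost every path. The exceptional set of paths
  is then the same for all s and t.\<close>

lemma (in filtered_prob_space) control_drift_lower_bound:
  assumes u: "u \<in> controls M F \<kappa>" and \<kappa>: "0 \<le> \<kappa>"
  shows "AE \<omega> in M. \<forall>s t. 0 \<le> s \<longrightarrow> s \<le> t \<longrightarrow>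
    - \<kappa> * (t - s) \<le> (LBINT r:{0..t}. u r \<omega>) - (LBINT r:{0..s}. u r \<omega>)"
proof -
  let ?T = "restrict_space lborel {0..} :: real measure"
  have prog: "progressively_measurable F u"
    and ess: "esssup (?T \<Otimes>\<^sub>M M) (\<lambda>(t, \<omega>). ereal \<bar>u t \<omega>\<bar>) \<le> ereal \<kappa>"
    using u by (auto simp: controls_def)
  \<comment> \<open>The essential supremum of a non-measurable function is \<infinity> by
    definition, so the finite bound already contains joint measurability.\<close>
  have meas [measurable]: "(\<lambda>(t, \<omega>). ereal \<bar>u t \<omega>\<bar>) \<in> borel_measurable (?T \<Otimes>\<^sub>M M)"
  proof (rule ccontr)
    assume "\<not> ?thesis"
    then have "esssup (?T \<Otimes>\<^sub>M M) (\<lambda>(t, \<omega>). ereal \<bar>u t \<omega>\<bar>) = top" by (rule esssup_non_measurable)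
    then show False using ess by (simp add: top_ereal_def)
  qed
  have sf: "sigma_finite_measure ?T"
    by (rule sigma_finite_measure_restrict_space[OF lborel.sigma_finite_measure_axioms]) auto
  interpret P: pair_sigma_finite ?T M
    by (intro pair_sigma_finite.intro sf sigma_finite_measure_axioms)
  have AEp: "AE p in ?T \<Otimes>\<^sub>M M. \<bar>u (fst p) (snd p)\<bar> \<le> \<kappa>"
    using esssup_AE[of "\<lambda>(t, \<omega>). ereal \<bar>u t \<omega>\<bar>" "?T \<Otimes>\<^sub>M M"]
  proof eventually_elim
    case (elim p)
    from order_trans[OF this ess] show ?case by (simp add: case_prod_beta)
  qed
  have "AE t in ?T. AE \<omega> in M. \<bar>u t \<omega>\<bar> \<le> \<kappa>"
    using P.AE_pair[OF AEp] by simp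
  moreover have "{p \<in> space (?T \<Otimes>\<^sub>M M). \<bar>u (fst p) (snd p)\<bar> \<le> \<kappa>} \<in> sets (?T \<Otimes>\<^sub>M M)"
  proof -
    have "{p \<in> space (?T \<Otimes>\<^sub>M M). (\<lambda>(t, \<omega>). ereal \<bar>u t \<omega>\<bar>) p \<le> ereal \<kappa>} \<in> sets (?T \<Otimes>\<^sub>M M)" by measurable
    then show ?thesis by (simp add: case_prod_beta)
  qed
  ultimately have "AE \<omega> in M. AE t in ?T. \<bar>u t \<omega>\<bar> \<le> \<kappa>"
    by (subst (asm) P.AE_commute) auto
  then show ?thesis
    using AE_space
  proof eventually_elim
    case (elim \<omega>)
    have bound: "AE t in lborel. 0 \<le> t \<longrightarrow> \<bar>u t \<omega>\<bar> \<le> \<kappa>"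
      using elim(1) by (subst (asm) AE_restrict_space_iff) auto
    \<comment> \<open>Sections of the progressively measurable map are measurable; together with the
      bound this gives integrability, without which the integral of \<open>u\<close> would be the
      default value 0.\<close>
    have mu: "(\<lambda>r. indicator {0..t} r * u r \<omega>) \<in> borel_measurable borel" if "0 \<le> t" for t
    proof -
      have "(\<lambda>(s, \<omega>). u s \<omega>) \<in> borel_measurable (restrict_space borel {0..t} \<Otimes>\<^sub>M F t)"
        using prog that by (simp add: progressively_measurable_def)
      moreover have "\<omega> \<in> space (F t)" using elim(2) space_F by simp
      ultimately have "(\<lambda>r. u r \<omega>) \<in> borel_measurable (restrict_space borel {0..t})"
        using measurable_compose[OF measurable_Pair2'] by fastforce
      then show ?thesis
        by (subst (asm) borel_measurable_restrict_space_iff) auto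
    qed
    have int: "integrable lborel (\<lambda>r. indicator {0..t} r * u r \<omega>)" if "0 \<le> t" for t
    proof (rule Bochner_Integration.integrable_bound)
      show "integrable lborel (\<lambda>r. \<kappa> * indicator {0..t} r)" by (intro integrable_mult_right integrable_real_indicator) (use that in auto)
      show "AE r in lborel. norm (indicator {0..t} r * u r \<omega>) \<le> norm (\<kappa> * indicator {0..t} r)"
        using bound by eventually_elim (use \<kappa> in \<open>auto simp: indicator_def\<close>)
    qed (use mu[OF that] in simp)
    \<comment> \<open>Adding \<kappa> makes the integrand nonnegative almost everywhere, so its
      integral increases with t; this is the claimed bound rearranged.\<close>
    have shift: "(LBINT r:{0..t}. u r \<omega>) + \<kappa> * t = (\<integral>r. indicator {0..t} r * (u r \<omega> + \<kappa>) \<partial>lborel)"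
      and ints: "integrable lborel (\<lambda>r. indicator {0..t} r * (u r \<omega> + \<kappa>))" if t: "0 \<le> t" for t
    proof -
      have i\<kappa>: "integrable lborel (\<lambda>r. \<kappa> * indicator {0..t} r)"
        by (intro integrable_mult_right integrable_real_indicator) (use t in auto)
      have eq: "(\<lambda>r. indicator {0..t} r * (u r \<omega> + \<kappa>)) = (\<lambda>r. indicator {0..t} r * u r \<omega> + \<kappa> * indicator {0..t} r)"
        by (auto simp: algebra_simps)
      show "integrable lborel (\<lambda>r. indicator {0..t} r * (u r \<omega> + \<kappa>))"
        unfolding eq by (intro Bochner_Integration.integrable_add int t i\<kappa>)
      have "(\<integral>r. indicator {0..t} r * (u r \<omega> + \<kappa>) \<partial>lborel) = (\<integral>r. indicator {0..t} r * u r \<omega> \<partial>lborel) + (\<integral>r. \<kappa> * indicator {0..t} r \<partial>lborel)"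
        unfolding eq by (intro Bochner_Integration.integral_add int t i\<kappa>)
      then show "(LBINT r:{0..t}. u r \<omega>) + \<kappa> * t = (\<integral>r. indicator {0..t} r * (u r \<omega> + \<kappa>) \<partial>lborel)"
        using t by (simp add: set_lebesgue_integral_def)
    qed
    show ?case
    proof (intro allI impI)
      fix s t :: real assume st: "0 \<le> s" "s \<le> t"
      have "(\<integral>r. indicator {0..s} r * (u r \<omega> + \<kappa>) \<partial>lborel) \<le> (\<integral>r. indicator {0..t} r * (u r \<omega> + \<kappa>) \<partial>lborel)"
      proof (intro integral_mono_AE ints)
        show "AE r in lborel. indicator {0..s} r * (u r \<omega> + \<kappa>) \<le> indicator {0..t} r * (u r \<omega> + \<kappa>)"
          using bound by eventually_elim (use st in \<open>auto simp: indicator_def\<close>)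
      qed (use st in auto)
      then show "- \<kappa> * (t - s) \<le> (LBINT r:{0..t}. u r \<omega>) - (LBINT r:{0..s}. u r \<omega>)"
        using shift[of s] shift[of t] st by (simp add: algebra_simps)
    qed
  qed
qed

section \<open>Optimality of the constant control\<close>

text \<open>Controls and states refer to \<open>F\<close> and \<open>W\<close>; the explicit
  reflected path and its cost, with prefix \<open>B\<close>, refer to \<open>F'\<close> and
  \<open>W'\<close>. The two sides meet only through almost sure equality of the paths.\<close>

locale reflection_control_problem = standard_brownian_motion M F W +
  B: discounted_brownian_motion M F' W' \<kappa> lam \<gamma>
  for M :: "'a measure" and F :: "real \<Rightarrow> 'a measure" and W :: "real \<Rightarrow> 'a \<Rightarrow> real"
    and F' :: "real \<Rightarrow> 'a measure" and W' :: "real \<Rightarrow> 'a \<Rightarrow> real" and \<kappa> lam \<gamma> :: real +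
  assumes W'_eq: "AE \<omega> in M. \<forall>t\<ge>0. W' t \<omega> = W t \<omega>"
begin

lemma LBINT_const: "0 \<le> t \<Longrightarrow> (LBINT s:{0..t}. - \<kappa>) = - \<kappa> * t"
  by (simp add: set_lebesgue_integral_def)

lemma constant_control: "(\<lambda>t \<omega>. - \<kappa>) \<in> controls M F \<kappa>"
  unfolding controls_def progressively_measurable_def
  using B.\<kappa> by (auto intro!: esssup_I)

text \<open>The explicit path is the larger of x + Y_t and Y_t + D_t. Since l increases and the
  drift is at least -\<kappa>, Z_t - Z_s \<ge> Y_t - Y_s. Taking s = 0, where Z is at least x, and
  then s with D_t = - Y_s, where Z_s \<ge> 0, gives the two bounds.\<close>

lemma reflected_process_ge:
  assumes x: "0 \<le> x" and u: "u \<in> controls M F \<kappa>" and Z: "reflected_process M F W x u Z l"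
  shows "AE \<omega> in M. \<forall>t\<ge>0. B.X x t \<omega> \<le> Z t \<omega>"
proof -
  from Z have "AE \<omega> in M. (\<forall>t\<ge>0. Z t \<omega> = x + W t \<omega> + (LBINT s:{0..t}. u s \<omega>) + l t \<omega>)
      \<and> (\<forall>t\<ge>0. 0 \<le> Z t \<omega>) \<and> mono_on {0..} (\<lambda>t. l t \<omega>) \<and> l 0 \<omega> = 0"
    unfolding reflected_process_def by (auto elim: eventually_mono)
  then show ?thesis
    using W'_eq control_drift_lower_bound[OF u B.\<kappa>]
  proof eventually_elim
    case (elim \<omega>)
    define y where "y t = x + W t \<omega> + (LBINT s:{0..t}. u s \<omega>)" for t
    have Zt: "Z t \<omega> = y t + l t \<omega>" if "0 \<le> t" for t using elim that by (simp add: y_def)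
    have incr: "B.Y t \<omega> - B.Y s \<omega> \<le> y t - y s" if "0 \<le> s" "s \<le> t" for s t
    proof -
      have "- \<kappa> * (t - s) \<le> (LBINT r:{0..t}. u r \<omega>) - (LBINT r:{0..s}. u r \<omega>)" using elim that by blast
      then show ?thesis using elim that by (simp add: y_def B.Y_def algebra_simps)
    qed
    have mono: "mono_on {0..} (\<lambda>t. l t \<omega>)" using elim by blast
    have "(LBINT s:{0..0}. u s \<omega>) = 0"
      unfolding set_lebesgue_integral_def
      by (rule integral_eq_zero_AE) (use AE_lborel_singleton[of "0::real"] in \<open>eventually_elim, auto\<close>)
    then have y0: "y 0 = x" using elim B.W_nonpos[of 0 \<omega>] by (auto simp: y_def)
    show ?case
    proof (intro allI impI)
      fix t :: real assume t: "0 \<le> t"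
      have lmono: "l s \<omega> \<le> l t \<omega>" if "0 \<le> s" "s \<le> t" for s
        using mono_onD[OF mono, of s t] that by simp
      have "x + B.Y t \<omega> \<le> Z t \<omega>"
        using incr[of 0 t] lmono[of 0] Zt[OF t] t y0 elim by (simp add: B.Y_0)
      moreover have "B.Y t \<omega> + B.D t \<omega> \<le> Z t \<omega>"
      proof -
        obtain s where s: "s \<in> {0..t}" "B.D t \<omega> = - B.Y s \<omega>" using B.D_attained[OF t] by blast
        have "0 \<le> y s + l s \<omega>" using Zt[of s] s elim by auto
        then show ?thesis using incr[of s t] lmono[of s] Zt[OF t] s by simp
      qed
      ultimately show "B.X x t \<omega> \<le> Z t \<omega>" by (auto simp: B.X_def B.L_def)
    qed
  qed
qed

text \<open>One inequality is the comparison applied to the constant control; the other bounds l by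
  \<open>B.L\<close>, which dominates - (x + Y_s) for all s \<le> t.\<close>

lemma reflected_process_unique:
  assumes x: "0 \<le> x" and Z: "reflected_process M F W x (\<lambda>t \<omega>. - \<kappa>) Z l"
  shows "AE \<omega> in M. \<forall>t\<ge>0. Z t \<omega> = B.X x t \<omega>"
proof -
  from Z have "AE \<omega> in M. (\<forall>t\<ge>0. Z t \<omega> = x + W t \<omega> + (LBINT s:{0..t}. - \<kappa>) + l t \<omega>)
      \<and> continuous_on {0..} (\<lambda>t. l t \<omega>) \<and> mono_on {0..} (\<lambda>t. l t \<omega>) \<and> l 0 \<omega> = 0
      \<and> (\<forall>t. point_of_increase (\<lambda>s. l s \<omega>) t \<longrightarrow> Z t \<omega> = 0)"
    unfolding reflected_process_def by (auto elim: eventually_mono)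
  then show ?thesis
    using W'_eq reflected_process_ge[OF x constant_control Z]
  proof eventually_elim
    case (elim \<omega>)
    have Zt: "Z t \<omega> = (x + B.Y t \<omega>) + l t \<omega>" if "0 \<le> t" for t
      using elim that by (simp add: B.Y_def LBINT_const)
    show ?case
    proof (intro allI impI antisym)
      fix t :: real assume t: "0 \<le> t"
      have "l t \<omega> \<le> B.L x t \<omega>"
      proof (rule reflection_term_le[where Z="\<lambda>t. Z t \<omega>" and y="\<lambda>t. x + B.Y t \<omega>" and l="\<lambda>t. l t \<omega>" and t=t])
        show "- (x + B.Y s \<omega>) \<le> B.L x t \<omega>" if "s \<in> {0..t}" for s
          using B.D_upper[OF that, of \<omega>] by (simp add: B.L_def)
      qed (use elim Zt t B.L_nonneg in auto)
      then show "Z t \<omega> \<le> B.X x t \<omega>" using Zt[OF t] by (simp add: B.X_def)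
      show "B.X x t \<omega> \<le> Z t \<omega>" using elim t by blast
    qed
  qed
qed

text \<open>\<open>B.L\<close> is adapted to the augmented filtration only, so a version adapted to
  \<open>F\<close> is built from \<open>W\<close> itself.\<close>

lemma reflected_process_exists:
  assumes x: "0 \<le> x"
  shows "\<exists>Z l. reflected_process M F W x (\<lambda>t \<omega>. - \<kappa>) Z l"
proof -
  let ?Q = "{0..1} \<inter> \<rat> :: real set"
  \<comment> \<open>On the null set of irregular paths the supremum over rationals may be infinite,
    so it is taken in \<open>ereal\<close>, where countable suprema are always measurable; on the
    remaining paths it equals \<open>B.L\<close>.\<close>
  define l where "l t \<omega> = real_of_ereal (SUP q\<in>?Q. max 0 (ereal (- (x + W (q * t) \<omega> - \<kappa> * (q * t)))))" for t \<omega>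
  define Z where "Z t \<omega> = x + W t \<omega> - \<kappa> * t + l t \<omega>" for t \<omega>
  have Q0: "0 \<in> ?Q" by simp
  have W_F: "W s \<in> borel_measurable (F t)" if "0 \<le> s" "s \<le> t" for s t
  proof -
    have "subalgebra (F t) (F s)" using sets_F_mono[OF that(2)] by (simp add: subalgebra_def space_F)
    then show ?thesis using adapted_W that(1) by (auto simp: adapted_def intro: measurable_from_subalg)
  qed
  have l_F: "l t \<in> borel_measurable (F t)" if t: "0 \<le> t" for t
  proof -
    have "(\<lambda>\<omega>. SUP q\<in>?Q. max 0 (ereal (- (x + W (q * t) \<omega> - \<kappa> * (q * t))))) \<in> borel_measurable (F t)"
    proof (rule borel_measurable_SUP)
      show "countable ?Q" using countable_rat by auto
      fix q assume "q \<in> ?Q"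
      then have [measurable]: "W (q * t) \<in> borel_measurable (F t)"
        using t by (intro W_F) (auto simp: mult_left_le_one_le)
      show "(\<lambda>\<omega>. max 0 (ereal (- (x + W (q * t) \<omega> - \<kappa> * (q * t))))) \<in> borel_measurable (F t)" by measurable
    qed
    then show ?thesis unfolding l_def by measurable
  qed
  have l_eq: "AE \<omega> in M. \<forall>t\<ge>0. l t \<omega> = B.L x t \<omega>"
    using W'_eq
  proof eventually_elim
    case (elim \<omega>)
    show ?case
    proof (intro allI impI)
      fix t :: real assume t: "0 \<le> t"
      have "(SUP q\<in>?Q. max 0 (ereal (- (x + W (q * t) \<omega> - \<kappa> * (q * t))))) = (SUP q\<in>?Q. max 0 (ereal (- (x + B.Y (q * t) \<omega>))))"
        using elim t by (intro SUP_cong) (auto simp: B.Y_def algebra_simps)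
      also have "\<dots> = ereal (B.L x t \<omega>)"
      proof (rule SUP_eqI)
        fix q assume "q \<in> ?Q"
        then have "q * t \<in> {0..t}" using t by (auto simp: mult_left_le_one_le)
        from B.D_upper[OF this, of \<omega>] have "- (x + B.Y (q * t) \<omega>) \<le> B.L x t \<omega>" "0 \<le> B.L x t \<omega>"
          by (auto simp: B.L_def)
        then show "max 0 (ereal (- (x + B.Y (q * t) \<omega>))) \<le> ereal (B.L x t \<omega>)"
          by simp
      next
        fix b assume b: "\<And>q. q \<in> ?Q \<Longrightarrow> max 0 (ereal (- (x + B.Y (q * t) \<omega>))) \<le> b"
        have b0: "0 \<le> b" using b[OF Q0] by simp
        show "ereal (B.L x t \<omega>) \<le> b"
        proof (cases b)
          case (real r)
          have "B.D t \<omega> \<le> r + x"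
            unfolding B.D_rational
          proof (rule cSUP_least)
            show "?Q \<noteq> {}" using Q0 by blast
            show "- B.Y (q * t) \<omega> \<le> r + x" if "q \<in> ?Q" for q
              using b[OF that] real by simp
          qed
          then show ?thesis using real b0 by (simp add: B.L_def)
        qed (use b0 in auto)
      qed
      finally show "l t \<omega> = B.L x t \<omega>" by (simp add: l_def)
    qed
  qed
  have "reflected_process M F W x (\<lambda>t \<omega>. - \<kappa>) Z l"
    unfolding reflected_process_def
  proof (intro conjI)
    show "adapted F Z" "adapted F l"
      unfolding adapted_def Z_def using l_F W_F by auto
    show "AE \<omega> in M. (\<forall>t\<ge>0. Z t \<omega> = x + W t \<omega> + (LBINT s:{0..t}. - \<kappa>) + l t \<omega>) \<and>
        (\<forall>t\<ge>0. 0 \<le> Z t \<omega>) \<and> continuous_on {0..} (\<lambda>t. l t \<omega>) \<and> mono_on {0..} (\<lambda>t. l t \<omega>) \<and>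
        l 0 \<omega> = 0 \<and> (\<forall>t. point_of_increase (\<lambda>s. l s \<omega>) t \<longrightarrow> Z t \<omega> = 0)"
      using l_eq W'_eq
    proof eventually_elim
      case (elim \<omega>)
      have ZX: "Z t \<omega> = B.X x t \<omega>" if "0 \<le> t" for t
        using elim that by (simp add: Z_def B.X_def B.Y_def)
      have "continuous_on {0..} (\<lambda>t. l t \<omega>)"
        using B.L_cont[of x \<omega>] by (rule continuous_on_eq) (use elim in auto)
      moreover have "mono_on {0..} (\<lambda>t. l t \<omega>)"
        using B.L_mono[of x \<omega>] elim by (auto simp: mono_on_def)
      moreover have "l 0 \<omega> = 0" using elim x by (simp add: B.L_def B.D_0)
      moreover have "Z t \<omega> = 0" if "point_of_increase (\<lambda>s. l s \<omega>) t" for t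
      proof -
        have "point_of_increase (\<lambda>s. B.L x s \<omega>) t"
          using that elim unfolding point_of_increase_def by (smt (verit))
        then show ?thesis using B.L_increases_only_at_zero ZX that by (simp add: point_of_increase_def)
      qed
      ultimately show ?case using ZX B.X_nonneg by (auto simp: Z_def LBINT_const)
    qed
  qed
  then show ?thesis by blast
qed

text \<open>Reduces the control problem to one number. Uniqueness gives every state driven by
  -\<kappa> the cost c, existence puts c into the set of costs, and the pathwise comparison with
  monotone f makes c a lower bound.\<close>

lemma value_function_eq:
  assumes x: "0 \<le> x" and f_mono: "mono_on {0..} f" and f0: "0 \<le> f 0" and c: "0 \<le> c"
    and cost: "(\<integral>\<^sup>+\<omega>. \<integral>\<^sup>+t. ennreal (exp (- lam * t) * f (B.X x t \<omega>)) * indicator {0..} t \<partial>lborel \<partial>M) = ennreal c"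
  shows "value_function M F W \<kappa> lam f x = ereal c"
    and "reflected_process M F W x (\<lambda>t \<omega>. - \<kappa>) Z l \<Longrightarrow> discounted_cost M lam f Z = ereal c"
proof -
  have f_nonneg: "0 \<le> f y" if "0 \<le> y" for y
    using f0 mono_onD[OF f_mono, of 0 y] that by simp
  have opt: "discounted_cost M lam f Z = ereal c" if Z: "reflected_process M F W x (\<lambda>t \<omega>. - \<kappa>) Z l" for Z l
  proof -
    note eq = reflected_process_unique[OF x Z]
    have "AE \<omega> in M. \<forall>t\<ge>0. 0 \<le> f (Z t \<omega>)"
      using eq by eventually_elim (auto intro!: f_nonneg B.X_nonneg)
    moreover have "(\<integral>\<^sup>+\<omega>. \<integral>\<^sup>+t. ennreal (exp (- lam * t) * f (Z t \<omega>)) * indicator {0..} t \<partial>lborel \<partial>M) = ennreal c"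
      unfolding cost[symmetric]
    proof (rule nn_integral_cong_AE)
      show "AE \<omega> in M. (\<integral>\<^sup>+t. ennreal (exp (- lam * t) * f (Z t \<omega>)) * indicator {0..} t \<partial>lborel)
          = (\<integral>\<^sup>+t. ennreal (exp (- lam * t) * f (B.X x t \<omega>)) * indicator {0..} t \<partial>lborel)"
        using eq by eventually_elim (auto intro!: nn_integral_cong simp: indicator_def)
    qed
    ultimately show ?thesis using c by (simp add: discounted_cost_nonneg enn2ereal_ennreal)
  qed
  then show "reflected_process M F W x (\<lambda>t \<omega>. - \<kappa>) Z l \<Longrightarrow> discounted_cost M lam f Z = ereal c" .
  have lower: "ereal c \<le> discounted_cost M lam f Z"
    if u: "u \<in> controls M F \<kappa>" and Z: "reflected_process M F W x u Z l" for u Z l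
  proof -
    note ge = reflected_process_ge[OF x u Z]
    have pos: "AE \<omega> in M. \<forall>t\<ge>0. 0 \<le> f (Z t \<omega>)"
      using ge by eventually_elim (auto intro!: f_nonneg intro: order_trans[OF B.X_nonneg])
    have "ennreal c \<le> (\<integral>\<^sup>+\<omega>. \<integral>\<^sup>+t. ennreal (exp (- lam * t) * f (Z t \<omega>)) * indicator {0..} t \<partial>lborel \<partial>M)"
      unfolding cost[symmetric]
    proof (rule nn_integral_mono_AE)
      show "AE \<omega> in M. (\<integral>\<^sup>+t. ennreal (exp (- lam * t) * f (B.X x t \<omega>)) * indicator {0..} t \<partial>lborel)
          \<le> (\<integral>\<^sup>+t. ennreal (exp (- lam * t) * f (Z t \<omega>)) * indicator {0..} t \<partial>lborel)"
        using ge
      proof eventually_elim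
        case (elim \<omega>)
        have "f (B.X x t \<omega>) \<le> f (Z t \<omega>)" if "0 \<le> t" for t
          using elim that B.X_nonneg[OF that, of x \<omega>] by (intro mono_onD[OF f_mono]) auto
        then show ?case
          by (intro nn_integral_mono) (auto simp: indicator_def intro!: ennreal_leI mult_left_mono)
      qed
    qed
    then have "enn2ereal (ennreal c) \<le> discounted_cost M lam f Z"
      unfolding discounted_cost_nonneg[where f=f and Z=Z, OF pos] by (simp add: less_eq_ennreal.rep_eq)
    then show ?thesis using c by (simp add: enn2ereal_ennreal)
  qed
  obtain Z l where "reflected_process M F W x (\<lambda>t \<omega>. - \<kappa>) Z l"
    using reflected_process_exists[OF x] by blast
  then have "ereal c \<in> {discounted_cost M lam f X |u X L. u \<in> controls M F \<kappa> \<and> reflected_process M F W x u X L}"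
    using opt constant_control by (metis (mono_tags, lifting) mem_Collect_eq)
  then show "value_function M F W \<kappa> lam f x = ereal c"
    unfolding value_function_def using lower by (intro antisym Inf_lower Inf_greatest) auto
qed

end

section \<open>The value functions\<close>

context discounted_brownian_motion
begin

lemma linear_cost_deriv: "(linear_cost has_real_derivative (1 - exp (\<gamma> * x)) / lam) (at x)"
  unfolding linear_cost_def[abs_def] using \<gamma> lam
  by (auto intro!: derivative_eq_intros simp: field_simps)

lemma linear_cost_deriv_pos: "0 < x \<Longrightarrow> 0 < (1 - exp (\<gamma> * x)) / lam"
  using \<gamma> lam by (simp add: mult_neg_pos)

lemma quadratic_cost_deriv:
  "(quadratic_cost has_real_derivative 2 * (lam * x - \<kappa> * (1 - exp (\<gamma> * x))) / lam\<^sup>2) (at x)"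
  unfolding quadratic_cost_def[abs_def] using lam
  by (auto intro!: derivative_eq_intros linear_cost_deriv simp: field_simps power2_eq_square)

text \<open>From 1 - exp (\<gamma> x) \<le> -\<gamma> x and -\<kappa> \<gamma> = lam - \<gamma>^2 /
  2; strictness comes from \<gamma> being nonzero.\<close>

lemma quadratic_cost_deriv_pos:
  assumes "0 < x"
  shows "0 < 2 * (lam * x - \<kappa> * (1 - exp (\<gamma> * x))) / lam\<^sup>2"
proof -
  have "1 - exp (\<gamma> * x) \<le> - \<gamma> * x"
    using exp_ge_add_one_self[of "\<gamma> * x"] by linarith
  then have "\<kappa> * (1 - exp (\<gamma> * x)) \<le> \<kappa> * (- \<gamma> * x)"
    using \<kappa> by (rule mult_left_mono)
  also have "\<dots> = (lam - \<gamma>\<^sup>2 / 2) * x" unfolding \<gamma>_eq[symmetric] by simp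
  also have "\<dots> < lam * x" using assms \<gamma> by (intro mult_strict_right_mono) auto
  finally show ?thesis using lam by simp
qed

lemma quadratic_cost_eq:
  "quadratic_cost x = 2 * \<kappa> * exp (\<gamma> * x) / (lam\<^sup>2 * \<gamma>) + x\<^sup>2 / lam - 2 * \<kappa> * x / lam\<^sup>2 + (2 * \<kappa>\<^sup>2 + lam) / lam^3"
  unfolding quadratic_cost_def linear_cost_def using \<gamma> lam
  by (simp add: field_simps power2_eq_square power3_eq_cube)

end

theorem mainTheorem8:
  fixes M :: "'a measure" and F :: "real \<Rightarrow> 'a measure" and W :: "real \<Rightarrow> 'a \<Rightarrow> real"
    and \<kappa> lam :: real
  assumes "standard_brownian_motion M F W"
    and "\<kappa> \<ge> 0" and "lam > 0"
  shows
    "(\<forall>x\<ge>0. value_function M F W \<kappa> lam (\<lambda>y. y) x =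
        ereal (exp ((\<kappa> - sqrt (\<kappa>\<^sup>2 + 2 * lam)) * x) / (lam * (- \<kappa> + sqrt (\<kappa>\<^sup>2 + 2 * lam)))
               + x / lam - \<kappa> / lam\<^sup>2)) \<and>
     (\<forall>x\<ge>0. value_function M F W \<kappa> lam (\<lambda>y. y\<^sup>2) x =
        ereal (2 * \<kappa> * exp ((\<kappa> - sqrt (\<kappa>\<^sup>2 + 2 * lam)) * x) / (lam\<^sup>2 * (\<kappa> - sqrt (\<kappa>\<^sup>2 + 2 * lam)))
               + x\<^sup>2 / lam - 2 * \<kappa> * x / lam\<^sup>2 + (2 * \<kappa>\<^sup>2 + lam) / lam^3)) \<and>
     (\<forall>f \<in> {\<lambda>y. y, \<lambda>y. y\<^sup>2}.
        (\<forall>x>0. \<exists>D>0. ((\<lambda>y. real_of_ereal (value_function M F W \<kappa> lam f y))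
                         has_real_derivative D) (at x)) \<and>
        (\<lambda>t \<omega>. - \<kappa>) \<in> controls M F \<kappa> \<and>
        (\<forall>x\<ge>0. (\<exists>X L. reflected_process M F W x (\<lambda>t \<omega>. - \<kappa>) X L) \<and>
           (\<forall>X L. reflected_process M F W x (\<lambda>t \<omega>. - \<kappa>) X L \<longrightarrow>
              discounted_cost M lam f X = value_function M F W \<kappa> lam f x \<and>
              (AE \<omega> in M. \<forall>t\<ge>0. X t \<omega> = x + W t \<omega> - \<kappa> * t + L t \<omega>))))"
proof -
  interpret S: standard_brownian_motion M F W by fact
  obtain F' W' where BM: "continuous_brownian_motion M F' W'" and W': "AE \<omega> in M. \<forall>t\<ge>0. W' t \<omega> = W t \<omega>"
    using S.continuous_version by blast
  \<comment> \<open>The negative root of \<gamma>^2 / 2 - \<kappa> \<gamma> = lam, and the exponent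
    in both closed formulas.\<close>
  define \<gamma> where "\<gamma> = \<kappa> - sqrt (\<kappa>\<^sup>2 + 2 * lam)"
  then have root: "sqrt (\<kappa>\<^sup>2 + 2 * lam) = \<kappa> - \<gamma>" by simp
  have "\<kappa> < sqrt (\<kappa>\<^sup>2 + 2 * lam)" using assms by (intro real_less_rsqrt) auto
  then have neg: "\<gamma> < 0" by (simp add: \<gamma>_def)
  have "(sqrt (\<kappa>\<^sup>2 + 2 * lam))\<^sup>2 = \<kappa>\<^sup>2 + 2 * lam" using assms by simp
  then have "(\<kappa> - \<gamma>)\<^sup>2 = \<kappa>\<^sup>2 + 2 * lam" by (simp add: \<gamma>_def)
  then have eq: "\<gamma>\<^sup>2 / 2 - \<kappa> * \<gamma> = lam" by (simp add: power2_diff)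
  interpret reflection_control_problem M F W F' W' \<kappa> lam \<gamma>
    by (intro reflection_control_problem.intro discounted_brownian_motion.intro drifted_brownian_motion.intro
        discounted_brownian_motion_axioms.intro reflection_control_problem_axioms.intro BM W' neg eq assms)
  have linear: "value_function M F W \<kappa> lam (\<lambda>y. y) x = ereal (B.linear_cost x)"
    "reflected_process M F W x (\<lambda>t \<omega>. - \<kappa>) Z l \<Longrightarrow> discounted_cost M lam (\<lambda>y. y) Z = ereal (B.linear_cost x)"
    if "0 \<le> x" for x Z l
    using value_function_eq[of x "\<lambda>y. y" "B.linear_cost x"] that B.linear_cost_nonneg B.nn_cost_linear
    by (auto simp: mono_on_def)
  have quadratic: "value_function M F W \<kappa> lam (\<lambda>y. y\<^sup>2) x = ereal (B.quadratic_cost x)"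
    "reflected_process M F W x (\<lambda>t \<omega>. - \<kappa>) Z l \<Longrightarrow> discounted_cost M lam (\<lambda>y. y\<^sup>2) Z = ereal (B.quadratic_cost x)"
    if "0 \<le> x" for x Z l
    using value_function_eq[of x "\<lambda>y. y\<^sup>2" "B.quadratic_cost x"] that B.discounted_mean_X_square(2) B.nn_cost_quadratic
    by (auto simp: mono_on_def power_mono)
  \<comment> \<open>The closed form is available for y \<ge> 0 only, so the derivative is
    transferred inside the open half-line.\<close>
  have deriv: "((\<lambda>y. real_of_ereal (value_function M F W \<kappa> lam f y)) has_real_derivative d) (at x)"
    if "\<And>y. 0 \<le> y \<Longrightarrow> value_function M F W \<kappa> lam f y = ereal (c y)" "(c has_real_derivative d) (at x)" "0 < x" for f c d x
    by (rule has_field_derivative_transform_within_open[OF that(2), of "{0<..}"]) (use that in auto)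
  have state: "AE \<omega> in M. \<forall>t\<ge>0. Z t \<omega> = x + W t \<omega> - \<kappa> * t + l t \<omega>"
    if "reflected_process M F W x (\<lambda>t \<omega>. - \<kappa>) Z l" for x Z l
    using that unfolding reflected_process_def by (auto simp: LBINT_const elim!: eventually_mono)
  show ?thesis
  proof (intro conjI ballI)
    show "\<forall>x\<ge>0. value_function M F W \<kappa> lam (\<lambda>y. y) x =
        ereal (exp ((\<kappa> - sqrt (\<kappa>\<^sup>2 + 2 * lam)) * x) / (lam * (- \<kappa> + sqrt (\<kappa>\<^sup>2 + 2 * lam))) + x / lam - \<kappa> / lam\<^sup>2)"
      unfolding root using linear(1) by (simp add: B.linear_cost_def mult.commute)
    show "\<forall>x\<ge>0. value_function M F W \<kappa> lam (\<lambda>y. y\<^sup>2) x =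
        ereal (2 * \<kappa> * exp ((\<kappa> - sqrt (\<kappa>\<^sup>2 + 2 * lam)) * x) / (lam\<^sup>2 * (\<kappa> - sqrt (\<kappa>\<^sup>2 + 2 * lam)))
               + x\<^sup>2 / lam - 2 * \<kappa> * x / lam\<^sup>2 + (2 * \<kappa>\<^sup>2 + lam) / lam^3)"
      unfolding root using quadratic(1) by (simp add: B.quadratic_cost_eq)
    fix f :: "real \<Rightarrow> real" assume f: "f \<in> {\<lambda>y. y, \<lambda>y. y\<^sup>2}"
    show "\<forall>x>0. \<exists>D>0. ((\<lambda>y. real_of_ereal (value_function M F W \<kappa> lam f y)) has_real_derivative D) (at x)"
      using f deriv[OF linear(1) B.linear_cost_deriv] B.linear_cost_deriv_pos
        deriv[OF quadratic(1) B.quadratic_cost_deriv] B.quadratic_cost_deriv_pos by blast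
    show "(\<lambda>t \<omega>. - \<kappa>) \<in> controls M F \<kappa>" by (rule constant_control)
    show "\<forall>x\<ge>0. (\<exists>X L. reflected_process M F W x (\<lambda>t \<omega>. - \<kappa>) X L) \<and>
           (\<forall>X L. reflected_process M F W x (\<lambda>t \<omega>. - \<kappa>) X L \<longrightarrow>
              discounted_cost M lam f X = value_function M F W \<kappa> lam f x \<and>
              (AE \<omega> in M. \<forall>t\<ge>0. X t \<omega> = x + W t \<omega> - \<kappa> * t + L t \<omega>))"
      using f reflected_process_exists linear quadratic state by auto
  qed
qed

end
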